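(* Suppose that $f$ is a transcendental entire function of the form $$f(z) = c z^q \prod_{n=1}^\infty \left(1 + \frac{z}{a_n}\right), \quad \text{where } c\in\mathbb{C}\setminus\{0\},\ q\in\{0,1,\ldots\},\ a_n\in\mathbb{C}, \text{ and } 0<|a_1|\leq |a_2|\leq\cdots,$$ and $f$ has genus zero. Suppose that there exist positive constants $\theta_1$ and $\theta_2$ with $0 \leq \theta_2 - \theta_1 < \pi$, and also $N_0\in\mathbb{N}$, such that $$\arg(a_n) \in [\theta_1, \theta_2] \mod 2\pi , \quad\text{for } n\geq N_0.$$ Suppose also that $f$ has no multiply connected Fatou components. Then $$\dim_H \bigl(J(f)\cap A(f)\bigr) = 2.$$
   Context: The function $f$ has genus zero: $\sum_n 1/|a_n|<\infty$, so the infinite product converges locally uniformly on $\mathbb{C}$. For $z\neq 0$, $\arg(z)\in(-\pi,\pi]$ is the principal argument; "$\arg(a_n)\in[\theta_1,\theta_2] \mod 2\pi$" means that $\arg(a_n)+2\pi k\in[\theta_1,\theta_2]$ for some integer $k$. The Fatou set $F(f)$ is the set of points $z\in\mathbb{C}$ such that the iterates $(f^n)_{n\in\mathbb{N}}$ form a normal family in a neighbourhood of $z$; its connected components are called Fatou components. The Julia set is $J(f)=\mathbb{C}\setminus F(f)$. The maximum modulus function is $M(r,f)=\max_{|z|=r}|f(z)|$ for $r\ge 0$, and $M^n(r,f)$ denotes the $n$-th iterate of $r\mapsto M(r,f)$ in the variable $r$. The fast escaping set is $$A(f) = \{z : \text{there exists } \ell \in\mathbb{N} \text{ such that } |f^{n+\ell}(z)|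 \geq M^n(R,f) \text{ for all } n \in\mathbb{N}\},$$ where $R>0$ is any number such that $M(r,f)>r$ for $r\ge R$ (the set does not depend on the choice of $R$). $\dim_H$ denotes Hausdorff dimension. *)

theory Defs
  imports "HOL-Complex_Analysis.Complex_Analysis"
begin

section \<open>Hausdorff dimension\<close>

text \<open>
  The contribution of one covering set is its diameter to the power \<open>s\<close>, with the usual
  conventions for \<open>s = 0\<close>: the empty set contributes 0 and every nonempty set contributes 1
  (\<^const>\<open>powr\<close> alone would give \<open>0 powr 0 = 0\<close> for singletons).
  Boundedness of the covering sets is required explicitly because \<^const>\<open>diameter\<close> is
  unspecified on unbounded sets.
\<close>

definition diam_pow :: "real \<Rightarrow> 'a::metric_space set \<Rightarrow> ennreal" where
  "diam_pow s U =
     (if U = {} then 0 else if s = 0 then 1 else ennreal (diameter U powr s))"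

definition hausdorff_premeasure :: "real \<Rightarrow> real \<Rightarrow> 'a::metric_space set \<Rightarrow> ennreal" where
  "hausdorff_premeasure s \<delta> A =
     (INF U \<in> {U :: nat \<Rightarrow> 'a set. A \<subseteq> (\<Union>i. U i) \<and> (\<forall>i. bounded (U i) \<and> diameter (U i) \<le> \<delta>)}.
        \<Sum>i. diam_pow s (U i))"

definition hausdorff_measure :: "real \<Rightarrow> 'a::metric_space set \<Rightarrow> ennreal" where
  "hausdorff_measure s A = (SUP \<delta> \<in> {0<..}. hausdorff_premeasure s \<delta> A)"

definition hausdorff_dim :: "'a::metric_space set \<Rightarrow> ennreal" where
  "hausdorff_dim A = (INF s \<in> {s. 0 \<le> s \<and> hausdorff_measure s A = 0}. ennreal s)"


section \<open>Normal families, Fatou and Julia sets\<close>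

text \<open>
  Normality in the sense of Montel for families of analytic functions: the constant limit
  \<open>\<infinity>\<close> is allowed.
\<close>

definition normal_family :: "complex set \<Rightarrow> (complex \<Rightarrow> complex) set \<Rightarrow> bool" where
  "normal_family U \<F> \<longleftrightarrow>
     (\<forall>s :: nat \<Rightarrow> complex \<Rightarrow> complex. range s \<subseteq> \<F> \<longrightarrow>
        (\<exists>r :: nat \<Rightarrow> nat. strict_mono r \<and>
           ((\<exists>g. \<forall>K. compact K \<and> K \<subseteq> U \<longrightarrow> uniform_limit K (\<lambda>n. s (r n)) g sequentially) \<or>
            (\<forall>K. compact K \<and> K \<subseteq> U \<longrightarrow>
               (\<forall>B. \<forall>\<^sub>F n in sequentially. \<forall>z\<in>K. B \<le> norm (s (r n) z))))))"

definition fatou_set :: "(complex \<Rightarrow> complex) \<Rightarrow> complex set" where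
  "fatou_set f = {z. \<exists>U. open U \<and> z \<in> U \<and> normal_family U (range (\<lambda>n. f ^^ n))}"

definition julia_set :: "(complex \<Rightarrow> complex) \<Rightarrow> complex set" where
  "julia_set f = - fatou_set f"

definition multiply_connected :: "complex set \<Rightarrow> bool" where
  "multiply_connected U \<longleftrightarrow> connected U \<and> \<not> simply_connected U"


section \<open>Transcendental entire functions and the fast escaping set\<close>

definition transcendental_entire :: "(complex \<Rightarrow> complex) \<Rightarrow> bool" where
  "transcendental_entire f \<longleftrightarrow> f holomorphic_on UNIV \<and> \<not> (\<exists>p. \<forall>z. f z = poly p z)"

definition max_modulus :: "(complex \<Rightarrow> complex) \<Rightarrow> real \<Rightarrow> real" where
  "max_modulus f r = (SUP z \<in> sphere 0 r. norm (f z))"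

definition admissible_radius :: "(complex \<Rightarrow> complex) \<Rightarrow> real \<Rightarrow> bool" where
  "admissible_radius f R \<longleftrightarrow> R > 0 \<and> (\<forall>r\<ge>R. max_modulus f r > r)"

text \<open>
  The radius \<open>R\<close> is a parameter; the set does not depend on it as long as \<open>R\<close> is an
  admissible radius for \<open>f\<close>.
\<close>

definition fast_escaping_set :: "real \<Rightarrow> (complex \<Rightarrow> complex) \<Rightarrow> complex set" where
  "fast_escaping_set R f =
     {z. \<exists>l::nat. \<forall>n::nat. norm ((f ^^ (n + l)) z) \<ge> (max_modulus f ^^ n) R}"

text \<open>Admissible radii exist for every transcendental entire function.\<close>

lemma norm_le_max_modulus:
  assumes "f holomorphic_on UNIV" "norm z = r"
  shows "norm (f z) \<le> max_modulus f r"
  unfolding max_modulus_def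
proof (rule cSUP_upper)
  have "continuous_on (sphere 0 r) (\<lambda>z. norm (f z))"
    using assms(1) holomorphic_on_imp_continuous_on continuous_on_subset continuous_on_norm
    by (metis subset_UNIV)
  then show "bdd_above ((\<lambda>z. norm (f z)) ` sphere 0 r)"
    by (intro bounded_imp_bdd_above compact_imp_bounded compact_continuous_image) auto
qed (use assms in auto)

lemma ex_admissible_radius:
  assumes "transcendental_entire f"
  shows "\<exists>R. admissible_radius f R"
proof (rule ccontr)
  assume no: "\<not> ?thesis"
  have hol: "f holomorphic_on UNIV"
    using assms by (simp add: transcendental_entire_def)
  have small: "\<exists>r\<ge>R. max_modulus f r \<le> r" if "R > 0" for R
    using no that by (metis admissible_radius_def not_less)
  have zero: "(deriv ^^ n) f 0 = 0" if n: "n \<ge> 2" for n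
  proof (rule ccontr)
    assume nz: "(deriv ^^ n) f 0 \<noteq> 0"
    define d where "d = norm ((deriv ^^ n) f 0)"
    have d: "d > 0" using nz by (simp add: d_def)
    obtain r where r: "r \<ge> 1 + fact n / d" "max_modulus f r \<le> r"
      using small[of "1 + fact n / d"] d by (auto simp: add_pos_nonneg)
    have r1: "r > 1" using r(1) d by (smt (verit) divide_pos_pos fact_gt_zero)
    have "d \<le> fact n * r / r ^ n"
      unfolding d_def
    proof (rule Cauchy_inequality)
      show "f holomorphic_on ball 0 r" using hol holomorphic_on_subset by blast
      show "continuous_on (cball 0 r) f"
        using hol holomorphic_on_imp_continuous_on continuous_on_subset by blast
      show "norm (f x) \<le> r" if "norm (0 - x) = r" for x
        using norm_le_max_modulus[OF hol, of x r] that r(2) by simp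
    qed (use r1 in auto)
    also have "\<dots> \<le> fact n * r / r ^ 2"
      using r1 n by (intro divide_left_mono power_increasing) auto
    also have "\<dots> = fact n / r"
      using r1 by (simp add: power2_eq_square)
    finally have "r * d \<le> fact n" using r1 by (simp add: field_simps)
    moreover have "fact n < r * d" using r(1) d by (simp add: field_simps)
    ultimately show False by simp
  qed
  have "f z = poly [:f 0, deriv f 0:] z" for z
  proof -
    have "(\<lambda>n. (deriv ^^ n) f 0 / fact n * (z - 0) ^ n) sums f z"
      by (rule holomorphic_power_series[where r = "norm z + 1"])
         (use hol holomorphic_on_subset in auto)
    moreover have "(\<lambda>n. (deriv ^^ n) f 0 / fact n * (z - 0) ^ n) sums
        (\<Sum>n\<in>{0,1}. (deriv ^^ n) f 0 / fact n * (z - 0) ^ n)"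
    proof (rule sums_finite)
      fix n :: nat assume "n \<notin> {0, 1}"
      then have "n \<ge> 2" by auto
      then show "(deriv ^^ n) f 0 / fact n * (z - 0) ^ n = 0" by (simp add: zero)
    qed simp
    ultimately show ?thesis
      using sums_unique2 by fastforce
  qed
  then show False
    using assms unfolding transcendental_entire_def by blast
qed

end

theory Submission
  imports Defs "HOL-Real_Asymp.Real_Asymp"
begin

text \<open>
  In a sector around the direction opposite to the zeros every factor satisfies
  \<open>norm (1 + z / a n) \<ge> 1 + \<epsilon> * norm (z / a n)\<close>. Hence \<open>norm (f z)\<close> dominates the maximum modulus at
  radius \<open>\<epsilon> / 2 * norm z\<close>, so that an orbit staying in the sector is fast escaping. The logarithmic
  derivative \<open>K z = z * f' z / f z\<close> is there comparable to
  \<open>\<nu> (ln (norm z)) = (\<Sum>n. norm z / (norm (a n) + norm z))\<close>, which tends to infinity. Expansion along such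
  an orbit, together with Bloch's theorem, puts its starting point into the Julia set when all
  Fatou components are simply connected.

  In the coordinate \<open>ln z\<close>, a square of side comparable to \<open>1 / \<nu>\<close> is mapped with bounded distortion
  over a translate by a multiple of \<open>2 * pi * \<i>\<close> of a square of fixed size in the sector. Thus each
  square contains many preimages of squares of the next level, filling a fixed proportion of its area, while the ratio
  of the sizes of consecutive levels is as small as desired. For \<open>s < 2\<close> and a cover with small
  \<open>s\<close>-dimensional sum one chooses successively squares that meet little of the cover, and obtains an
  uncovered point whose orbit stays in the sector.
\<close>

section \<open>Hausdorff measure and dimension\<close>

text \<open>No mass distribution is built for the lower bound. A cover of small weight is defeated
  directly, by choosing a nested sequence of boxes that escapes it. The loss in each generation is a
  fixed constant, while the number \<open>m^2\<close> of children grows without bound as the sector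
  is cut off farther out. For \<open>s < 2\<close> the surplus \<open>m powr (2 - s)\<close> pays
  for the loss, but only beyond a radius depending on \<open>s\<close>. So the set of orbits under
  consideration changes with \<open>s\<close>; what remains fixed is the set J(f) \<inter> A(f) that
  contains all of them.

  The constants must not deteriorate from one generation to the next. This is arranged by starting
  each generation from a square of the same size \<open>h0\<close> and by making each inverse branch
  so strong a contraction that the distortion bound reproduces itself.

  Finitely many zeros may lie anywhere, even in the sector; far out, their factors are controlled by
  modulus alone. The hypothesis on Fatou components enters where a logarithm of \<open>w - p\<close>
  is needed on a whole component.\<close>

lemma hausdorff_measure_eq_0_iff:
  "hausdorff_measure s A = 0 \<longleftrightarrow> (\<forall>\<delta>>0. hausdorff_premeasure s \<delta> A = 0)"
  unfolding hausdorff_measure_def by (auto simp: SUP_eq_iff bot_ennreal simp flip: bot_ennreal)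

lemma hausdorff_premeasure_mono:
  assumes "A \<subseteq> B"
  shows "hausdorff_premeasure s \<delta> A \<le> hausdorff_premeasure s \<delta> B"
  unfolding hausdorff_premeasure_def
  by (rule INF_superset_mono) (use assms in auto)

lemma hausdorff_measure_mono:
  assumes "A \<subseteq> B"
  shows "hausdorff_measure s A \<le> hausdorff_measure s B"
  unfolding hausdorff_measure_def
  by (rule SUP_mono') (rule hausdorff_premeasure_mono[OF assms])

lemma hausdorff_premeasure_le:
  assumes "A \<subseteq> (\<Union>i. U i)" "\<And>i. bounded (U i)" "\<And>i. diameter (U i) \<le> \<delta>"
  shows "hausdorff_premeasure s \<delta> A \<le> (\<Sum>i::nat. diam_pow s (U i))"
  unfolding hausdorff_premeasure_def by (rule INF_lower) (use assms in auto)

lemma hausdorff_premeasure_less_obtain: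
  assumes "hausdorff_premeasure s \<delta> A < e"
  obtains U :: "nat \<Rightarrow> 'a::metric_space set" where "A \<subseteq> (\<Union>i. U i)" "\<And>i. bounded (U i)"
    "\<And>i. diameter (U i) \<le> \<delta>" "(\<Sum>i. diam_pow s (U i)) < e"
  using assms unfolding hausdorff_premeasure_def INF_less_iff by auto

lemma hausdorff_measure_UN_null:
  fixes A :: "nat \<Rightarrow> 'a::metric_space set"
  assumes "\<And>n. hausdorff_measure s (A n) = 0"
  shows "hausdorff_measure s (\<Union>n. A n) = 0"
  unfolding hausdorff_measure_eq_0_iff
proof (intro allI impI)
  fix \<delta> :: real assume \<delta>: "\<delta> > 0"
  have "hausdorff_premeasure s \<delta> (\<Union>n. A n) \<le> 0 + ennreal e" if e: "e > 0" for e
  proof -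
    have "\<exists>U. A n \<subseteq> (\<Union>i. U i) \<and> (\<forall>i::nat. bounded (U i)) \<and> (\<forall>i. diameter (U i) \<le> \<delta>) \<and>
            (\<Sum>i. diam_pow s (U i)) < ennreal (e * (1/2)^Suc n)" for n
    proof -
      have "hausdorff_premeasure s \<delta> (A n) < ennreal (e * (1/2)^Suc n)"
        using assms[of n] \<delta> e unfolding hausdorff_measure_eq_0_iff by simp
      then show ?thesis by (metis hausdorff_premeasure_less_obtain)
    qed
    then obtain U where U: "\<And>n. A n \<subseteq> (\<Union>i::nat. U n i)" "\<And>n i. bounded (U n i)"
      "\<And>n i. diameter (U n i) \<le> \<delta>" "\<And>n. (\<Sum>i. diam_pow s (U n i)) < ennreal (e * (1/2)^Suc n)"
      by metis
    define V where "V = (\<lambda>i. case_prod U (prod_decode i))"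
    have VU: "V (prod_encode (n, i)) = U n i" for n i by (simp add: V_def)
    have "hausdorff_premeasure s \<delta> (\<Union>n. A n) \<le> (\<Sum>i. diam_pow s (V i))"
    proof (rule hausdorff_premeasure_le)
      show "(\<Union>n. A n) \<subseteq> (\<Union>i. V i)"
      proof
        fix x assume "x \<in> (\<Union>n. A n)"
        then obtain n i where "x \<in> U n i" using U(1) by blast
        then show "x \<in> (\<Union>i. V i)" using VU by blast
      qed
    qed (auto simp: V_def split_beta U)
    also have "\<dots> = (\<Sum>i. (\<lambda>(n, i). diam_pow s (U n i)) (prod_decode i))"
      by (simp add: V_def split_beta)
    also have "\<dots> = (\<Sum>n. \<Sum>i. diam_pow s (U n i))"
      by (rule suminf_ennreal_2dimen) simp
    also have "\<dots> \<le> (\<Sum>n. ennreal (e * (1/2)^Suc n))"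
      by (intro suminf_le) (use U(4) in \<open>auto intro: less_imp_le\<close>)
    also have "\<dots> = ennreal e"
      by (rule suminf_ennreal_eq) (use e sums_mult[OF power_half_series, of e] in auto)
    finally show ?thesis by simp
  qed
  then have "hausdorff_premeasure s \<delta> (\<Union>n. A n) \<le> 0"
    by (rule ennreal_le_epsilon) auto
  then show "hausdorff_premeasure s \<delta> (\<Union>n. A n) = 0" by simp
qed

section \<open>Dimension at most 2 for every subset of the plane\<close>

lemma diam_pow_le:
  fixes U :: "'a::real_normed_vector set"
  assumes "bounded U" "\<And>x y. x \<in> U \<Longrightarrow> y \<in> U \<Longrightarrow> dist x y \<le> d" "0 \<le> d" "s > 0"
  shows "diam_pow s U \<le> ennreal (d powr s)"
proof -
  have "diameter U \<le> d" using assms by (intro diameter_le) (auto simp: dist_norm)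
  then show ?thesis
    using assms diameter_ge_0[OF assms(1)] by (auto simp: diam_pow_def intro!: ennreal_leI powr_mono2)
qed

text \<open>Cutting the square into \<open>n * n\<close> cells of diameter at most
  \<open>2 / n\<close> costs at most \<open>2 powr s * n powr (2 - s)\<close>, which tends to 0
  because \<open>s > 2\<close>.\<close>

lemma hausdorff_measure_unit_square:
  assumes s: "s > 2"
  shows "hausdorff_measure s {z::complex. a \<le> Re z \<and> Re z < a + 1 \<and> b \<le> Im z \<and> Im z < b + 1} = 0"
    (is "hausdorff_measure s ?S = 0")
  unfolding hausdorff_measure_eq_0_iff
proof (intro allI impI)
  fix \<delta> :: real assume \<delta>: "\<delta> > 0"
  define g where "g n = 2 powr s * real n powr (2 - s)" for n
  have bd: "hausdorff_premeasure s \<delta> ?S \<le> ennreal (g n)" if n: "n > 0" "2 / real n \<le> \<delta>" for n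
  proof -
    define C where "C i = {z::complex. a + real (i div n) / n \<le> Re z \<and> Re z \<le> a + real (i div n) / n + 1 / n \<and>
        b + real (i mod n) / n \<le> Im z \<and> Im z \<le> b + real (i mod n) / n + 1 / n}" for i
    define U where "U i = (if i < n * n then C i else {})" for i
    have d: "dist x y \<le> 2 / n" if "x \<in> U i" "y \<in> U i" for x y i
    proof -
      have "\<bar>Re (x - y)\<bar> \<le> 1 / n" "\<bar>Im (x - y)\<bar> \<le> 1 / n"
        using that unfolding U_def C_def by (auto split: if_splits)
      then show ?thesis using cmod_le[of "x - y"] unfolding dist_norm by simp
    qed
    have bdd: "bounded (U i)" for i
      unfolding bounded_any_center[of _ "SOME x. x \<in> U i"] by (metis d someI)
    have "hausdorff_premeasure s \<delta> ?S \<le> (\<Sum>i. diam_pow s (U i))"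
    proof (rule hausdorff_premeasure_le)
      show "?S \<subseteq> (\<Union>i. U i)"
      proof
        fix z assume z: "z \<in> ?S"
        define k where "k = nat \<lfloor>(Re z - a) * n\<rfloor>"
        define l where "l = nat \<lfloor>(Im z - b) * n\<rfloor>"
        have kl: "real k \<le> (Re z - a) * n" "(Re z - a) * n < k + 1" "real l \<le> (Im z - b) * n" "(Im z - b) * n < l + 1"
          using z n unfolding k_def l_def by (simp_all add: of_nat_nat) linarith+
        have "(Re z - a) * n < 1 * n" "(Im z - b) * n < 1 * n"
          using z n by (auto intro!: mult_strict_right_mono)
        then have lt: "k < n" "l < n" using kl by linarith+
        have "k * n + l < n * n"
        proof -
          have "k * n + l < (k + 1) * n" using lt by simp
          also have "\<dots> \<le> n * n" using lt by (intro mult_right_mono) auto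
          finally show ?thesis .
        qed
        moreover have "z \<in> C (k * n + l)"
          using kl lt n unfolding C_def by (simp add: field_simps)
        ultimately have "z \<in> U (k * n + l)" by (simp add: U_def)
        then show "z \<in> (\<Union>i. U i)" by blast
      qed
      show "bounded (U i)" for i by (rule bdd)
      show "diameter (U i) \<le> \<delta>" for i
      proof -
        have "diameter (U i) \<le> 2 / n" using n d by (intro diameter_le) (auto simp: dist_norm)
        then show ?thesis using n by simp
      qed
    qed
    also have "\<dots> = (\<Sum>i<n*n. diam_pow s (U i))"
      by (rule suminf_finite) (auto simp: U_def diam_pow_def)
    also have "\<dots> \<le> (\<Sum>i<n*n. ennreal ((2 / n) powr s))"
      using d bdd s by (intro sum_mono diam_pow_le) auto
    also have "\<dots> = ennreal (n * n * (2 / n) powr s)"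
      by (simp add: ennreal_of_nat_eq_real_of_nat ennreal_mult flip: of_nat_mult)
    also have "ennreal (n * n * (2 / n) powr s) = ennreal (g n)"
      using n by (simp add: g_def powr_diff powr_divide power2_eq_square)
    finally show ?thesis .
  qed
  have "g \<longlonglongrightarrow> 2 powr s * 0"
    unfolding g_def by (intro tendsto_intros tendsto_neg_powr filterlim_real_sequentially) (use s in auto)
  then have lim: "(\<lambda>n. ennreal (g n)) \<longlonglongrightarrow> ennreal 0"
    by (intro tendsto_ennrealI) simp
  have ev: "\<forall>\<^sub>F n in sequentially. hausdorff_premeasure s \<delta> ?S \<le> ennreal (g n)"
    using eventually_ge_at_top[of "nat \<lceil>2/\<delta>\<rceil> + 1"]
  proof eventually_elim
    case (elim n)
    have "2 / \<delta> \<le> n" using elim by linarith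
    then show ?case using elim \<delta> by (intro bd) (auto simp: field_simps)
  qed
  have "hausdorff_premeasure s \<delta> ?S \<le> ennreal 0"
    using lim ev by (intro tendsto_lowerbound[of "\<lambda>n. ennreal (g n)" _ sequentially]) auto
  then show "hausdorff_premeasure s \<delta> ?S = 0" by simp
qed

lemma hausdorff_dim_complex_le: "hausdorff_dim (A :: complex set) \<le> 2"
proof (rule ennreal_le_epsilon)
  fix e :: real assume e: "e > 0"
  define S where "S = (\<lambda>(k::int, l::int). {z::complex. real_of_int k \<le> Re z \<and> Re z < real_of_int k + 1 \<and>
      real_of_int l \<le> Im z \<and> Im z < real_of_int l + 1})"
  have "hausdorff_measure (2 + e) (\<Union>n. S (from_nat n)) = 0"
    using hausdorff_measure_unit_square[of "2 + e"] e
    by (intro hausdorff_measure_UN_null) (auto simp: S_def split: prod.split)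
  moreover have "A \<subseteq> (\<Union>n. S (from_nat n))"
  proof
    fix z
    have "z \<in> S (\<lfloor>Re z\<rfloor>, \<lfloor>Im z\<rfloor>)" by (auto simp: S_def)
    then have "z \<in> S (from_nat (to_nat (\<lfloor>Re z\<rfloor>, \<lfloor>Im z\<rfloor>)))" by simp
    then show "z \<in> (\<Union>n. S (from_nat n))" by blast
  qed
  ultimately have "hausdorff_measure (2 + e) A = 0"
    using hausdorff_measure_mono by (metis le_zero_eq)
  then have "hausdorff_dim A \<le> ennreal (2 + e)"
    unfolding hausdorff_dim_def using e by (intro INF_lower) auto
  also have "\<dots> = 2 + ennreal e" using e by (subst ennreal_plus) auto
  finally show "hausdorff_dim A \<le> 2 + ennreal e" .
qed

section \<open>Criteria for lower bounds on the dimension\<close>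

lemma hausdorff_measure_null_mono:
  assumes "hausdorff_measure s A = 0" "s \<le> t" "0 < t"
  shows "hausdorff_measure t A = 0"
  unfolding hausdorff_measure_eq_0_iff
proof (intro allI impI)
  fix \<delta> :: real assume \<delta>: "\<delta> > 0"
  \<comment> \<open>For sets of diameter at most 1 the weights decrease in the exponent. Restricting
    to such covers is free, since the premeasures of exponent \<open>s\<close> vanish at every
    scale.\<close>
  have "hausdorff_premeasure t \<delta> A \<le> hausdorff_premeasure s (min \<delta> 1) A"
    unfolding hausdorff_premeasure_def
  proof (rule INF_mono)
    fix U :: "nat \<Rightarrow> 'a set"
    assume U: "U \<in> {U. A \<subseteq> (\<Union>i. U i) \<and> (\<forall>i. bounded (U i) \<and> diameter (U i) \<le> min \<delta> 1)}"
    have "diam_pow t (U i) \<le> diam_pow s (U i)" for i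
    proof -
      have "0 \<le> diameter (U i)" "diameter (U i) \<le> 1"
        using U diameter_ge_0 by auto
      then have "diameter (U i) powr t \<le> diameter (U i) powr s" "diameter (U i) powr t \<le> 1"
        using assms by (auto intro: powr_mono' powr_le1)
      then show ?thesis using assms by (auto simp: diam_pow_def ennreal_leI)
    qed
    then show "\<exists>V\<in>{U. A \<subseteq> (\<Union>i. U i) \<and> (\<forall>i. bounded (U i) \<and> diameter (U i) \<le> \<delta>)}.
        (\<Sum>i. diam_pow t (V i)) \<le> (\<Sum>i. diam_pow s (U i))"
      using U by (intro bexI[of _ U] suminf_le) auto
  qed
  also have "\<dots> = 0" using assms(1) \<delta> by (simp add: hausdorff_measure_eq_0_iff)
  finally show "hausdorff_premeasure t \<delta> A = 0" by simp
qed

text \<open>Raising an exponent to \<open>max s 1\<close> preserves nullity, so exponents below 1,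
  including \<open>s = 0\<close> with its special convention, need no separate treatment.\<close>

lemma hausdorff_dim_geI:
  assumes "\<And>s. 1 \<le> s \<Longrightarrow> s < d \<Longrightarrow> hausdorff_measure s A \<noteq> 0" "1 < d"
  shows "ennreal d \<le> hausdorff_dim A"
  unfolding hausdorff_dim_def
proof (rule INF_greatest)
  fix s assume s: "s \<in> {s. 0 \<le> s \<and> hausdorff_measure s A = 0}"
  have "d \<le> s"
  proof (rule ccontr)
    assume "\<not> d \<le> s"
    moreover have "hausdorff_measure (max s 1) A = 0"
      by (rule hausdorff_measure_null_mono[of s]) (use s in auto)
    moreover have "1 \<le> max s 1" by simp
    moreover have "max s 1 < d" using \<open>\<not> d \<le> s\<close> assms(2) by linarith
    ultimately show False using assms(1)[of "max s 1"] by blast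
  qed
  then show "ennreal d \<le> ennreal s" by (rule ennreal_leI)
qed

text \<open>A null set has covers of arbitrarily small weight. Each covering set lies in a ball
  about one of its points with radius slightly above its diameter, so it is enough to defeat covers
  by balls.\<close>

lemma hausdorff_measure_nonzeroI:
  fixes A :: "'a::metric_space set"
  assumes s: "0 < s" and e: "0 < e"
    and no_cover: "\<And>y r. \<lbrakk>\<And>i::nat. 0 < r i; summable (\<lambda>i. r i powr s); (\<Sum>i. r i powr s) < e\<rbrakk>
      \<Longrightarrow> \<not> A \<subseteq> (\<Union>i. ball (y i) (r i))"
  shows "hausdorff_measure s A \<noteq> 0"
proof
  assume "hausdorff_measure s A = 0"
  then have "hausdorff_premeasure s 1 A < ennreal (e/2)"
    using e by (simp add: hausdorff_measure_eq_0_iff)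
  then obtain U :: "nat \<Rightarrow> 'a set" where U: "A \<subseteq> (\<Union>i. U i)" "\<And>i. bounded (U i)"
    "(\<Sum>i. diam_pow s (U i)) < ennreal (e/2)"
    by (metis hausdorff_premeasure_less_obtain)
  define D where "D i = diameter (U i)" for i
  have D0: "0 \<le> D i" for i using U(2) diameter_ge_0 by (auto simp: D_def)
  have "diam_pow s (U i) = ennreal (D i powr s)" for i
    using s by (auto simp: D_def diam_pow_def)
  then have sum: "(\<Sum>i. ennreal (D i powr s)) < ennreal (e/2)" using U(3) by simp
  then have summ: "summable (\<lambda>i. D i powr s)"
    by (intro summable_suminf_not_top) auto
  have "ennreal (\<Sum>i. D i powr s) < ennreal (e/2)"
    using sum by (subst (asm) suminf_ennreal2[OF _ summ]) auto
  then have sumD: "(\<Sum>i. D i powr s) < e/2"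
    by (subst (asm) ennreal_less_iff) (auto intro: suminf_nonneg summ)
  \<comment> \<open>The padding is added to the \<open>s\<close>-th powers, where it sums to
    \<open>e/2\<close>. It makes every radius positive and larger than the diameter, even for empty
    sets and singletons.\<close>
  define r where "r i = (D i powr s + e/2 * (1/2)^Suc i) powr (1/s)" for i
  define y where "y i = (SOME x. x \<in> U i)" for i
  have rs: "r i powr s = D i powr s + e/2 * (1/2)^Suc i" for i
    using s e unfolding r_def by (simp add: powr_powr add_nonneg_nonneg)
  have "(\<lambda>i. e/2 * (1/2)^Suc i) sums (e/2 * 1)"
    by (rule sums_mult[OF power_half_series])
  then have "(\<lambda>i. r i powr s) sums ((\<Sum>i. D i powr s) + e/2 * 1)"
    unfolding rs by (intro sums_add summable_sums summ)
  then have r_sum: "summable (\<lambda>i. r i powr s)" "(\<Sum>i. r i powr s) < e"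
    using sumD by (auto simp: sums_iff)
  have rD: "D i < r i" for i
  proof (rule ccontr)
    assume "\<not> D i < r i"
    then have "r i powr s \<le> D i powr s" using s by (intro powr_mono2) (auto simp: r_def)
    moreover have "0 < e/2 * (1/2)^Suc i" using e by simp
    ultimately show False using rs[of i] by linarith
  qed
  have "U i \<subseteq> ball (y i) (r i)" for i
  proof
    fix x assume x: "x \<in> U i"
    then have "y i \<in> U i" unfolding y_def by (rule someI)
    then have "dist (y i) x \<le> D i"
      using x U(2) unfolding D_def by (intro diameter_bounded_bound) auto
    then show "x \<in> ball (y i) (r i)" using rD[of i] by simp
  qed
  then have "A \<subseteq> (\<Union>i. ball (y i) (r i))"
    by (intro order_trans[OF U(1)] UN_mono) simp_all
  moreover have "\<not> A \<subseteq> (\<Union>i. ball (y i) (r i))"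
  proof (rule no_cover)
    show "0 < r i" for i by (rule le_less_trans[OF D0 rD])
  qed (fact r_sum)+
  ultimately show False by contradiction
qed

section \<open>A covering game on nested families of sets\<close>

text \<open>With exponent \<open>s < 2\<close>, the balls larger than the scale \<open>l\<close> of the children meet at most half
  of the children, and the remaining balls are shared by few children each, so that one of the
  children inherits the bound on the total weight of the balls meeting it.\<close>

lemma exists_child_meeting_little:
  fixes Q :: "'i \<Rightarrow> 'a::metric_space set" and y :: "nat \<Rightarrow> 'a" and r :: "nat \<Rightarrow> real"
  assumes s: "0 < s" "s < 2" and J: "finite J" "card J = m\<^sup>2" and m: "0 < m"
    and C: "0 < C" and l: "0 < l" and d: "0 < d" and c1: "0 < c1" "c1 * d \<le> l * m"
    and count: "\<And>x t. 0 < t \<Longrightarrow> real (card {j \<in> J. Q j \<inter> ball x t \<noteq> {}}) \<le> C * max 1 ((t / l)\<^sup>2)"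
    and sub: "\<And>j. j \<in> J \<Longrightarrow> Q j \<subseteq> P"
    and r: "\<And>i. 0 < r i" and summ: "summable (\<lambda>i. r i powr s)"
    and W: "(\<Sum>i. if P \<inter> ball (y i) (r i) \<noteq> {} then r i powr s else 0) < c * d powr s"
    and c: "0 < c" "c \<le> 1" "2 * C * c \<le> c1\<^sup>2"
    and m_large: "2 * C < (c1 / 2) powr s * real m powr (2 - s)"
  shows "\<exists>j\<in>J. (\<Sum>i. if Q j \<inter> ball (y i) (r i) \<noteq> {} then r i powr s else 0) < c * (l / 2) powr s"
proof -
  define w where "w = (\<lambda>S i. if S \<inter> ball (y i) (r i) \<noteq> {} then r i powr s else 0)"
  have w0: "0 \<le> w S i" for S i by (simp add: w_def)
  have wsumm: "summable (w S)" for S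
    by (rule summable_comparison_test'[OF summ, of 0]) (simp add: w_def)
  have wP: "suminf (w P) < c * d powr s" using W by (simp add: w_def)
  have wPi: "w P i < c * d powr s" for i
  proof -
    have "sum (w P) {i} \<le> suminf (w P)" by (rule sum_le_suminf[OF wsumm]) (auto simp: w0)
    then show ?thesis using wP by simp
  qed
  \<comment> \<open>\<open>B\<close> collects the children met by some ball of radius at least
    \<open>l\<close>, \<open>G\<close> the others. The members of \<open>B\<close> are counted; over
    \<open>G\<close> the weights are averaged.\<close>
  define B where "B = {j \<in> J. \<exists>i. l \<le> r i \<and> Q j \<inter> ball (y i) (r i) \<noteq> {}}"
  define G where "G = J - B"
  have fin: "finite B" "finite G" using J by (auto simp: B_def G_def)
  define b where "b j i = (if l \<le> r i \<and> Q j \<inter> ball (y i) (r i) \<noteq> {} then 1 else (0::real))" for j i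
  have count_if: "(\<Sum>j\<in>K. if Q j \<inter> ball (y i) (r i) \<noteq> {} then v else 0) \<le> C * max 1 ((r i / l)\<^sup>2) * v"
    if "K \<subseteq> J" "0 \<le> v" for K i and v :: real
  proof -
    have "(\<Sum>j\<in>K. if Q j \<inter> ball (y i) (r i) \<noteq> {} then v else 0)
        \<le> (\<Sum>j\<in>J. if Q j \<inter> ball (y i) (r i) \<noteq> {} then v else 0)"
      using that J by (intro sum_mono2) auto
    also have "\<dots> = (\<Sum>j\<in>{j \<in> J. Q j \<inter> ball (y i) (r i) \<noteq> {}}. v)"
      by (rule sum.inter_filter[OF J(1), symmetric])
    also have "\<dots> = card {j \<in> J. Q j \<inter> ball (y i) (r i) \<noteq> {}} * v" by simp
    also have "\<dots> \<le> C * max 1 ((r i / l)\<^sup>2) * v"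
      using count[OF r] that by (intro mult_right_mono) auto
    finally show ?thesis .
  qed
  \<comment> \<open>A large ball meets at most \<open>C * (r i / l)^2\<close> children. Splitting
    \<open>r^2\<close> into \<open>r powr (2 - s) * r powr s\<close> and using \<open>r < d\<close>
    turns this count into a multiple of the weight of the ball.\<close>
  have bsum: "(\<Sum>j\<in>B. b j i) \<le> C / l\<^sup>2 * d powr (2 - s) * w P i" for i
  proof (cases "l \<le> r i \<and> P \<inter> ball (y i) (r i) \<noteq> {}")
    case True
    then have wi: "w P i = r i powr s" by (simp add: w_def)
    have "r i powr s < d powr s"
      using wPi[of i] c mult_right_mono[of c 1 "d powr s"] unfolding wi by simp
    then have "r i < d" using s r[of i] d by (metis less_imp_le powr_mono2 not_less)
    have "(\<Sum>j\<in>B. b j i) = (\<Sum>j\<in>B. if Q j \<inter> ball (y i) (r i) \<noteq> {} then 1 else 0)"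
      using True by (intro sum.cong) (auto simp: b_def)
    also have "\<dots> \<le> C * max 1 ((r i / l)\<^sup>2) * 1"
      by (rule count_if) (auto simp: B_def)
    also have "max 1 ((r i / l)\<^sup>2) = (r i / l)\<^sup>2"
      using True l by (intro max_absorb2 one_le_power) auto
    also have "C * (r i / l)\<^sup>2 * 1 = C / l\<^sup>2 * r i powr (2 - s) * r i powr s"
      using r[of i] by (simp add: power_divide flip: powr_add powr_numeral)
    also have "\<dots> \<le> C / l\<^sup>2 * d powr (2 - s) * r i powr s"
      using \<open>r i < d\<close> r[of i] s C by (intro mult_right_mono mult_left_mono powr_mono2) auto
    finally show ?thesis by (simp add: wi)
  next
    case False
    then have "b j i = 0" if "j \<in> B" for j
      using that sub unfolding B_def b_def by auto
    then show ?thesis using C w0[of P i] by (simp add: zero_le_mult_iff)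
  qed
  \<comment> \<open>A crude bound, made for the summability that permits exchanging the two
    sums.\<close>
  have bw: "b j i \<le> w P i / l powr s" if "j \<in> B" for j i
  proof (cases "l \<le> r i \<and> Q j \<inter> ball (y i) (r i) \<noteq> {}")
    case True
    then have "w P i = r i powr s" using that sub by (auto simp: w_def B_def)
    then show ?thesis using True l s by (auto simp: b_def intro!: powr_mono2)
  qed (use w0 in \<open>auto simp: b_def\<close>)
  have bsumm: "summable (b j)" if "j \<in> B" for j
  proof (rule summable_comparison_test'[OF summable_divide[OF wsumm]])
    fix i
    have "norm (b j i) = b j i" by (simp add: b_def)
    then show "norm (b j i) \<le> w P i / l powr s" using bw[OF that] by simp
  qed
  have "real (card B) = (\<Sum>j\<in>B. 1)" by simp
  also have "\<dots> \<le> (\<Sum>j\<in>B. suminf (b j))"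
  proof (rule sum_mono)
    fix j assume j: "j \<in> B"
    then obtain i where "l \<le> r i \<and> Q j \<inter> ball (y i) (r i) \<noteq> {}" unfolding B_def by blast
    then have "b j i = 1" by (simp add: b_def)
    then show "1 \<le> suminf (b j)"
      using sum_le_suminf[OF bsumm[OF j], of "{i}"] by (simp add: b_def)
  qed
  also have "\<dots> = (\<Sum>i. \<Sum>j\<in>B. b j i)"
    by (rule suminf_sum[symmetric]) (rule bsumm)
  also have "\<dots> \<le> (\<Sum>i. C / l\<^sup>2 * d powr (2 - s) * w P i)"
    by (intro suminf_le bsum summable_sum bsumm summable_mult wsumm)
  also have "\<dots> = C / l\<^sup>2 * d powr (2 - s) * suminf (w P)"
    by (rule suminf_mult[OF wsumm])
  also have "\<dots> \<le> C / l\<^sup>2 * d powr (2 - s) * (c * d powr s)"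
    using C wP by (intro mult_left_mono) auto
  also have "\<dots> = C * c * d\<^sup>2 / l\<^sup>2"
    using d by (simp add: mult_ac flip: powr_add powr_numeral)
  \<comment> \<open>\<open>c1 * d \<le> l * m\<close> turns \<open>d^2 / l^2\<close> into
    \<open>m^2 / c1^2\<close>, and \<open>2 * C * c \<le> c1^2\<close> leaves a factor of at most
    1/2.\<close>
  also have "\<dots> \<le> real m ^ 2 / 2"
  proof -
    have "2 * C * c * d\<^sup>2 \<le> c1\<^sup>2 * d\<^sup>2" using c by (intro mult_right_mono) auto
    also have "\<dots> \<le> (l * m)\<^sup>2"
      using c1 d by (auto simp flip: power_mult_distrib intro!: power_mono)
    finally show ?thesis using l by (simp add: field_simps power_mult_distrib)
  qed
  finally have cardB: "real (card B) \<le> real m ^ 2 / 2" .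
  have "B \<subseteq> J" by (auto simp: B_def)
  then have "real (card G) = real m ^ 2 - card B"
    unfolding G_def using J card_mono[of J B] fin by (simp add: card_Diff_subset of_nat_diff)
  then have cardG: "real m ^ 2 / 2 \<le> card G" using cardB by simp
  have gsum: "(\<Sum>j\<in>G. w (Q j) i) \<le> C * w P i" for i
  proof (cases "r i < l \<and> P \<inter> ball (y i) (r i) \<noteq> {}")
    case True
    have "(\<Sum>j\<in>G. w (Q j) i) \<le> C * max 1 ((r i / l)\<^sup>2) * r i powr s"
      unfolding w_def by (rule count_if) (auto simp: G_def)
    also have "max 1 ((r i / l)\<^sup>2) = 1"
      using True l r[of i] by (intro max_absorb1 power_le_one) auto
    finally show ?thesis using True by (simp add: w_def)
  next
    case False
    have "w (Q j) i = 0" if j: "j \<in> G" for j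
    proof (cases "r i < l")
      case True
      then have "P \<inter> ball (y i) (r i) = {}" using False by simp
      moreover have "Q j \<subseteq> P" using j sub by (simp add: G_def)
      ultimately have "Q j \<inter> ball (y i) (r i) = {}" by blast
      then show ?thesis by (simp add: w_def)
    next
      case False
      then have "Q j \<inter> ball (y i) (r i) = {}" using j unfolding G_def B_def by simp
      then show ?thesis by (simp add: w_def)
    qed
    then show ?thesis using C w0[of P i] by (simp add: zero_le_mult_iff)
  qed
  have "(\<Sum>j\<in>G. suminf (w (Q j))) = (\<Sum>i. \<Sum>j\<in>G. w (Q j) i)"
    by (rule suminf_sum[symmetric]) (rule wsumm)
  also have "\<dots> \<le> (\<Sum>i. C * w P i)"
    by (intro suminf_le gsum summable_sum wsumm summable_mult)
  also have "\<dots> = C * suminf (w P)" by (rule suminf_mult[OF wsumm])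
  also have "\<dots> < C * (c * d powr s)" using C wP by simp
  \<comment> \<open>Here \<open>s < 2\<close> pays: replacing \<open>d\<close> by \<open>l\<close>
    costs \<open>m powr s\<close>, but there are \<open>m^2\<close> children, and the surplus
    \<open>m powr (2 - s)\<close> absorbs \<open>C\<close> and \<open>c1\<close>.\<close>
  also have "\<dots> \<le> real m ^ 2 / 2 * (c * (l / 2) powr s)"
  proof -
    have "2 * C * d powr s \<le> (c1 / 2) powr s * real m powr (2 - s) * d powr s"
      using m_large by (intro mult_right_mono) auto
    also have "\<dots> = real m powr (2 - s) * (c1 * d / 2) powr s"
      using c1 d by (simp add: powr_mult powr_divide)
    also have "\<dots> \<le> real m powr (2 - s) * (l * m / 2) powr s"
      using c1 d s by (intro mult_left_mono powr_mono2) auto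
    also have "\<dots> = real m powr 2 * (l / 2) powr s"
      using m l by (simp add: powr_mult powr_divide powr_diff)
    finally have "2 * C * d powr s \<le> real m ^ 2 * (l / 2) powr s"
      using m by simp
    then have "c * (2 * C * d powr s) \<le> c * (real m ^ 2 * (l / 2) powr s)"
      using c by (intro mult_left_mono) auto
    then show ?thesis by (simp add: algebra_simps)
  qed
  also have "\<dots> \<le> real (card G) * (c * (l / 2) powr s)"
    using cardG c by (intro mult_right_mono) auto
  finally have lt: "(\<Sum>j\<in>G. suminf (w (Q j))) < real (card G) * (c * (l / 2) powr s)" .
  have "\<exists>j\<in>G. suminf (w (Q j)) < c * (l / 2) powr s"
  proof (rule ccontr)
    assume "\<not> ?thesis"
    then have "(\<Sum>j\<in>G. c * (l / 2) powr s) \<le> (\<Sum>j\<in>G. suminf (w (Q j)))"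
      by (intro sum_mono) force
    then show False using lt by simp
  qed
  then show ?thesis by (auto simp: G_def w_def)
qed

text \<open>The bound \<open>c * d powr s\<close> on the weight of the balls meeting the current set
  passes to a suitable child. A ball containing the limit point would be counted at every stage,
  although these bounds tend to 0. The threshold \<open>e\<close> is the bound for the initial
  set.\<close>

lemma nested_sets_avoid_balls:
  fixes Q :: "'st \<Rightarrow> 'a::heine_borel set" and d :: "'st \<Rightarrow> real"
    and valid :: "'st \<Rightarrow> bool" and succ :: "'st \<Rightarrow> 'st \<Rightarrow> bool"
  assumes s: "0 < s" "s < 2" and C: "0 < C" and c1: "0 < c1"
    and valid: "\<And>\<sigma>. valid \<sigma> \<Longrightarrow> 0 < d \<sigma> \<and> compact (Q \<sigma>) \<and> Q \<sigma> \<noteq> {}"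
    and step: "\<And>\<sigma>. valid \<sigma> \<Longrightarrow> \<exists>(J :: 'i set) m l ch. finite J \<and> card J = m\<^sup>2 \<and> 0 < m \<and> 0 < l \<and> c1 * d \<sigma> \<le> l * real m \<and>
        2 * C < (c1 / 2) powr s * real m powr (2 - s) \<and>
        (\<forall>j\<in>J. valid (ch j) \<and> succ \<sigma> (ch j) \<and> Q (ch j) \<subseteq> Q \<sigma> \<and> l / 2 \<le> d (ch j) \<and> d (ch j) \<le> d \<sigma> / 2) \<and>
        (\<forall>x t. 0 < t \<longrightarrow> real (card {j \<in> J. Q (ch j) \<inter> ball x t \<noteq> {}}) \<le> C * max 1 ((t / l)\<^sup>2))"
    and start: "valid \<sigma>0"
  shows "\<exists>e>0. \<forall>y r. (\<forall>i::nat. 0 < r i) \<and> summable (\<lambda>i. r i powr s) \<and> (\<Sum>i. r i powr s) < e \<longrightarrow>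
      (\<exists>x \<sigma>. \<sigma> 0 = \<sigma>0 \<and> (\<forall>k. valid (\<sigma> k) \<and> succ (\<sigma> k) (\<sigma> (Suc k)) \<and> x \<in> Q (\<sigma> k)) \<and>
         x \<notin> (\<Union>i. ball (y i) (r i)))"
proof -
  \<comment> \<open>The largest value satisfying both conditions on \<open>c\<close> in the
    selection of a child.\<close>
  define c where "c = min 1 (c1\<^sup>2 / (2 * C))"
  have "c \<le> c1\<^sup>2 / (2 * C)" by (simp add: c_def)
  then have "2 * C * c \<le> 2 * C * (c1\<^sup>2 / (2 * C))" using C by (intro mult_left_mono) auto
  then have c: "0 < c" "c \<le> 1" "2 * C * c \<le> c1\<^sup>2"
    using C c1 by (auto simp: c_def)
  have "\<exists>x \<sigma>. \<sigma> 0 = \<sigma>0 \<and> (\<forall>k. valid (\<sigma> k) \<and> succ (\<sigma> k) (\<sigma> (Suc k)) \<and> x \<in> Q (\<sigma> k)) \<and>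
         x \<notin> (\<Union>i. ball (y i) (r i))"
    if r: "\<And>i. 0 < r i" and summ: "summable (\<lambda>i::nat. r i powr s)"
      and less: "(\<Sum>i. r i powr s) < c * d \<sigma>0 powr s" for y r
  proof -
    define w where "w = (\<lambda>S i. if S \<inter> ball (y i) (r i) \<noteq> {} then r i powr s else 0)"
    have w0: "0 \<le> w S i" for S i by (simp add: w_def)
    have wsumm: "summable (w S)" for S
      by (rule summable_comparison_test'[OF summ, of 0]) (simp add: w_def)
    define ok where "ok = (\<lambda>\<sigma>. valid \<sigma> \<and> suminf (w (Q \<sigma>)) < c * d \<sigma> powr s)"
    have "suminf (w (Q \<sigma>0)) \<le> (\<Sum>i. r i powr s)"
      by (intro suminf_le wsumm summ) (simp add: w_def)
    then have ok0: "ok \<sigma>0" using start less by (simp add: ok_def)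
    have ok_step: "\<exists>\<sigma>'. ok \<sigma>' \<and> succ \<sigma> \<sigma>' \<and> Q \<sigma>' \<subseteq> Q \<sigma> \<and> d \<sigma>' \<le> d \<sigma> / 2" if \<sigma>: "ok \<sigma>" for \<sigma>
    proof -
      from \<sigma> have v: "valid \<sigma>" and W: "suminf (w (Q \<sigma>)) < c * d \<sigma> powr s" by (auto simp: ok_def)
      from step[OF v] obtain J :: "'i set" and m l ch where *:
        "finite J \<and> card J = m\<^sup>2 \<and> 0 < m \<and> 0 < l \<and> c1 * d \<sigma> \<le> l * real m \<and>
         2 * C < (c1 / 2) powr s * real m powr (2 - s) \<and>
         (\<forall>j\<in>J. valid (ch j) \<and> succ \<sigma> (ch j) \<and> Q (ch j) \<subseteq> Q \<sigma> \<and> l / 2 \<le> d (ch j) \<and> d (ch j) \<le> d \<sigma> / 2) \<and>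
         (\<forall>x t. 0 < t \<longrightarrow> real (card {j \<in> J. Q (ch j) \<inter> ball x t \<noteq> {}}) \<le> C * max 1 ((t / l)\<^sup>2))"
        by (elim exE) (rule that)
      have J: "finite J" "card J = m\<^sup>2" and m: "0 < m" and l: "0 < l" "c1 * d \<sigma> \<le> l * real m"
        and large: "2 * C < (c1 / 2) powr s * real m powr (2 - s)"
        and ch: "\<And>j. j \<in> J \<Longrightarrow> valid (ch j) \<and> succ \<sigma> (ch j) \<and> Q (ch j) \<subseteq> Q \<sigma> \<and> l / 2 \<le> d (ch j) \<and> d (ch j) \<le> d \<sigma> / 2"
        and count: "\<And>x t. 0 < t \<Longrightarrow> real (card {j \<in> J. Q (ch j) \<inter> ball x t \<noteq> {}}) \<le> C * max 1 ((t / l)\<^sup>2)"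
        using * by blast+
      have "\<exists>j\<in>J. (\<Sum>i. if Q (ch j) \<inter> ball (y i) (r i) \<noteq> {} then r i powr s else 0) < c * (l / 2) powr s"
      proof (rule exists_child_meeting_little[where Q = "\<lambda>j. Q (ch j)" and P = "Q \<sigma>" and d = "d \<sigma>"])
        show "(\<Sum>i. if Q \<sigma> \<inter> ball (y i) (r i) \<noteq> {} then r i powr s else 0) < c * d \<sigma> powr s"
          using W by (simp add: w_def)
      qed (use s C c1 c r summ v valid J m l large ch count in auto)
      then obtain j where j: "j \<in> J" "suminf (w (Q (ch j))) < c * (l / 2) powr s"
        by (auto simp: w_def)
      \<comment> \<open>\<open>l / 2 \<le> d (ch j)\<close> converts the estimate at scale
        \<open>l\<close> into the invariant of the child.\<close>
      have "c * (l / 2) powr s \<le> c * d (ch j) powr s"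
        using ch[OF j(1)] c l s by (intro mult_left_mono powr_mono2) auto
      then have "ok (ch j)" using j ch[OF j(1)] by (simp add: ok_def)
      then show ?thesis using ch[OF j(1)] by blast
    qed
    have "\<exists>\<sigma>. \<forall>n. (ok (\<sigma> n) \<and> (n = 0 \<longrightarrow> \<sigma> n = \<sigma>0)) \<and>
        (succ (\<sigma> n) (\<sigma> (Suc n)) \<and> Q (\<sigma> (Suc n)) \<subseteq> Q (\<sigma> n) \<and> d (\<sigma> (Suc n)) \<le> d (\<sigma> n) / 2)"
      by (rule dependent_nat_choice) (use ok0 ok_step in auto)
    then obtain \<sigma> where \<sigma>: "\<And>n. ok (\<sigma> n)" "\<sigma> 0 = \<sigma>0" "\<And>n. succ (\<sigma> n) (\<sigma> (Suc n))"
      "\<And>n. Q (\<sigma> (Suc n)) \<subseteq> Q (\<sigma> n)" "\<And>n. d (\<sigma> (Suc n)) \<le> d (\<sigma> n) / 2"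
      by metis
    have v: "valid (\<sigma> n)" for n using \<sigma>(1) by (simp add: ok_def)
    have "\<Inter> (range (\<lambda>n. Q (\<sigma> n))) \<noteq> {}"
    proof (rule compact_nest)
      show "Q (\<sigma> n) \<subseteq> Q (\<sigma> k)" if "k \<le> n" for k n
        using lift_Suc_antimono_le[of "\<lambda>n. Q (\<sigma> n)", OF \<sigma>(4) that] .
    qed (use v valid in auto)
    then obtain x where x: "\<And>n. x \<in> Q (\<sigma> n)" by blast
    have dn: "d (\<sigma> n) \<le> d \<sigma>0 * (1/2) ^ n" for n
    proof (induction n)
      case (Suc n)
      then show ?case using \<sigma>(5)[of n] by simp
    qed (simp add: \<sigma>)
    have "x \<notin> ball (y i) (r i)" for i
    proof
      assume i: "x \<in> ball (y i) (r i)"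
      have le: "r i powr s \<le> (d \<sigma>0 * (1/2) ^ n) powr s" for n
      proof -
        have "r i powr s = sum (w (Q (\<sigma> n))) {i}" using i x[of n] by (auto simp: w_def)
        also have "\<dots> \<le> suminf (w (Q (\<sigma> n)))" by (rule sum_le_suminf[OF wsumm]) (auto simp: w0)
        also have "\<dots> \<le> c * d (\<sigma> n) powr s" using \<sigma>(1) by (simp add: ok_def less_imp_le)
        also have "\<dots> \<le> 1 * (d \<sigma>0 * (1/2) ^ n) powr s"
          using c dn s v valid by (intro mult_mono powr_mono2) (auto intro: less_imp_le)
        finally show ?thesis by simp
      qed
      have "(\<lambda>n. d \<sigma>0 * (1/2) ^ n) \<longlonglongrightarrow> d \<sigma>0 * 0"
        by (intro tendsto_intros LIMSEQ_power_zero) simp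
      then have "(\<lambda>n. d \<sigma>0 * (1/2) ^ n) \<longlonglongrightarrow> 0" by simp
      then have "(\<lambda>n. (d \<sigma>0 * (1/2) ^ n) powr s) \<longlonglongrightarrow> 0 powr s"
        using s start valid[OF start] by (intro tendsto_powr') (auto simp: less_imp_le)
      then have "r i powr s \<le> 0 powr s"
        by (rule tendsto_lowerbound) (auto intro: always_eventually le)
      then show False using s r[of i] by simp
    qed
    then show ?thesis using x v \<sigma>(2,3) by blast
  qed
  then show ?thesis
    using c valid[OF start] by (intro exI[of _ "c * d \<sigma>0 powr s"]) (auto simp del: UN_iff)
qed

section \<open>Escaping points in the Julia set\<close>

lemma normal_family_subset:
  assumes "normal_family U F" "V \<subseteq> U"
  shows "normal_family V F"
  using assms unfolding normal_family_def by (meson order_trans)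

lemma fatou_setE_ball:
  assumes "z \<in> fatou_set f"
  obtains r where "0 < r" "normal_family (ball z r) (range (\<lambda>n. f ^^ n))"
proof -
  obtain U where U: "open U" "z \<in> U" "normal_family U (range (\<lambda>n. f ^^ n))"
    using assms by (auto simp: fatou_set_def)
  then obtain r where "0 < r" "ball z r \<subseteq> U" using open_contains_ball by blast
  then show ?thesis using U normal_family_subset that by blast
qed

lemma open_fatou_set: "open (fatou_set f)"
  unfolding fatou_set_def open_subopen[of "{z. _ z}"] by blast

text \<open>If \<open>s n\<close> are iterates of \<open>f\<close>, then so are
  \<open>s n \<circ> f\<close>, and these are normal near \<open>z\<close>. Their limits are carried
  along preimages to the image of a smaller disc, which is a neighbourhood of \<open>f z\<close> by
  the open mapping theorem.\<close>

lemma fatou_set_forward_invariant: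
  assumes hol: "f holomorphic_on UNIV" and nc: "\<not> f constant_on UNIV" and z: "z \<in> fatou_set f"
  shows "f z \<in> fatou_set f"
proof -
  obtain r where r: "0 < r" "normal_family (ball z r) (range (\<lambda>n. f ^^ n))"
    using fatou_setE_ball[OF z] by blast
  \<comment> \<open>A single compact set that contains a preimage of every point of the image
    disc.\<close>
  define C where "C = cball z (r / 2)"
  have C: "compact C" "C \<subseteq> ball z r" using r by (auto simp: C_def)
  have "normal_family (f ` ball z (r / 2)) (range (\<lambda>n. f ^^ n))"
    unfolding normal_family_def
  proof (intro allI impI)
    fix s :: "nat \<Rightarrow> complex \<Rightarrow> complex" assume s: "range s \<subseteq> range (\<lambda>n. f ^^ n)"
    have "range (\<lambda>n. s n \<circ> f) \<subseteq> range (\<lambda>n. f ^^ n)"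
    proof
      fix h assume "h \<in> range (\<lambda>n. s n \<circ> f)"
      then obtain n k where "h = s n \<circ> f" "s n = f ^^ k" using s by blast
      then have "h = f ^^ Suc k" by (simp add: fun_eq_iff funpow_swap1)
      then show "h \<in> range (\<lambda>n. f ^^ n)" by blast
    qed
    then obtain k where k: "strict_mono k"
      "(\<exists>g. \<forall>K. compact K \<and> K \<subseteq> ball z r \<longrightarrow> uniform_limit K (\<lambda>n. s (k n) \<circ> f) g sequentially) \<or>
       (\<forall>K. compact K \<and> K \<subseteq> ball z r \<longrightarrow> (\<forall>B. \<forall>\<^sub>F n in sequentially. \<forall>z\<in>K. B \<le> norm ((s (k n) \<circ> f) z)))"
      using r(2) unfolding normal_family_def by blast
    have pre: "\<exists>x\<in>C. f x = y" if "K \<subseteq> f ` ball z (r / 2)" "y \<in> K" for K y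
      using that by (force simp: C_def)
    from k(2) have "(\<exists>g. \<forall>K. compact K \<and> K \<subseteq> f ` ball z (r / 2) \<longrightarrow> uniform_limit K (\<lambda>n. s (k n)) g sequentially) \<or>
       (\<forall>K. compact K \<and> K \<subseteq> f ` ball z (r / 2) \<longrightarrow> (\<forall>B. \<forall>\<^sub>F n in sequentially. \<forall>z\<in>K. B \<le> norm (s (k n) z)))"
    proof
      assume "\<exists>g. \<forall>K. compact K \<and> K \<subseteq> ball z r \<longrightarrow> uniform_limit K (\<lambda>n. s (k n) \<circ> f) g sequentially"
      then obtain g where g: "uniform_limit C (\<lambda>n. s (k n) \<circ> f) g sequentially" using C by blast
      \<comment> \<open>One chosen preimage per point is enough, because the estimate for
        \<open>s (k n) (f x)\<close> is uniform over all \<open>x\<close> in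
        \<open>C\<close>.\<close>
      define G where "G y = g (SOME x. x \<in> C \<and> f x = y)" for y
      have "uniform_limit K (\<lambda>n. s (k n)) G sequentially" if K: "K \<subseteq> f ` ball z (r / 2)" for K
        unfolding uniform_limit_iff
      proof (intro allI impI)
        fix e :: real assume "e > 0"
        with g have "\<forall>\<^sub>F n in sequentially. \<forall>x\<in>C. dist ((s (k n) \<circ> f) x) (g x) < e"
          by (simp add: uniform_limit_iff)
        then show "\<forall>\<^sub>F n in sequentially. \<forall>y\<in>K. dist (s (k n) y) (G y) < e"
        proof eventually_elim
          case (elim n)
          show ?case
          proof
            fix y assume "y \<in> K"
            then have "\<exists>x. x \<in> C \<and> f x = y" using pre[OF K] by blast
            then have "(SOME x. x \<in> C \<and> f x = y) \<in> C \<and> f (SOME x. x \<in> C \<and> f x = y) = y"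
              by (rule someI_ex)
            then show "dist (s (k n) y) (G y) < e" using elim unfolding G_def by fastforce
          qed
        qed
      qed
      then show ?thesis by blast
    next
      assume "\<forall>K. compact K \<and> K \<subseteq> ball z r \<longrightarrow> (\<forall>B. \<forall>\<^sub>F n in sequentially. \<forall>z\<in>K. B \<le> norm ((s (k n) \<circ> f) z))"
      then have inf: "\<forall>\<^sub>F n in sequentially. \<forall>x\<in>C. B \<le> norm ((s (k n) \<circ> f) x)" for B using C by blast
      have "\<forall>\<^sub>F n in sequentially. \<forall>y\<in>K. B \<le> norm (s (k n) y)" if K: "K \<subseteq> f ` ball z (r / 2)" for K B
        using inf[of B]
      proof eventually_elim
        case (elim n)
        then show ?case using pre[OF K] by force
      qed
      then show ?thesis by blast
    qed
    then show "\<exists>k. strict_mono k \<and>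
        ((\<exists>g. \<forall>K. compact K \<and> K \<subseteq> f ` ball z (r / 2) \<longrightarrow> uniform_limit K (\<lambda>n. s (k n)) g sequentially) \<or>
         (\<forall>K. compact K \<and> K \<subseteq> f ` ball z (r / 2) \<longrightarrow> (\<forall>B. \<forall>\<^sub>F n in sequentially. \<forall>z\<in>K. B \<le> norm (s (k n) z))))"
      using k(1) by blast
  qed
  moreover have "open (f ` ball z (r / 2))"
    by (rule open_mapping_thm[OF hol open_UNIV connected_UNIV open_ball subset_UNIV nc])
  moreover have "f z \<in> f ` ball z (r / 2)" using r by auto
  ultimately show ?thesis unfolding fatou_set_def by blast
qed

lemma funpow_fatou_set:
  assumes "f holomorphic_on UNIV" "\<not> f constant_on UNIV" "z \<in> fatou_set f"
  shows "(f ^^ n) z \<in> fatou_set f"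
  by (induction n) (use assms fatou_set_forward_invariant in auto)

lemma holomorphic_funpow:
  assumes "f holomorphic_on UNIV"
  shows "(f ^^ n) holomorphic_on UNIV"
proof (induction n)
  case (Suc n)
  have "f \<circ> (f ^^ n) holomorphic_on UNIV"
    by (rule holomorphic_on_compose[OF Suc]) (use assms holomorphic_on_subset in blast)
  then show ?case by (simp add: o_def)
qed (auto simp: id_def)

lemma transcendental_entire_not_affine:
  assumes "transcendental_entire f"
  shows "f \<noteq> (\<lambda>x. a + b * x)"
proof
  assume "f = (\<lambda>x. a + b * x)"
  then have "\<forall>z. f z = poly [:a, b:] z" by (simp add: mult.commute)
  then show False using assms unfolding transcendental_entire_def by blast
qed

lemma transcendental_entire_not_constant:
  assumes "transcendental_entire f"
  shows "\<not> f constant_on UNIV"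
proof
  assume "f constant_on UNIV"
  then obtain c where "f = (\<lambda>x. c + 0 * x)" unfolding constant_on_def by auto
  then show False using transcendental_entire_not_affine[OF assms] by blast
qed

text \<open>If the Julia set were empty, normality would spread the escape of one orbit to the whole plane,
  contradicting the existence of a point of period at most 2.\<close>

lemma julia_set_nonempty:
  assumes f: "transcendental_entire f"
    and esc: "filterlim (\<lambda>n. norm ((f ^^ n) z0)) at_top sequentially"
  shows "julia_set f \<noteq> {}"
proof
  assume "julia_set f = {}"
  then have F: "z \<in> fatou_set f" for z by (auto simp: julia_set_def)
  define X where "X = {z. filterlim (\<lambda>n. norm ((f ^^ n) z)) at_top sequentially}"
  \<comment> \<open>Normality leaves two behaviours along a subsequence: a finite limit contradicts
    the escape of \<open>x\<close>, and divergence to infinity contradicts the bounded subsequence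
    at \<open>w\<close>.\<close>
  have spread: "w \<in> X" if x: "x \<in> X" "x \<in> ball z r" "w \<in> ball z r"
    and nf: "normal_family (ball z r) (range (\<lambda>n. f ^^ n))" for x w z r
  proof (rule ccontr)
    assume "w \<notin> X"
    then obtain B where "\<not> (\<forall>\<^sub>F n in sequentially. B \<le> norm ((f ^^ n) w))"
      by (auto simp: X_def filterlim_at_top)
    then have "infinite {n. norm ((f ^^ n) w) < B}"
      by (auto simp: not_eventually not_le frequently_sequentially infinite_nat_iff_unbounded_le)
    then obtain k :: "nat \<Rightarrow> nat" where k: "strict_mono k" "\<And>n. k n \<in> {n. norm ((f ^^ n) w) < B}"
      using infinite_enumerate by blast
    have "range (\<lambda>n. f ^^ k n) \<subseteq> range (\<lambda>n. f ^^ n)" by blast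
    then obtain l where l: "strict_mono (l :: nat \<Rightarrow> nat)"
      "(\<exists>g. \<forall>K. compact K \<and> K \<subseteq> ball z r \<longrightarrow> uniform_limit K (\<lambda>n. f ^^ k (l n)) g sequentially) \<or>
       (\<forall>K. compact K \<and> K \<subseteq> ball z r \<longrightarrow> (\<forall>B. \<forall>\<^sub>F n in sequentially. \<forall>z\<in>K. B \<le> norm ((f ^^ k (l n)) z)))"
      using nf unfolding normal_family_def by blast
    have "strict_mono (\<lambda>n. k (l n))" using k(1) l(1) by (simp add: strict_mono_def)
    then have sub: "filterlim (\<lambda>n. k (l n)) at_top sequentially" by (rule filterlim_subseq)
    have "filterlim (\<lambda>n. norm ((f ^^ n) x)) at_top sequentially" using x by (simp add: X_def)
    then have lx: "filterlim (\<lambda>n. norm ((f ^^ k (l n)) x)) at_top sequentially"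
      by (rule filterlim_compose) (rule sub)
    have K: "compact {x, w}" "{x, w} \<subseteq> ball z r" using x by auto
    from l(2) show False
    proof
      assume "\<exists>g. \<forall>K. compact K \<and> K \<subseteq> ball z r \<longrightarrow> uniform_limit K (\<lambda>n. f ^^ k (l n)) g sequentially"
      then obtain g where "uniform_limit {x, w} (\<lambda>n. f ^^ k (l n)) g sequentially" using K by blast
      then have "(\<lambda>n. (f ^^ k (l n)) x) \<longlonglongrightarrow> g x" by (rule tendsto_uniform_limitI) simp
      then have "(\<lambda>n. norm ((f ^^ k (l n)) x)) \<longlonglongrightarrow> norm (g x)" by (rule tendsto_norm)
      then show False using lx by (metis not_tendsto_and_filterlim_at_infinity
          filterlim_at_top_imp_at_infinity sequentially_bot)
    next
      assume "\<forall>K. compact K \<and> K \<subseteq> ball z r \<longrightarrow> (\<forall>B. \<forall>\<^sub>F n in sequentially. \<forall>z\<in>K. B \<le> norm ((f ^^ k (l n)) z))"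
      then have "\<forall>\<^sub>F n in sequentially. \<forall>z\<in>{x, w}. B \<le> norm ((f ^^ k (l n)) z)" using K by blast
      then obtain n where "B \<le> norm ((f ^^ k (l n)) w)" by (auto dest: eventually_happens)
      then show False using k(2)[of "l n"] by simp
    qed
  qed
  have "open X"
  proof (rule openI)
    fix z assume z: "z \<in> X"
    obtain r where "0 < r" "normal_family (ball z r) (range (\<lambda>n. f ^^ n))" using fatou_setE_ball[OF F] by blast
    then show "\<exists>r>0. ball z r \<subseteq> X" using spread[OF z, of z r] by (intro exI[of _ r]) auto
  qed
  moreover have "open (- X)"
  proof (rule openI)
    fix z assume z: "z \<in> - X"
    obtain r where "0 < r" "normal_family (ball z r) (range (\<lambda>n. f ^^ n))" using fatou_setE_ball[OF F] by blast
    then show "\<exists>r>0. ball z r \<subseteq> - X"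
      using spread[of _ z r z] z by (intro exI[of _ r]) auto
  qed
  ultimately have "X = UNIV"
    using connected_UNIV[where ?'a = complex] esc unfolding connected_clopen
    by (metis X_def closed_def closedin_closed_Int mem_Collect_eq open_openin empty_iff
        inf_top.left_neutral subtopology_UNIV)
  \<comment> \<open>An entire function that is not a translation has such a point; its orbit is
    finite and cannot escape.\<close>
  obtain x where x: "f (f x) = x"
    using holomorphic_involution_point[of f] f transcendental_entire_not_affine[OF f, of _ 1]
    by (auto simp: transcendental_entire_def)
  have "norm ((f ^^ n) x) \<le> max (norm x) (norm (f x))" for n
  proof -
    have "(f ^^ n) x = x \<or> (f ^^ n) x = f x" by (induction n) (use x in auto)
    then show ?thesis by auto
  qed
  moreover have "filterlim (\<lambda>n. norm ((f ^^ n) x)) at_top sequentially"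
    using \<open>X = UNIV\<close> by (auto simp: X_def)
  then have "\<forall>\<^sub>F n in sequentially. max (norm x) (norm (f x)) + 1 \<le> norm ((f ^^ n) x)"
    by (simp add: filterlim_at_top)
  then obtain n where "max (norm x) (norm (f x)) + 1 \<le> norm ((f ^^ n) x)" by (auto dest: eventually_happens)
  ultimately show False by (meson add_le_same_cancel1 not_one_le_zero order_trans)
qed

text \<open>Otherwise a branch of \<open>log (w - p)\<close>, \<open>p\<close> in the Julia set, on the component containing the
  image of a disc under the iterate has, by Bloch's theorem, an image containing two points
  that differ by \<open>2\<pi>i\<close>.\<close>

lemma expanding_escaping_point_in_julia_set:
  assumes f: "transcendental_entire f"
    and sc: "\<not> (\<exists>U \<in> components (fatou_set f). multiply_connected U)"
    and esc: "filterlim (\<lambda>n. norm ((f ^^ n) z)) at_top sequentially"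
    and exp: "\<And>n. 2 * norm (f ((f ^^ n) z)) \<le> norm (deriv f ((f ^^ n) z)) * norm ((f ^^ n) z)"
  shows "z \<in> julia_set f"
proof (rule ccontr)
  assume "z \<notin> julia_set f"
  then have zF: "z \<in> fatou_set f" by (simp add: julia_set_def)
  have hol: "f holomorphic_on UNIV" using f by (simp add: transcendental_entire_def)
  note nc = transcendental_entire_not_constant[OF f]
  obtain p where p: "p \<in> julia_set f" using julia_set_nonempty[OF f esc] by blast
  obtain r where r: "0 < r" "ball z r \<subseteq> fatou_set f"
    using zF open_fatou_set open_contains_ball by blast
  have holn: "(f ^^ n) holomorphic_on S" for n S
    using holomorphic_funpow[OF hol] holomorphic_on_subset by blast
  \<comment> \<open>By the chain rule the quotient of
    \<open>norm (deriv (f ^^ n) z) * norm z\<close> by \<open>norm ((f ^^ n) z)\<close> at least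
    doubles at every step. The product form also covers a vanishing iterate.\<close>
  have grow: "2 ^ n * norm ((f ^^ n) z) \<le> norm (deriv (f ^^ n) z) * norm z" for n
  proof (induction n)
    case 0
    show ?case by (simp add: id_def)
  next
    case (Suc n)
    have "deriv (f ^^ Suc n) z = deriv f ((f ^^ n) z) * deriv (f ^^ n) z"
      unfolding funpow.simps
      by (rule deriv_chain) (use holn[of n] hol in \<open>auto simp: holomorphic_on_def\<close>)
    then have "norm (deriv (f ^^ Suc n) z) * norm z * norm ((f ^^ n) z)
        = norm (deriv f ((f ^^ n) z)) * norm ((f ^^ n) z) * (norm (deriv (f ^^ n) z) * norm z)"
      by (simp add: norm_mult)
    also have "\<dots> \<ge> 2 * norm (f ((f ^^ n) z)) * (2 ^ n * norm ((f ^^ n) z))"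
      by (intro mult_mono exp Suc) auto
    finally have *: "2 ^ Suc n * norm ((f ^^ Suc n) z) * norm ((f ^^ n) z)
        \<le> norm (deriv (f ^^ Suc n) z) * norm z * norm ((f ^^ n) z)" by (simp add: mult_ac)
    show ?case
    proof (cases "(f ^^ n) z = 0")
      case True
      then have "(f ^^ Suc n) z = 0" using exp[of n] by simp
      then show ?thesis by (simp only: norm_zero mult_zero_right) simp
    next
      case False
      then show ?thesis using * by (simp add: o_def)
    qed
  qed
  \<comment> \<open>\<open>168 = 2 * 12 * 7\<close>: 2 from
    \<open>norm ((f ^^ n) z - p) \<le> 2 * norm ((f ^^ n) z)\<close>, 12 from Bloch's theorem, and 7
    as a radius exceeding \<open>2 * pi\<close>.\<close>
  define N where "N = 168 * norm z / r"
  have "\<forall>\<^sub>F n in sequentially. norm p + 1 \<le> norm ((f ^^ n) z)"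
    using esc by (simp add: filterlim_at_top)
  moreover have "\<forall>\<^sub>F n in sequentially. N \<le> 2 ^ n"
  proof -
    obtain m where m: "N < 2 ^ m" using real_arch_pow[of 2 N] by auto
    have "N \<le> 2 ^ n" if "m \<le> n" for n
      by (rule order_trans[OF less_imp_le[OF m] power_increasing[OF that]]) simp
    then show ?thesis by (auto simp: eventually_sequentially)
  qed
  ultimately have "\<forall>\<^sub>F n in sequentially. norm p + 1 \<le> norm ((f ^^ n) z) \<and> N \<le> 2 ^ n"
    by (rule eventually_conj)
  then obtain n where n: "norm p + 1 \<le> norm ((f ^^ n) z)" "N \<le> 2 ^ n"
    using eventually_happens by fastforce
  define W where "W = connected_component_set (fatou_set f) ((f ^^ n) z)"
  have zn: "(f ^^ n) w \<in> fatou_set f" if "w \<in> ball z r" for w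
    using funpow_fatou_set[OF hol nc] r(2) that by blast
  have Wc: "W \<in> components (fatou_set f)"
    using zn[of z] r by (auto simp: W_def components_def)
  have W: "open W" "connected W" "W \<subseteq> fatou_set f"
    using Wc open_fatou_set open_components in_components_connected in_components_subset by blast+
  then have "simply_connected W" using Wc sc by (auto simp: multiply_connected_def)
  have pW: "w \<noteq> p" if "w \<in> W" for w using that W p by (auto simp: julia_set_def)
  have "\<forall>h. h holomorphic_on W \<and> (\<forall>w\<in>W. h w \<noteq> 0) \<longrightarrow> (\<exists>g. g holomorphic_on W \<and> (\<forall>w\<in>W. h w = exp (g w)))"
    by (rule conjunct2[OF iffD1[OF simply_connected_eq_holomorphic_log[OF W(1)] \<open>simply_connected W\<close>]])
  moreover have "(\<lambda>w. w - p) holomorphic_on W \<and> (\<forall>w\<in>W. w - p \<noteq> 0)"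
    using pW by (auto intro!: holomorphic_intros)
  ultimately obtain L where L: "L holomorphic_on W" "\<And>w. w \<in> W \<Longrightarrow> w - p = exp (L w)"
    by (elim allE[of _ "\<lambda>w. w - p"]) blast
  have im: "(f ^^ n) ` ball z r \<subseteq> W"
    unfolding W_def
  proof (rule connected_component_maximal)
    show "connected ((f ^^ n) ` ball z r)"
      by (intro connected_continuous_image holomorphic_on_imp_continuous_on holn connected_ball)
  qed (use zn r in auto)
  define g where "g = L \<circ> (f ^^ n)"
  have holg: "g holomorphic_on ball z r"
    unfolding g_def by (intro holomorphic_on_compose_gen[OF _ L(1)] holn im)
  have znW: "(f ^^ n) z \<in> W" using im r by auto
  have dL: "(L has_field_derivative deriv L ((f ^^ n) z)) (at ((f ^^ n) z))"
    using L(1) W(1) znW by (simp add: holomorphic_derivI)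
  have "((\<lambda>w. exp (L w)) has_field_derivative (exp (L ((f ^^ n) z)) * deriv L ((f ^^ n) z))) (at ((f ^^ n) z))"
    by (rule DERIV_chain2[OF DERIV_exp dL])
  then have "((\<lambda>w. w - p) has_field_derivative (exp (L ((f ^^ n) z)) * deriv L ((f ^^ n) z))) (at ((f ^^ n) z))"
    by (rule has_field_derivative_transform_within_open[OF _ W(1) znW]) (simp add: L(2))
  moreover have "((\<lambda>w. w - p) has_field_derivative 1) (at ((f ^^ n) z))"
    by (auto intro!: derivative_eq_intros)
  ultimately have dL1: "((f ^^ n) z - p) * deriv L ((f ^^ n) z) = 1"
    using L(2)[OF znW] DERIV_unique by metis
  have "deriv g z = deriv L ((f ^^ n) z) * deriv (f ^^ n) z"
    unfolding g_def by (rule deriv_chain)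
      (use dL holn[of n UNIV] in \<open>auto simp: holomorphic_on_def field_differentiable_def\<close>)
  then have dg: "norm ((f ^^ n) z - p) * norm (deriv g z) = norm (deriv (f ^^ n) z)"
    using dL1 by (metis norm_mult mult.assoc mult_1)
  have "norm ((f ^^ n) z - p) \<le> 2 * norm ((f ^^ n) z)"
    using n(1) norm_triangle_ineq4[of "(f ^^ n) z" p] by simp
  then have "norm (deriv (f ^^ n) z) \<le> 2 * norm ((f ^^ n) z) * norm (deriv g z)"
    unfolding dg[symmetric] by (intro mult_right_mono) auto
  then have "norm (deriv (f ^^ n) z) * norm z \<le> 2 * norm ((f ^^ n) z) * norm (deriv g z) * norm z"
    by (rule mult_right_mono) auto
  with grow[of n] have "2 ^ n * norm ((f ^^ n) z) \<le> 2 * norm (deriv g z) * norm z * norm ((f ^^ n) z)"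
    by (simp add: mult_ac)
  moreover have "0 < norm ((f ^^ n) z)" using n(1) norm_ge_zero[of p] by linarith
  ultimately have "2 ^ n \<le> 2 * norm (deriv g z) * norm z" by simp
  with n(2) have "168 * norm z / r \<le> 2 * norm (deriv g z) * norm z" by (simp add: N_def)
  moreover have "z \<noteq> 0"
  proof
    assume "z = 0"
    then have "2 ^ n * norm ((f ^^ n) z) \<le> 0" using grow[of n] by simp
    moreover have "0 < 2 ^ n * norm ((f ^^ n) z)" using \<open>0 < norm ((f ^^ n) z)\<close> by simp
    ultimately show False by linarith
  qed
  ultimately have "7 \<le> r * norm (deriv g z) / 12"
    using r by (simp add: field_simps)
  then obtain b where b: "ball b 7 \<subseteq> g ` ball z r" using Bloch[OF holg r(1)] by metis
  have "b + 2 * pi * \<i> \<in> ball b 7"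
    using pi_less_4 pi_approx by (simp add: dist_norm norm_mult)
  then obtain u where u: "u \<in> ball z r" "b + 2 * pi * \<i> = g u" using b by blast
  moreover have "b \<in> ball b 7" by simp
  then obtain v where v: "v \<in> ball z r" "b = g v" using b by blast
  \<comment> \<open>\<open>exp (g w)\<close> determines \<open>(f ^^ n) w\<close>, and
    \<open>g\<close> factors through the iterate. Points whose \<open>g\<close>-values differ by
    \<open>2 * pi * \<i>\<close> therefore have equal iterates, hence equal \<open>g\<close>-values,
    which is absurd.\<close>
  have "exp (g u) = exp (g v)" unfolding u(2)[symmetric] v(2)[symmetric] by (simp add: exp_add exp_eq_1)
  moreover have "(f ^^ n) u \<in> W" "(f ^^ n) v \<in> W" using im u v by auto
  ultimately have "(f ^^ n) u - p = (f ^^ n) v - p"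
    using L(2)[of "(f ^^ n) u"] L(2)[of "(f ^^ n) v"] by (simp add: g_def)
  then have "(f ^^ n) u = (f ^^ n) v" by simp
  then have "g u = g v" by (simp add: g_def)
  then show False using u(2) v(2) by simp
qed

section \<open>Inverse branches in logarithmic coordinates\<close>

text \<open>\<open>exp\<close> maps it onto a sector of directions within \<eta> of \<psi>, outside
  the disc of radius \<open>exp X\<close>.\<close>

definition log_strip :: "real \<Rightarrow> real \<Rightarrow> real \<Rightarrow> complex set" where
  "log_strip \<psi> \<eta> X = {\<zeta>. X < Re \<zeta> \<and> \<bar>Im \<zeta> - \<psi>\<bar> < \<eta>}"

lemma convex_log_strip: "convex (log_strip \<psi> \<eta> X)"
proof -
  have "log_strip \<psi> \<eta> X = {z. Re z > X} \<inter> {z. Im z > \<psi> - \<eta>} \<inter> {z. Im z < \<psi> + \<eta>}"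
    by (auto simp: log_strip_def abs_less_iff)
  then show ?thesis
    by (simp add: convex_Int convex_halfspace_Re_gt convex_halfspace_Im_gt convex_halfspace_Im_lt)
qed

lemma open_log_strip: "open (log_strip \<psi> \<eta> X)"
  unfolding log_strip_def by (intro open_Collect_conj open_Collect_less continuous_intros)

lemma log_strip_mono: "X \<le> Y \<Longrightarrow> log_strip \<psi> \<eta> Y \<subseteq> log_strip \<psi> \<eta> X"
  by (auto simp: log_strip_def)

text \<open>Squares are used instead of discs because they are tiled exactly by \<open>m * m\<close>
  smaller ones; \<open>h\<close> is half the side.\<close>

definition square :: "complex \<Rightarrow> real \<Rightarrow> complex set" where
  "square b h = {z. \<bar>Re (z - b)\<bar> \<le> h \<and> \<bar>Im (z - b)\<bar> \<le> h}"

lemma square_eq_cbox: "square b h = cbox (b - Complex h h) (b + Complex h h)"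
  by (auto simp: square_def in_cbox_complex_iff abs_le_iff)

lemma convex_square: "convex (square b h)" and compact_square: "compact (square b h)"
  by (simp_all add: square_eq_cbox)

lemma center_in_square: "0 \<le> h \<Longrightarrow> b \<in> square b h"
  by (simp add: square_def)

lemma cball_subset_square: "cball b h \<subseteq> square b h"
proof
  fix z assume "z \<in> cball b h"
  then show "z \<in> square b h"
    using abs_Re_le_cmod[of "z - b"] abs_Im_le_cmod[of "z - b"]
    by (auto simp: square_def dist_norm norm_minus_commute)
qed

lemma norm_diff_le_square:
  assumes "z \<in> square b h" "w \<in> square b h"
  shows "norm (z - w) \<le> 4 * h"
  using assms cmod_le[of "z - w"] by (auto simp: square_def)

lemma norm_diff_center_le_square:
  assumes "z \<in> square b h"
  shows "norm (z - b) \<le> 2 * h"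
  using assms cmod_le[of "z - b"] by (auto simp: square_def)

text \<open>\<open>K\<close> is the derivative of a logarithm of \<open>f (exp \<zeta>)\<close>.
  \<open>Re_K\<close> and \<open>K_incr\<close> together bound its relative variation by
  \<open>C / \<kappa>\<close> times the distance, so this logarithm is nearly affine on small
  squares. \<open>f_grows\<close> pushes images to the right, back into the truncated strip.\<close>

locale log_dynamics =
  fixes f K :: "complex \<Rightarrow> complex" and \<nu> :: "real \<Rightarrow> real" and \<psi> \<eta> X0 \<kappa> C :: real
  assumes hol: "f holomorphic_on UNIV"
    and eta: "0 < \<eta>" and kappa: "0 < \<kappa>"
    and nz: "\<And>\<zeta>. \<zeta> \<in> log_strip \<psi> \<eta> X0 \<Longrightarrow> f (exp \<zeta>) \<noteq> 0"
    and K_eq: "\<And>\<zeta>. K \<zeta> = exp \<zeta> * deriv f (exp \<zeta>) / f (exp \<zeta>)"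
    and Re_K: "\<And>\<zeta>. \<zeta> \<in> log_strip \<psi> \<eta> X0 \<Longrightarrow> \<kappa> * \<nu> (Re \<zeta>) \<le> Re (K \<zeta>)"
    and norm_K: "\<And>\<zeta>. \<zeta> \<in> log_strip \<psi> \<eta> X0 \<Longrightarrow> norm (K \<zeta>) \<le> C * \<nu> (Re \<zeta>)"
    and K_incr: "\<And>\<zeta> \<xi>. \<zeta> \<in> log_strip \<psi> \<eta> X0 \<Longrightarrow> \<xi> \<in> log_strip \<psi> \<eta> X0 \<Longrightarrow> norm (\<zeta> - \<xi>) \<le> 1/2 \<Longrightarrow>
        norm (K \<zeta> - K \<xi>) \<le> C * norm (\<zeta> - \<xi>) * \<nu> (Re \<zeta>)"
    and \<nu>_mono: "\<And>x y. x \<le> y \<Longrightarrow> \<nu> x \<le> \<nu> y"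
    and \<nu>_add_le: "\<And>x s. 0 \<le> s \<Longrightarrow> \<nu> (x + s) \<le> exp s * \<nu> x"
    and \<nu>_unbounded: "\<And>V. \<exists>X. \<forall>x\<ge>X. V \<le> \<nu> x"
    and f_grows: "\<And>\<zeta>. \<zeta> \<in> log_strip \<psi> \<eta> X0 \<Longrightarrow> 3 * exp (Re \<zeta>) \<le> norm (f (exp \<zeta>))"
begin

text \<open>\<open>\<eta> / 2\<close> keeps squares centred on the axis inside the strip;
  \<open>1/8\<close> ensures \<open>2 * h0 + pi < 4\<close> and
  \<open>exp (2 * h0) \<le> 2\<close>.\<close>

definition h0 :: real where "h0 = min (\<eta> / 2) (1/8)"

text \<open>From \<open>\<tau> \<le> h * \<nu>\<close> and
  \<open>\<kappa> * \<nu> \<le> norm K\<close> follows \<open>h * norm K \<ge> 24\<close>; Bloch's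
  lemma keeps at least a sixth of this, a disc of radius 4.\<close>

definition \<tau> :: real where "\<tau> = 24 / \<kappa>"

text \<open>When \<nu> is at least \<open>V0\<close> and \<open>h * \<nu> \<le> 4 * \<tau>\<close>,
  the first summand forces \<open>4 * C * h \<le> \<kappa>\<close> and the second
  \<open>h \<le> 1/8\<close>.\<close>

definition V0 :: real where "V0 = 384 * C / \<kappa>\<^sup>2 + 768 / \<kappa>"

lemma h0: "0 < h0" "h0 \<le> 1/8" "h0 < \<eta>"
  using eta by (auto simp: h0_def)

lemma tau_pos: "0 < \<tau>" using kappa by (simp add: \<tau>_def)

lemma C_pos: "0 < C"
proof -
  obtain X where X: "\<And>x. x \<ge> X \<Longrightarrow> 1 \<le> \<nu> x" using \<nu>_unbounded by blast
  define \<zeta> where "\<zeta> = Complex (max X X0 + 1) \<psi>"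
  have \<zeta>: "\<zeta> \<in> log_strip \<psi> \<eta> X0" "1 \<le> \<nu> (Re \<zeta>)" using eta X by (auto simp: \<zeta>_def log_strip_def)
  have "0 < \<kappa> * \<nu> (Re \<zeta>)" using \<zeta> kappa by simp
  also have "\<dots> \<le> C * \<nu> (Re \<zeta>)"
    using Re_K[OF \<zeta>(1)] norm_K[OF \<zeta>(1)] complex_Re_le_cmod[of "K \<zeta>"] by linarith
  finally show ?thesis using \<zeta>(2) by (simp add: zero_less_mult_iff)
qed

lemma exists_log:
  "\<exists>L. (\<forall>\<zeta>\<in>log_strip \<psi> \<eta> X0. f (exp \<zeta>) = exp (L \<zeta>) \<and> (L has_field_derivative K \<zeta>) (at \<zeta>))"
proof -
  let ?S = "log_strip \<psi> \<eta> X0"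
  have holfe: "(\<lambda>\<zeta>. f (exp \<zeta>)) holomorphic_on ?S"
    using holomorphic_on_compose_gen[OF holomorphic_on_exp hol, of ?S] by (simp add: o_def)
  have "simply_connected ?S" by (rule convex_imp_simply_connected[OF convex_log_strip])
  then have "\<forall>h. h holomorphic_on ?S \<and> (\<forall>z\<in>?S. h z \<noteq> 0) \<longrightarrow> (\<exists>g. g holomorphic_on ?S \<and> (\<forall>z\<in>?S. h z = exp (g z)))"
    by (rule conjunct2[OF iffD1[OF simply_connected_eq_holomorphic_log[OF open_log_strip]]])
  moreover have "(\<lambda>\<zeta>. f (exp \<zeta>)) holomorphic_on ?S \<and> (\<forall>z\<in>?S. f (exp z) \<noteq> 0)"
    using holfe nz by blast
  ultimately obtain L where L: "L holomorphic_on ?S" "\<And>\<zeta>. \<zeta> \<in> ?S \<Longrightarrow> f (exp \<zeta>) = exp (L \<zeta>)"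
    by (elim allE[of _ "\<lambda>\<zeta>. f (exp \<zeta>)"]) blast
  have "(L has_field_derivative K \<zeta>) (at \<zeta>)" if \<zeta>: "\<zeta> \<in> ?S" for \<zeta>
  proof -
    have dL: "(L has_field_derivative deriv L \<zeta>) (at \<zeta>)"
      by (rule holomorphic_derivI[OF L(1) open_log_strip \<zeta>])
    have df: "(f has_field_derivative deriv f (exp \<zeta>)) (at (exp \<zeta>))"
      by (rule holomorphic_derivI[OF hol]) auto
    have "((\<lambda>\<zeta>. exp (L \<zeta>)) has_field_derivative exp (L \<zeta>) * deriv L \<zeta>) (at \<zeta>)"
      by (rule DERIV_chain2[OF DERIV_exp dL])
    then have "((\<lambda>\<zeta>. f (exp \<zeta>)) has_field_derivative exp (L \<zeta>) * deriv L \<zeta>) (at \<zeta>)"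
      by (rule has_field_derivative_transform_within_open[OF _ open_log_strip \<zeta>]) (simp add: L(2))
    moreover have "((\<lambda>\<zeta>. f (exp \<zeta>)) has_field_derivative deriv f (exp \<zeta>) * exp \<zeta>) (at \<zeta>)"
      by (rule DERIV_chain2[OF df DERIV_exp])
    ultimately have "exp (L \<zeta>) * deriv L \<zeta> = deriv f (exp \<zeta>) * exp \<zeta>" by (rule DERIV_unique)
    then have "deriv L \<zeta> = K \<zeta>" using nz[OF \<zeta>] L(2)[OF \<zeta>] by (simp add: K_eq field_simps)
    then show ?thesis using dL by simp
  qed
  then show ?thesis using L(2) by blast
qed

text \<open>Boxes of this size have images of bounded size in logarithmic coordinates, large enough
  to contain a translate by \<open>2\<pi>i\<int>\<close> of a fixed square inside the strip.\<close>

lemma inverse_branch: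
  assumes X: "X0 \<le> X" "V0 \<le> \<nu> X"
    and sq: "square b h \<subseteq> log_strip \<psi> \<eta> X" and h: "0 < h" "\<tau> \<le> h * \<nu> (Re b)" "h * \<nu> (Re b) \<le> 4 * \<tau>"
  shows "\<exists>bs lam lam'. Im bs = \<psi> \<and> Re b + 1 \<le> Re bs \<and> h \<le> 1/8 \<and>
    (\<forall>w\<in>square bs h0. lam w \<in> square b h \<and> (lam has_field_derivative lam' w) (at w) \<and>
       f (exp (lam w)) = exp w \<and> h / (6 * \<tau> * C) \<le> norm (lam' w) \<and> norm (lam' w) \<le> h / 12) \<and>
    (\<forall>u\<in>square bs h0. \<forall>v\<in>square bs h0. norm (lam' u - lam' v) \<le> 1/4 * norm (u - v) * norm (lam' v))"
proof -
  let ?S = "log_strip \<psi> \<eta> X0"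
  obtain L where L: "\<And>\<zeta>. \<zeta> \<in> ?S \<Longrightarrow> f (exp \<zeta>) = exp (L \<zeta>)"
    "\<And>\<zeta>. \<zeta> \<in> ?S \<Longrightarrow> (L has_field_derivative K \<zeta>) (at \<zeta>)"
    using exists_log by blast
  have sqS: "square b h \<subseteq> ?S" using sq log_strip_mono[OF X(1)] by blast
  have bS: "b \<in> ?S" "X < Re b" using sq sqS center_in_square[of h b] h by (auto simp: log_strip_def)
  define n where "n = \<nu> (Re b)"
  have nV: "V0 \<le> n" using X(2) \<nu>_mono[of X "Re b"] bS by (simp add: n_def)
  have n1: "384 * C / \<kappa>\<^sup>2 \<le> n" and n2: "768 / \<kappa> \<le> n"
  proof -
    have "0 < 384 * C / \<kappa>\<^sup>2" "0 < 768 / \<kappa>" using C_pos kappa by auto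
    then show "384 * C / \<kappa>\<^sup>2 \<le> n" "768 / \<kappa> \<le> n" using nV unfolding V0_def by linarith+
  qed
  have n0: "0 < n" using n2 kappa by (smt (verit) divide_pos_pos)
  have hn: "h \<le> 4 * \<tau> / n" using h n0 by (simp add: n_def field_simps)
  also have "\<dots> \<le> 4 * \<tau> / (768 / \<kappa>)" using n2 n0 kappa tau_pos by (intro divide_left_mono mult_pos_pos) auto
  also have "\<dots> = 1/8" using kappa by (simp add: \<tau>_def)
  finally have h8: "h \<le> 1/8" .
  have "h \<le> 4 * \<tau> / n" by (rule hn)
  also have "\<dots> \<le> 4 * \<tau> / (384 * C / \<kappa>\<^sup>2)"
    using n1 n0 kappa tau_pos C_pos by (intro divide_left_mono mult_pos_pos) auto
  also have "\<dots> = \<kappa> / (4 * C)" using kappa C_pos by (simp add: \<tau>_def power2_eq_square)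
  finally have hC: "4 * C * h \<le> \<kappa>" using C_pos by (simp add: field_simps)
  define M where "M = norm (K b)"
  have M1: "\<kappa> * n \<le> M" using Re_K[OF bS(1)] complex_Re_le_cmod[of "K b"] by (simp add: M_def n_def)
  have M2: "M \<le> C * n" using norm_K[OF bS(1)] by (simp add: M_def n_def)
  have M0: "0 < M" using M1 n0 kappa by (smt (verit) mult_pos_pos)
  have hM: "24 \<le> h * M"
  proof -
    have "24 = \<kappa> * \<tau>" using kappa by (simp add: \<tau>_def)
    also have "\<dots> \<le> \<kappa> * (h * n)" using h kappa by (simp add: n_def)
    also have "\<dots> \<le> h * M" using M1 h by (simp add: mult.left_commute)
    finally show ?thesis .
  qed
  \<comment> \<open>\<open>K\<close> deviates from its central value by at most half the modulus of
    that value. This yields both the injectivity of \<open>L\<close> and the derivative bound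
    required by Bloch's lemma.\<close>
  have near: "norm (K \<zeta> - K b) \<le> M / 2" if "\<zeta> \<in> square b h" for \<zeta>
  proof -
    have d: "norm (b - \<zeta>) \<le> 2 * h" using norm_diff_center_le_square[OF that] by (simp add: norm_minus_commute)
    have "norm (K b - K \<zeta>) \<le> C * norm (b - \<zeta>) * n"
      unfolding n_def by (rule K_incr) (use bS sqS that d h8 in auto)
    also have "\<dots> \<le> C * (2 * h) * n" using d C_pos n0 by (intro mult_right_mono mult_left_mono) auto
    also have "\<dots> \<le> \<kappa> / 2 * n" using hC n0 by (intro mult_right_mono) auto
    also have "\<dots> \<le> M / 2" using M1 by simp
    finally show ?thesis by (simp add: norm_minus_commute)
  qed
  have Kbounds: "M / 2 \<le> norm (K \<zeta>)" "norm (K \<zeta>) \<le> 3/2 * M" if "\<zeta> \<in> square b h" for \<zeta>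
    using near[OF that] norm_triangle_ineq2[of "K b" "K b - K \<zeta>"] norm_triangle_ineq[of "K b" "K \<zeta> - K b"]
      norm_triangle_ineq2[of "K b" "K \<zeta>"]
    by (auto simp: M_def norm_minus_commute)
  have inj: "inj_on L (square b h)"
  proof (rule inj_onI)
    fix x y assume xy: "x \<in> square b h" "y \<in> square b h" "L x = L y"
    \<comment> \<open>\<open>L\<close> minus the linear map with slope \<open>K b\<close> has
      Lipschitz constant \<open>M / 2\<close>, less than \<open>M = norm (K b)\<close>, so
      \<open>L\<close> cannot identify two points.\<close>
    have "norm ((L x - K b * x) - (L y - K b * y)) \<le> M / 2 * norm (x - y)"
    proof (rule field_differentiable_bound[OF convex_square])
      show "((\<lambda>z. L z - K b * z) has_field_derivative (K z - K b)) (at z within square b h)"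
        if "z \<in> square b h" for z
        using has_field_derivative_at_within[OF L(2)] that sqS by (auto intro!: derivative_eq_intros)
    qed (use xy near in auto)
    moreover have "(L x - K b * x) - (L y - K b * y) = K b * (y - x)"
      using xy(3) by (simp add: algebra_simps)
    ultimately have "M * norm (x - y) \<le> M / 2 * norm (x - y)"
      by (simp only: norm_mult M_def norm_minus_commute[of y x])
    then show "x = y" using M0 by (simp add: mult_le_cancel_right)
  qed
  have ballS: "cball b h \<subseteq> ?S" "ball b h \<subseteq> square b h"
    using cball_subset_square[of b h] sqS ball_subset_cball[of b h] by blast+
  have holL: "L holomorphic_on ?S"
    unfolding holomorphic_on_def field_differentiable_def
    using L(2) has_field_derivative_at_within by blast
  have holb: "L holomorphic_on ball b h"
    by (rule holomorphic_on_subset[OF holL order_trans[OF ball_subset_cball ballS(1)]])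
  have injb: "inj_on L (ball b h)" by (rule inj_on_subset[OF inj ballS(2)])
  have derivL: "deriv L \<zeta> = K \<zeta>" if "\<zeta> \<in> ?S" for \<zeta> by (rule DERIV_imp_deriv[OF L(2)[OF that]])
  have "ball (L b) ((3 - 2 * sqrt 2) * h * norm (deriv L b)) \<subseteq> L ` ball b h"
  proof (rule Bloch_lemma)
    show "L holomorphic_on cball b h" by (rule holomorphic_on_subset[OF holL ballS(1)])
    show "norm (deriv L z) \<le> 2 * norm (deriv L b)" if "z \<in> ball b h" for z
    proof -
      have z: "z \<in> square b h" "z \<in> ?S" using that ballS sqS by auto
      show ?thesis unfolding derivL[OF z(2)] derivL[OF bS(1)] M_def[symmetric]
        using Kbounds(2)[OF z(1)] M0 by linarith
    qed
  qed (rule h)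
  moreover have "4 \<le> (3 - 2 * sqrt 2) * h * norm (deriv L b)"
  proof -
    \<comment> \<open>\<open>17/12\<close> is the value for which
      \<open>3 - 2 * sqrt 2 \<ge> 1/6\<close> results.\<close>
    have "sqrt 2 \<le> 17/12" by (rule real_le_lsqrt) (auto simp: power2_eq_square)
    then have "1/6 * (h * M) \<le> (3 - 2 * sqrt 2) * (h * M)" using h M0 by (intro mult_right_mono) auto
    then show ?thesis using hM by (simp add: derivL bS M_def)
  qed
  ultimately have ball4: "ball (L b) 4 \<subseteq> L ` ball b h" by (meson order_trans subset_ball)
  obtain g where g: "g holomorphic_on L ` ball b h"
    "\<And>z. z \<in> ball b h \<Longrightarrow> deriv L z * deriv g (L z) = 1" "\<And>z. z \<in> ball b h \<Longrightarrow> g (L z) = z"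
    using holomorphic_has_inverse[OF holb open_ball injb] by blast
  \<comment> \<open>The multiple of \<open>2 * pi\<close> that brings \<psi> closest to
    \<open>Im (L b)\<close>, within \<open>pi\<close>. Since \<open>pi + 2 * h0 < 4\<close>, the
    shifted square lies in the disc covered by \<open>L\<close>.\<close>
  define j where "j = \<lfloor>(Im (L b) - \<psi>) / (2 * pi) + 1/2\<rfloor>"
  define t where "t = 2 * of_int j * of_real pi * \<i>"
  define bs where "bs = Complex (Re (L b)) \<psi>"
  define lam where "lam w = g (w + t)" for w
  define lam' where "lam' w = 1 / K (lam w)" for w
  have jb: "\<bar>\<psi> + 2 * of_int j * pi - Im (L b)\<bar> \<le> pi"
  proof -
    define y where "y = (Im (L b) - \<psi>) / (2 * pi)"
    have "\<bar>of_int j - y\<bar> \<le> 1/2" unfolding j_def y_def[symmetric] by linarith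
    then have "\<bar>of_int j - y\<bar> * (2 * pi) \<le> 1/2 * (2 * pi)" by (intro mult_right_mono) auto
    then have "\<bar>(of_int j - y) * (2 * pi)\<bar> \<le> pi" by (simp add: abs_mult)
    moreover have "y * (2 * pi) = Im (L b) - \<psi>" by (simp add: y_def)
    ultimately show ?thesis by (simp add: algebra_simps)
  qed
  have w: "\<exists>\<zeta>\<in>ball b h. L \<zeta> = w + t \<and> lam w = \<zeta>" if "w \<in> square bs h0" for w
  proof -
    have "\<bar>Re (w + t - L b)\<bar> \<le> h0" "\<bar>Im (w - bs)\<bar> \<le> h0"
      using that by (auto simp: square_def bs_def t_def)
    moreover have "Im (w + t - L b) = Im (w - bs) + (\<psi> + 2 * of_int j * pi - Im (L b))"
      by (simp add: bs_def t_def)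
    ultimately have "norm (w + t - L b) \<le> h0 + (h0 + pi)"
      using cmod_le[of "w + t - L b"] jb by linarith
    also have "\<dots> < 4" using h0 pi_approx by simp
    finally have "w + t \<in> ball (L b) 4" by (simp add: dist_norm norm_minus_commute)
    then obtain \<zeta> where "\<zeta> \<in> ball b h" "w + t = L \<zeta>" using ball4 by blast
    then show ?thesis using g(3) by (intro bexI[of _ \<zeta>]) (auto simp: lam_def)
  qed
  have lam_sq: "lam w \<in> square b h" if "w \<in> square bs h0" for w
    using w[OF that] ballS by blast
  have opn: "open (L ` ball b h)"
    by (rule open_mapping_thm3[OF holb open_ball injb])
  have dlam: "(lam has_field_derivative lam' x) (at x)" if "x \<in> square bs h0" for x
  proof -
    obtain \<zeta> where \<zeta>: "\<zeta> \<in> ball b h" "L \<zeta> = x + t" "lam x = \<zeta>" using w[OF \<open>x \<in> square bs h0\<close>] by blast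
    have "\<zeta> \<in> ?S" using \<zeta>(1) ballS sqS by blast
    then have eq: "K \<zeta> * deriv g (x + t) = 1" using g(2)[OF \<zeta>(1)] \<zeta>(2) by (simp add: derivL)
    then have "K \<zeta> \<noteq> 0" by auto
    with eq have "deriv g (x + t) = lam' x" by (simp add: lam'_def \<zeta>(3) field_simps)
    moreover have "(g has_field_derivative deriv g (x + t)) (at (x + t))"
      by (rule holomorphic_derivI[OF g(1) opn]) (use \<zeta> in \<open>auto simp flip: \<zeta>(2)\<close>)
    ultimately have "(g has_field_derivative lam' x) (at (x + t))" by simp
    then show ?thesis unfolding lam_def by (simp add: DERIV_shift)
  qed
  have flam: "f (exp (lam x)) = exp x" if "x \<in> square bs h0" for x
  proof -
    obtain \<zeta> where \<zeta>: "\<zeta> \<in> ball b h" "L \<zeta> = x + t" "lam x = \<zeta>" using w[OF \<open>x \<in> square bs h0\<close>] by blast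
    have "\<zeta> \<in> ?S" using \<zeta>(1) ballS sqS by blast
    then have "f (exp (lam x)) = exp (x + t)" using L(1) \<zeta> by simp
    also have "exp (x + t) = exp x"
      using exp_integer_2pi[of "of_int j"] by (simp add: exp_add t_def)
    finally show ?thesis .
  qed
  have lam'_lower: "h / (6 * \<tau> * C) \<le> norm (lam' x)" and lam'_upper: "norm (lam' x) \<le> h / 12"
    if "x \<in> square bs h0" for x
  proof -
    note Kx = Kbounds[OF lam_sq[OF that]]
    have Kpos: "0 < norm (K (lam x))" using Kx M0 by linarith
    \<comment> \<open>\<open>6 = 3/2 * 4\<close>: 3/2 from the variation of \<open>K\<close> over
      the square, 4 from \<open>h * n \<le> 4 * \<tau>\<close>.\<close>
    have "h * norm (K (lam x)) \<le> h * (3/2 * (C * n))" using Kx(2) M2 h by (intro mult_left_mono) auto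
    also have "\<dots> = 3/2 * C * (h * n)" by simp
    also have "\<dots> \<le> 3/2 * C * (4 * \<tau>)" using h C_pos by (intro mult_left_mono) (auto simp: n_def)
    finally show "h / (6 * \<tau> * C) \<le> norm (lam' x)"
      unfolding lam'_def norm_divide norm_one using Kpos tau_pos C_pos
      by (simp add: divide_le_eq le_divide_eq mult_ac)
    have "24 \<le> h * (2 * norm (K (lam x)))" using hM mult_left_mono[of M "2 * norm (K (lam x))" h] Kx h by linarith
    then show "norm (lam' x) \<le> h / 12" unfolding lam'_def norm_divide norm_one using Kpos by (simp add: divide_le_eq mult_ac)
  qed
  have lam'_var: "norm (lam' u - lam' v) \<le> 1/4 * norm (u - v) * norm (lam' v)"
    if uv: "u \<in> square bs h0" "v \<in> square bs h0" for u v
  proof -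
    note su = lam_sq[OF uv(1)] and sv = lam_sq[OF uv(2)]
    have Ku: "0 < norm (K (lam u))" "0 < norm (K (lam v))" using Kbounds(1)[OF su] Kbounds(1)[OF sv] M0 by linarith+
    have l: "norm (lam u - lam v) \<le> h / 12 * norm (u - v)"
      by (rule field_differentiable_bound[OF convex_square has_field_derivative_at_within[OF dlam] lam'_upper])
        (use uv in auto)
    \<comment> \<open>The relative variation of a reciprocal is that of \<open>K\<close>. By
      \<open>K_incr\<close> and the contraction of \<open>lam\<close> its constant is at most
      \<open>C * h / (12 * \<kappa>)\<close>, far below 1/4.\<close>
    have "lam' u - lam' v = (K (lam v) - K (lam u)) / (K (lam u) * K (lam v))"
      using Ku by (simp add: lam'_def field_simps)
    then have "norm (lam' u - lam' v) = norm (K (lam u) - K (lam v)) / norm (K (lam u)) * norm (lam' v)"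
      by (simp add: norm_divide norm_mult lam'_def norm_minus_commute)
    also have "\<dots> \<le> C * (h / 12 * norm (u - v)) / \<kappa> * norm (lam' v)"
    proof (rule mult_right_mono)
      have uS: "lam u \<in> ?S" "lam v \<in> ?S" using su sv sqS by auto
      have "norm (K (lam u) - K (lam v)) \<le> C * norm (lam u - lam v) * \<nu> (Re (lam u))"
        by (rule K_incr[OF uS]) (use norm_diff_le_square[OF su sv] h8 in auto)
      also have "\<dots> \<le> C * (h / 12 * norm (u - v)) * (norm (K (lam u)) / \<kappa>)"
      proof (rule mult_mono)
        have "\<kappa> * \<nu> (Re (lam u)) \<le> norm (K (lam u))"
          using Re_K[OF uS(1)] complex_Re_le_cmod[of "K (lam u)"] by linarith
        then show "\<nu> (Re (lam u)) \<le> norm (K (lam u)) / \<kappa>" using kappa by (simp add: field_simps)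
        have "X \<le> Re (lam u)" using su sq by (auto simp: log_strip_def)
        moreover have "0 \<le> V0" using C_pos kappa by (simp add: V0_def)
        ultimately show "0 \<le> \<nu> (Re (lam u))" using X(2) \<nu>_mono by (meson order_trans)
      qed (use l C_pos h in auto)
      finally show "norm (K (lam u) - K (lam v)) / norm (K (lam u)) \<le> C * (h / 12 * norm (u - v)) / \<kappa>"
        using Ku by (simp add: divide_le_eq)
    qed simp
    also have "\<dots> \<le> 1/4 * norm (u - v) * norm (lam' v)"
    proof (rule mult_right_mono)
      have "4 * C * h * norm (u - v) \<le> \<kappa> * norm (u - v)" by (rule mult_right_mono[OF hC]) simp
      then have "4 * C * h * norm (u - v) / (48 * \<kappa>) \<le> \<kappa> * norm (u - v) / (48 * \<kappa>)"
        using kappa by (intro divide_right_mono) auto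
      also have "\<kappa> * norm (u - v) / (48 * \<kappa>) \<le> 1/4 * norm (u - v)" using kappa by simp
      finally show "C * (h / 12 * norm (u - v)) / \<kappa> \<le> 1/4 * norm (u - v)" by simp
    qed simp
    finally show ?thesis .
  qed
  have Re_bs: "Re b + 1 \<le> Re bs"
  proof -
    \<comment> \<open>The factor 3 of \<open>f_grows\<close> exceeds \<open>exp 1\<close>. The
      resulting shift by 1 leaves room for the half-side \<open>h0\<close> on the left of the new
      centre.\<close>
    have "exp (Re b + 1) = exp 1 * exp (Re b)" by (simp add: exp_add)
    also have "\<dots> \<le> 3 * exp (Re b)" by (intro mult_right_mono exp_le) auto
    also have "\<dots> \<le> norm (f (exp b))" by (rule f_grows[OF bS(1)])
    also have "\<dots> = exp (Re (L b))" by (simp add: L(1)[OF bS(1)])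
    finally show ?thesis by (simp add: bs_def)
  qed
  have Im_bs: "Im bs = \<psi>" by (simp add: bs_def)
  show ?thesis
    by (intro exI[of _ bs] exI[of _ lam] exI[of _ lam'] conjI ballI)
      (assumption | rule Im_bs Re_bs h8 lam_sq dlam flam lam'_lower lam'_upper lam'_var)+
qed

end

section \<open>Nested boxes and their subdivision\<close>

lemma card_grid_le:
  fixes A :: "(nat \<times> nat) set" and r :: real
  assumes "finite A" and "0 \<le> r"
    and near: "\<And>i j i' j'. (i, j) \<in> A \<Longrightarrow> (i', j') \<in> A \<Longrightarrow>
       \<bar>real i - real i'\<bar> \<le> r \<and> \<bar>real j - real j'\<bar> \<le> r"
  shows "real (card A) \<le> (2 * r + 1)\<^sup>2"
proof (cases "A = {}")
  case False
  then obtain i0 j0 where 0: "(i0, j0) \<in> A" by (metis all_not_in_conv surj_pair)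
  define n where "n = nat \<lfloor>r\<rfloor>"
  have nr: "real n \<le> r" using assms(2) by (simp add: n_def)
  have close: "k \<in> {k0 - n..k0 + n}" if "\<bar>real k - real k0\<bar> \<le> r" for k k0
  proof -
    have "\<bar>int k - int k0\<bar> \<le> \<lfloor>r\<rfloor>" using that by (simp add: le_floor_iff)
    then show ?thesis using assms(2) by (auto simp: n_def nat_le_iff le_nat_iff)
  qed
  \<comment> \<open>Truncated subtraction is harmless: it only cuts off negative numbers, and
    \<open>2 * n + 1\<close> still bounds the number of elements.\<close>
  have "A \<subseteq> {i0 - n..i0 + n} \<times> {j0 - n..j0 + n}"
    using near[OF _ 0] close by fast
  then have "card A \<le> card ({i0 - n..i0 + n} \<times> {j0 - n..j0 + n})" by (rule card_mono[rotated]) simp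
  also have "\<dots> \<le> (2 * n + 1) * (2 * n + 1)"
    unfolding card_cartesian_product by (rule mult_mono) auto
  finally have "real (card A) \<le> real ((2 * n + 1) * (2 * n + 1))" by (rule of_nat_mono)
  also have "\<dots> = (2 * real n + 1)\<^sup>2" by (simp add: power2_eq_square algebra_simps)
  also have "\<dots> \<le> (2 * r + 1)\<^sup>2" using nr by (intro power_mono) auto
  finally show ?thesis .
qed simp

context log_dynamics begin

text \<open>In a state \<open>(k, G, g, b, h)\<close>, the map \<open>G\<close> with derivative \<open>g\<close> is an inverse branch of \<open>f ^^ k\<close> with
  respect to the logarithmic coordinate of the image, which ranges over \<open>square b h\<close>; its distortion
  is controlled by the bound on the variation of \<open>g\<close>.\<close>

definition good_box :: "real \<Rightarrow> nat \<times> (complex \<Rightarrow> complex) \<times> (complex \<Rightarrow> complex) \<times> complex \<times> real \<Rightarrow> bool" where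
  "good_box X = (\<lambda>(k, G, g, b, h). square b h \<subseteq> log_strip \<psi> \<eta> X \<and> 0 < h \<and>
     \<tau> \<le> h * \<nu> (Re b) \<and> h * \<nu> (Re b) \<le> 4 * \<tau> \<and>
     (\<forall>w\<in>square b h. (G has_field_derivative g w) (at w within square b h)) \<and> g b \<noteq> 0 \<and>
     (\<forall>u\<in>square b h. \<forall>v\<in>square b h. norm (g u - g v) \<le> 2 * norm (u - v) * norm (g v)) \<and>
     (\<forall>w\<in>square b h. (f ^^ k) (G w) = exp w))"

definition box_set :: "nat \<times> (complex \<Rightarrow> complex) \<times> (complex \<Rightarrow> complex) \<times> complex \<times> real \<Rightarrow> complex set" where
  "box_set = (\<lambda>(k, G, g, b, h). G ` square b h)"

text \<open>To first order, half the side of the image of the square.\<close>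

definition box_size :: "nat \<times> (complex \<Rightarrow> complex) \<times> (complex \<Rightarrow> complex) \<times> complex \<times> real \<Rightarrow> real" where
  "box_size = (\<lambda>(k, G, g, b, h). norm (g b) * h)"

text \<open>The product of \<open>h0\<close>, of the coefficient \<open>1 / (6 * \<tau> * C)\<close>
  in the lower bound for the derivative of an inverse branch, and of 2/3 for the variation of
  \<open>g\<close>.\<close>

definition c1 :: real where "c1 = h0 / (9 * \<tau> * C)"

lemma c1_pos: "0 < c1"
  using h0 tau_pos C_pos by (simp add: c1_def)

lemma box_nonempty_compact:
  assumes "good_box X \<sigma>"
  shows "0 < box_size \<sigma> \<and> compact (box_set \<sigma>) \<and> box_set \<sigma> \<noteq> {}"
proof -
  obtain k G g b h where \<sigma>: "\<sigma> = (k, G, g, b, h)" by (metis surj_pair)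
  have d: "\<And>w. w \<in> square b h \<Longrightarrow> (G has_field_derivative g w) (at w within square b h)" "0 < h" "g b \<noteq> 0"
    using assms by (auto simp: \<sigma> good_box_def)
  have "continuous_on (square b h) G" using d(1) by (rule DERIV_continuous_on)
  then show ?thesis
    using d(2,3) center_in_square[of h b]
    by (auto simp: \<sigma> box_size_def box_set_def intro: compact_continuous_image compact_square)
qed

text \<open>This is one step of the covering game, with \<open>C = 49\<close>. The square of
  half-side \<open>h0\<close> from \<open>inverse_branch\<close> is divided into
  \<open>m * m\<close> squares, where \<open>m\<close> is about \<open>h0 * \<nu> / \<tau>\<close>,
  so that the new half-sides again satisfy the normalisation in \<open>good_box\<close>.\<close>

lemma box_children:
  assumes X: "X0 \<le> X" "V0 \<le> \<nu> X" "2 * \<tau> \<le> h0 * \<nu> X"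
    and large: "\<And>m::nat. h0 * \<nu> X / \<tau> - 1 \<le> m \<Longrightarrow> 2 * 49 < (c1 / 2) powr s * real m powr (2 - s)"
    and \<sigma>: "good_box X \<sigma>"
  shows "\<exists>(J :: (nat \<times> nat) set) m l ch. finite J \<and> card J = m\<^sup>2 \<and> 0 < m \<and> 0 < l \<and> c1 * box_size \<sigma> \<le> l * real m \<and>
        2 * 49 < (c1 / 2) powr s * real m powr (2 - s) \<and>
        (\<forall>j\<in>J. good_box X (ch j) \<and> fst (ch j) = Suc (fst \<sigma>) \<and> box_set (ch j) \<subseteq> box_set \<sigma> \<and>
           l / 2 \<le> box_size (ch j) \<and> box_size (ch j) \<le> box_size \<sigma> / 2) \<and>
        (\<forall>x t. 0 < t \<longrightarrow> real (card {j \<in> J. box_set (ch j) \<inter> ball x t \<noteq> {}}) \<le> 49 * max 1 ((t / l)\<^sup>2))"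
proof -
  obtain k G g b h where \<sigma>_eq: "\<sigma> = (k, G, g, b, h)" by (metis surj_pair)
  have sq: "square b h \<subseteq> log_strip \<psi> \<eta> X" and h: "0 < h" "\<tau> \<le> h * \<nu> (Re b)" "h * \<nu> (Re b) \<le> 4 * \<tau>"
    and dG: "\<And>w. w \<in> square b h \<Longrightarrow> (G has_field_derivative g w) (at w within square b h)" and gb: "g b \<noteq> 0"
    and g_var: "\<And>u v. u \<in> square b h \<Longrightarrow> v \<in> square b h \<Longrightarrow> norm (g u - g v) \<le> 2 * norm (u - v) * norm (g v)"
    and fk: "\<And>w. w \<in> square b h \<Longrightarrow> (f ^^ k) (G w) = exp w"
    using \<sigma> by (auto simp: \<sigma>_eq good_box_def)
  obtain bs lam lam' where bs: "Im bs = \<psi>" "Re b + 1 \<le> Re bs" and h8: "h \<le> 1/8"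
    and lam: "\<And>w. w \<in> square bs h0 \<Longrightarrow> lam w \<in> square b h"
      "\<And>w. w \<in> square bs h0 \<Longrightarrow> (lam has_field_derivative lam' w) (at w)"
      "\<And>w. w \<in> square bs h0 \<Longrightarrow> f (exp (lam w)) = exp w"
      "\<And>w. w \<in> square bs h0 \<Longrightarrow> h / (6 * \<tau> * C) \<le> norm (lam' w)"
      "\<And>w. w \<in> square bs h0 \<Longrightarrow> norm (lam' w) \<le> h / 12"
    and lam'_var: "\<And>u v. u \<in> square bs h0 \<Longrightarrow> v \<in> square bs h0 \<Longrightarrow>
        norm (lam' u - lam' v) \<le> 1/4 * norm (u - v) * norm (lam' v)"
    using inverse_branch[OF X(1,2) sq h] by (elim exE conjE) (rule that, auto)
  define H where "H = G \<circ> lam"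
  define H' where "H' w = g (lam w) * lam' w" for w
  have bS: "b \<in> square b h" "bs \<in> square bs h0" using h h0 by (auto intro: center_in_square)
  have dH: "(H has_field_derivative H' w) (at w within square bs h0)" if "w \<in> square bs h0" for w
    unfolding H_def H'_def
  proof (rule DERIV_image_chain)
    show "(G has_field_derivative g (lam w)) (at (lam w) within lam ` square bs h0)"
      by (rule has_field_derivative_subset[OF dG]) (use lam(1) that in auto)
    show "(lam has_field_derivative lam' w) (at w within square bs h0)"
      by (rule has_field_derivative_at_within[OF lam(2)[OF that]])
  qed
  \<comment> \<open>As \<open>h \<le> 1/8\<close>, points of the square are within 1/4 of
    \<open>b\<close>, so \<open>g\<close> varies by a factor of at most 3/2.\<close>
  have g_lam: "norm (g b) \<le> 3/2 * norm (g (lam w))" "norm (g (lam w)) \<le> 3/2 * norm (g b)"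
    if "w \<in> square bs h0" for w
  proof -
    note lw = lam(1)[OF that]
    have d: "2 * norm (b - lam w) \<le> 1/2"
      using norm_diff_center_le_square[OF lw] h8 by (simp add: norm_minus_commute)
    have "norm (g b - g (lam w)) \<le> 1/2 * norm (g (lam w))"
      using g_var[OF bS(1) lw] mult_right_mono[OF d, of "norm (g (lam w))"] by simp
    then show "norm (g b) \<le> 3/2 * norm (g (lam w))"
      using norm_triangle_ineq2[of "g b" "g (lam w)"] by linarith
    have "norm (g (lam w) - g b) \<le> 1/2 * norm (g b)"
      using g_var[OF lw bS(1)] mult_right_mono[OF d, of "norm (g b)"] by (simp add: norm_minus_commute)
    then show "norm (g (lam w)) \<le> 3/2 * norm (g b)"
      using norm_triangle_ineq2[of "g (lam w)" "g b"] by linarith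
  qed
  \<comment> \<open>Distortion does not accumulate: the constant 2 for \<open>g\<close> is
    multiplied by 1/8 from the contraction of \<open>lam\<close> and by 2 from comparing values of
    \<open>lam'\<close>, and 1/4 is added for \<open>lam'\<close> itself. The total 3/4 is again
    below 2.\<close>
  have H'_var: "norm (H' u - H' v) \<le> norm (u - v) * norm (H' v)"
    if uv: "u \<in> square bs h0" "v \<in> square bs h0" for u v
  proof -
    have "norm (u - v) \<le> 1/2" using norm_diff_le_square[OF uv] h0 by linarith
    then have "1/4 * norm (u - v) * norm (lam' v) \<le> 1 * norm (lam' v)" by (intro mult_right_mono) auto
    then have l2: "norm (lam' u) \<le> 2 * norm (lam' v)"
      using lam'_var[OF uv] norm_triangle_ineq2[of "lam' u" "lam' v"] by linarith
    have "norm (lam u - lam v) \<le> h / 12 * norm (u - v)"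
      by (rule field_differentiable_bound[OF convex_square has_field_derivative_at_within[OF lam(2)] lam(5)])
        (use uv in auto)
    also have "\<dots> \<le> 1/8 * norm (u - v)" using h8 h by (intro mult_right_mono) auto
    finally have l: "norm (lam u - lam v) \<le> 1/8 * norm (u - v)" .
    have "H' u - H' v = (g (lam u) - g (lam v)) * lam' u + g (lam v) * (lam' u - lam' v)"
      by (simp add: H'_def algebra_simps)
    then have "norm (H' u - H' v) \<le> norm (g (lam u) - g (lam v)) * norm (lam' u) + norm (g (lam v)) * norm (lam' u - lam' v)"
      by (metis norm_mult norm_triangle_ineq)
    also have "\<dots> \<le> (2 * (1/8 * norm (u - v)) * norm (g (lam v))) * (2 * norm (lam' v))
        + norm (g (lam v)) * (1/4 * norm (u - v) * norm (lam' v))"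
    proof (rule add_mono)
      have "norm (g (lam u) - g (lam v)) \<le> 2 * norm (lam u - lam v) * norm (g (lam v))"
        by (rule g_var[OF lam(1)[OF uv(1)] lam(1)[OF uv(2)]])
      also have "\<dots> \<le> 2 * (1/8 * norm (u - v)) * norm (g (lam v))"
        using l by (intro mult_right_mono mult_left_mono) auto
      finally show "norm (g (lam u) - g (lam v)) * norm (lam' u) \<le> (2 * (1/8 * norm (u - v)) * norm (g (lam v))) * (2 * norm (lam' v))"
        using l2 by (intro mult_mono) auto
    qed (intro mult_left_mono lam'_var uv norm_ge_zero)
    also have "\<dots> = 3/4 * (norm (u - v) * norm (H' v))" by (simp add: H'_def norm_mult)
    also have "\<dots> \<le> norm (u - v) * norm (H' v)" by simp
    finally show ?thesis .
  qed
  define D where "D = norm (H' bs)"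
  have D1: "c1 * box_size \<sigma> \<le> D * h0"
  proof -
    have "norm (g b) * (h / (6 * \<tau> * C)) \<le> 3/2 * norm (g (lam bs)) * norm (lam' bs)"
      using g_lam(1)[OF bS(2)] lam(4)[OF bS(2)] h tau_pos C_pos by (intro mult_mono) auto
    then have "2/3 * (norm (g b) * (h / (6 * \<tau> * C))) \<le> D" by (simp add: D_def H'_def norm_mult)
    then have "2/3 * (norm (g b) * (h / (6 * \<tau> * C))) * h0 \<le> D * h0" using h0 by (intro mult_right_mono) auto
    then show ?thesis by (simp add: c1_def box_size_def \<sigma>_eq field_simps)
  qed
  have D2: "D \<le> box_size \<sigma> / 8"
  proof -
    have "D \<le> 3/2 * norm (g b) * (h / 12)"
      unfolding D_def H'_def norm_mult using g_lam(2)[OF bS(2)] lam(5)[OF bS(2)] by (intro mult_mono) auto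
    then show ?thesis by (simp add: box_size_def \<sigma>_eq mult.commute)
  qed
  have bp: "0 < box_size \<sigma>" using box_nonempty_compact[OF \<sigma>] by simp
  have D0: "0 < D"
  proof -
    have "0 < c1 * box_size \<sigma>" using c1_pos bp by simp
    then have "0 < D * h0" using D1 by linarith
    then show ?thesis using h0 by (simp add: zero_less_mult_iff)
  qed
  have H'_near: "norm (H' w - H' bs) \<le> D / 4" if "w \<in> square bs h0" for w
  proof -
    have "norm (w - bs) \<le> 1/4" using norm_diff_center_le_square[OF that] h0 by linarith
    then have "norm (w - bs) * D \<le> 1/4 * D" using D0 by (intro mult_right_mono) auto
    then show ?thesis using H'_var[OF that bS(2)] by (simp add: D_def)
  qed
  have H'_lo: "3/4 * D \<le> norm (H' w)" and H'_hi: "norm (H' w) \<le> 5/4 * D" if "w \<in> square bs h0" for w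
    using H'_near[OF that] norm_triangle_ineq2[of "H' bs" "H' w"] norm_triangle_ineq2[of "H' w" "H' bs"]
    by (auto simp: D_def norm_minus_commute)
  \<comment> \<open>Subtracting the linear map with slope \<open>H' bs\<close> leaves Lipschitz
    constant \<open>D / 4\<close>. Hence \<open>H\<close> separates points at a definite rate, which
    the counting of children needs.\<close>
  have H_dist: "D / 2 * norm (u - v) \<le> norm (H u - H v)"
    if uv: "u \<in> square bs h0" "v \<in> square bs h0" for u v
  proof -
    have "norm ((H u - H' bs * u) - (H v - H' bs * v)) \<le> D / 4 * norm (u - v)"
    proof (rule field_differentiable_bound[OF convex_square])
      show "((\<lambda>z. H z - H' bs * z) has_field_derivative (H' z - H' bs)) (at z within square bs h0)"
        if "z \<in> square bs h0" for z
        by (auto intro!: derivative_eq_intros dH[OF that])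
    qed (use uv H'_near in auto)
    moreover have "(H u - H' bs * u) - (H v - H' bs * v) = (H u - H v) - H' bs * (u - v)"
      by (simp add: algebra_simps)
    ultimately have "norm ((H u - H v) - H' bs * (u - v)) \<le> D / 4 * norm (u - v)" by simp
    moreover have "norm (H' bs * (u - v)) \<le> norm (H u - H v) + norm ((H u - H v) - H' bs * (u - v))"
      by (metis norm_minus_commute norm_triangle_sub)
    moreover have "norm (H' bs * (u - v)) = D * norm (u - v)" by (simp add: D_def norm_mult)
    moreover have "D * norm (u - v) = D / 2 * norm (u - v) + D / 4 * norm (u - v) + D / 4 * norm (u - v)"
      by (simp add: algebra_simps)
    moreover have "0 \<le> D / 4 * norm (u - v)" using D0 by simp
    ultimately show ?thesis by linarith
  qed
  have sqs: "square bs h0 \<subseteq> log_strip \<psi> \<eta> X"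
  proof
    fix z assume z: "z \<in> square bs h0"
    have "X < Re b" using sq bS by (auto simp: log_strip_def)
    then show "z \<in> log_strip \<psi> \<eta> X"
      using z bs h0 by (auto simp: square_def log_strip_def abs_le_iff)
  qed
  \<comment> \<open>The least value of \<nu> over the real parts in the square, taken at the left
    edge.\<close>
  define n where "n = \<nu> (Re bs - h0)"
  have "X < Re b" using sq bS by (auto simp: log_strip_def)
  then have nX: "\<nu> X \<le> n" unfolding n_def using bs h0 by (intro \<nu>_mono) auto
  define m where "m = nat \<lfloor>h0 * n / \<tau>\<rfloor>"
  have "h0 * \<nu> X / \<tau> \<le> h0 * n / \<tau>" using nX h0 tau_pos by (intro divide_right_mono mult_left_mono) auto
  moreover have "2 \<le> h0 * \<nu> X / \<tau>" using X(3) tau_pos by (simp add: le_divide_eq)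
  ultimately have y: "2 \<le> h0 * n / \<tau>" "h0 * \<nu> X / \<tau> \<le> h0 * n / \<tau>" by linarith+
  have m: "real m \<le> h0 * n / \<tau>" "h0 * n / \<tau> - 1 < real m"
    using y(1) by (auto simp: m_def)
  have m1: "1 < real m" "h0 * n / \<tau> \<le> 2 * real m" using m y by linarith+
  then have m0: "0 < m" by simp
  have mlarge: "2 * 49 < (c1 / 2) powr s * real m powr (2 - s)"
    by (rule large) (use m y in linarith)
  define h1 where "h1 = h0 / m"
  have h1: "0 < h1" "h1 \<le> h0" using h0 m1 by (auto simp: h1_def divide_le_eq)
  have h1m: "h1 * m = h0" using m0 by (simp add: h1_def)
  define l where "l = D * h1"
  have l0: "0 < l" using D0 h1 by (simp add: l_def)
  \<comment> \<open>Centres of the \<open>m * m\<close> squares of half-side \<open>h1\<close> that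
    tile \<open>square bs h0\<close>.\<close>
  define c where "c = (\<lambda>(i::nat, j::nat). bs + Complex ((2 * real i + 1) * h1 - h0) ((2 * real j + 1) * h1 - h0))"
  define ch where "ch ij = (Suc k, H, H', c ij, h1)" for ij
  define J where "J = {..<m} \<times> {..<m}"
  have edge: "\<bar>(2 * real i + 1) * h1 - h0\<bar> + h1 \<le> h0" if "i < m" for i
  proof -
    have "(2 * real i + 2) * h1 \<le> 2 * real m * h1" using that h1 by (intro mult_right_mono) auto
    moreover have "2 * real m * h1 = 2 * h0" using h1m by (simp add: mult.commute mult.left_commute)
    moreover have "0 \<le> real i * h1" using h1 by simp
    ultimately show ?thesis by (simp add: algebra_simps abs_le_iff)
  qed
  have c_sq: "square (c ij) h1 \<subseteq> square bs h0" if "ij \<in> J" for ij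
  proof
    fix z assume z: "z \<in> square (c ij) h1"
    obtain i j where ij: "ij = (i, j)" "i < m" "j < m" using \<open>ij \<in> J\<close> unfolding J_def by auto
    show "z \<in> square bs h0"
      using z edge[OF ij(2)] edge[OF ij(3)] unfolding ij(1) square_def c_def by (auto simp: abs_le_iff)
  qed
  have c_in: "c ij \<in> square bs h0" if "ij \<in> J" for ij
    using c_sq[OF that] center_in_square[of h1 "c ij"] h1 by auto
  have size: "box_size (ch ij) = norm (H' (c ij)) * h1" for ij by (simp add: box_size_def ch_def)
  have box: "good_box X (ch ij)" if "ij \<in> J" for ij
  proof -
    note csq = c_sq[OF that]
    have Rc: "Re bs - h0 \<le> Re (c ij)" "Re (c ij) \<le> (Re bs - h0) + 2 * h0"
      using c_in[OF that] by (auto simp: square_def abs_le_iff)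
    have n0: "0 < n" using y(1) h0 tau_pos by (smt (verit) divide_nonpos_pos mult_nonneg_nonpos)
    have "\<tau> \<le> h1 * n" using m(1) m0 tau_pos by (simp add: h1_def field_simps)
    also have "\<dots> \<le> h1 * \<nu> (Re (c ij))" unfolding n_def using Rc h1 by (intro mult_left_mono \<nu>_mono) auto
    finally have t1: "\<tau> \<le> h1 * \<nu> (Re (c ij))" .
    \<comment> \<open>Across the square \<nu> grows by a factor of at most 2, and rounding
      \<open>m\<close> down costs at most another 2; together they give the 4 in
      \<open>4 * \<tau>\<close>.\<close>
    have e2: "exp (2 * h0) \<le> 2"
    proof -
      have "exp (2 * h0) \<le> exp (1/4)" using h0 by simp
      also have "\<dots> \<le> 1 + 1/4 + (1/4)\<^sup>2" by (rule exp_bound) auto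
      also have "\<dots> \<le> (2::real)" by (simp add: power2_eq_square)
      finally show ?thesis .
    qed
    have "\<nu> (Re (c ij)) \<le> \<nu> ((Re bs - h0) + 2 * h0)" by (rule \<nu>_mono[OF Rc(2)])
    also have "\<dots> \<le> exp (2 * h0) * n" unfolding n_def by (rule \<nu>_add_le) (use h0 in simp)
    also have "\<dots> \<le> 2 * n" using e2 n0 by (intro mult_right_mono) auto
    finally have "h1 * \<nu> (Re (c ij)) \<le> h1 * (2 * n)" using h1 by (intro mult_left_mono) auto
    also have "\<dots> \<le> 4 * \<tau>" using m1(2) m0 tau_pos by (simp add: h1_def field_simps)
    finally have t2: "h1 * \<nu> (Re (c ij)) \<le> 4 * \<tau>" .
    have fH: "(f ^^ Suc k) (H w) = exp w" if "w \<in> square bs h0" for w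
      using fk[OF lam(1)[OF that]] lam(3)[OF that] by (simp add: H_def)
    have var2: "norm (H' u - H' v) \<le> 2 * norm (u - v) * norm (H' v)"
      if "u \<in> square bs h0" "v \<in> square bs h0" for u v
    proof -
      have "0 \<le> norm (u - v) * norm (H' v)" by simp
      then show ?thesis using H'_var[OF that] by linarith
    qed
    have "H' (c ij) \<noteq> 0" using H'_lo[OF c_in[OF that]] D0 by auto
    then show ?thesis
      unfolding good_box_def ch_def case_prod_conv
    proof (intro conjI ballI)
      fix w assume w: "w \<in> square (c ij) h1"
      then have w': "w \<in> square bs h0" using csq by blast
      show "(H has_field_derivative H' w) (at w within square (c ij) h1)"
        by (rule has_field_derivative_subset[OF dH[OF w'] csq])
      show "(f ^^ Suc k) (H w) = exp w" by (rule fH[OF w'])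
      fix v assume "v \<in> square (c ij) h1"
      then show "norm (H' w - H' v) \<le> 2 * norm (w - v) * norm (H' v)" using csq by (intro var2 w') blast
    qed (use csq sqs h1(1) t1 t2 in auto)
  qed
  \<comment> \<open>Children meeting one ball of radius \<open>t\<close> have grid coordinates
    differing by at most \<open>2 * t / l + 1\<close>, where the 1 stems from the width of the
    squares. They fit into a block of side \<open>4 * t / l + 3 \<le> 7 * max 1 (t / l)\<close>,
    whence \<open>49 = 7 * 7\<close>.\<close>
  have count: "real (card {ij \<in> J. box_set (ch ij) \<inter> ball x t \<noteq> {}}) \<le> 49 * max 1 ((t / l)\<^sup>2)"
    if t: "0 < t" for x t
  proof -
    have close: "\<bar>real i - real i'\<bar> \<le> 2 * t / l + 1 \<and> \<bar>real j - real j'\<bar> \<le> 2 * t / l + 1"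
      if ij: "(i, j) \<in> {ij \<in> J. box_set (ch ij) \<inter> ball x t \<noteq> {}}"
        and ij': "(i', j') \<in> {ij \<in> J. box_set (ch ij) \<inter> ball x t \<noteq> {}}" for i j i' j'
    proof -
      obtain p where p: "p \<in> square (c (i, j)) h1" "H p \<in> ball x t"
        using ij by (auto simp: box_set_def ch_def)
      obtain p' where p': "p' \<in> square (c (i', j')) h1" "H p' \<in> ball x t"
        using ij' by (auto simp: box_set_def ch_def)
      have pp: "p \<in> square bs h0" "p' \<in> square bs h0"
        using c_sq p(1) p'(1) ij ij' by auto
      have "norm (H p - H p') \<le> 2 * t"
        using p(2) p'(2) dist_triangle_less_add[of "H p" x t "H p'" t]
        by (simp add: dist_norm norm_minus_commute)
      then have "D / 2 * norm (p - p') \<le> 2 * t" using H_dist[OF pp] by linarith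
      then have np: "norm (p - p') \<le> 4 * t / D" using D0 by (simp add: field_simps)
      have conv: "\<bar>real i - real i'\<bar> \<le> 2 * t / l + 1" if "\<bar>2 * h1 * (real i - real i')\<bar> \<le> 4 * t / D + 2 * h1" for i i' :: nat
      proof -
        have "4 * t / D + 2 * h1 = 2 * h1 * (2 * t / l + 1)" using h1 D0 by (simp add: l_def field_simps)
        moreover have "\<bar>2 * h1 * (real i - real i')\<bar> = 2 * h1 * \<bar>real i - real i'\<bar>" using h1 by (simp add: abs_mult)
        ultimately have "2 * h1 * \<bar>real i - real i'\<bar> \<le> 2 * h1 * (2 * t / l + 1)" using that by linarith
        then show ?thesis using h1 by (simp add: mult_le_cancel_left)
      qed
      have "\<bar>Re (p - p')\<bar> \<le> 4 * t / D" "\<bar>Im (p - p')\<bar> \<le> 4 * t / D"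
        using np abs_Re_le_cmod[of "p - p'"] abs_Im_le_cmod[of "p - p'"] by linarith+
      then have "\<bar>2 * h1 * (real i - real i')\<bar> \<le> 4 * t / D + 2 * h1"
        "\<bar>2 * h1 * (real j - real j')\<bar> \<le> 4 * t / D + 2 * h1"
        using p(1) p'(1) by (auto simp: square_def c_def abs_le_iff algebra_simps)
      then show ?thesis using conv by blast
    qed
    have "real (card {ij \<in> J. box_set (ch ij) \<inter> ball x t \<noteq> {}}) \<le> (2 * (2 * t / l + 1) + 1)\<^sup>2"
    proof (rule card_grid_le)
      show "finite {ij \<in> J. box_set (ch ij) \<inter> ball x t \<noteq> {}}" by (simp add: J_def)
      show "0 \<le> 2 * t / l + 1" using t l0 by simp
    qed (rule close)
    also have "\<dots> \<le> (7 * max 1 (t / l))\<^sup>2"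
      using t l0 by (intro power_mono) (auto simp: max_def field_simps)
    also have "\<dots> = 49 * max 1 ((t / l)\<^sup>2)"
    proof (cases "1 \<le> t / l")
      case True
      then have "1 \<le> (t / l)\<^sup>2" by (rule one_le_power)
      then show ?thesis using True by (simp add: max_def power2_eq_square)
    next
      case False
      then have "(t / l)\<^sup>2 \<le> 1" using t l0 by (intro power_le_one) auto
      then show ?thesis using False by (simp add: max_def)
    qed
    finally show ?thesis .
  qed
  have child: "good_box X (ch ij) \<and> fst (ch ij) = Suc (fst \<sigma>) \<and> box_set (ch ij) \<subseteq> box_set \<sigma> \<and>
      l / 2 \<le> box_size (ch ij) \<and> box_size (ch ij) \<le> box_size \<sigma> / 2" if "ij \<in> J" for ij
  proof (intro conjI box that)
    show "fst (ch ij) = Suc (fst \<sigma>)" by (simp add: ch_def \<sigma>_eq)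
    show "box_set (ch ij) \<subseteq> box_set \<sigma>"
      using c_sq[OF that] lam(1) by (auto simp: box_set_def ch_def \<sigma>_eq H_def)
    have "D / 2 * h1 \<le> norm (H' (c ij)) * h1"
      using H'_lo[OF c_in[OF that]] D0 h1 by (intro mult_right_mono) auto
    then show "l / 2 \<le> box_size (ch ij)" by (simp add: size l_def)
    have "norm (H' (c ij)) * h1 \<le> 5/4 * D * 1"
      using H'_hi[OF c_in[OF that]] D0 h1 h0 by (intro mult_mono) auto
    then show "box_size (ch ij) \<le> box_size \<sigma> / 2" using D2 bp by (simp add: size)
  qed
  have "card J = m\<^sup>2" "finite J" by (simp_all add: J_def power2_eq_square)
  moreover have "c1 * box_size \<sigma> \<le> l * real m" using D1 h1m by (simp add: l_def mult.assoc)
  ultimately show ?thesis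
    using m0 l0 mlarge child count
    by (intro exI[of _ J] exI[of _ m] exI[of _ l] exI[of _ ch]) simp
qed

text \<open>The initial branch is \<open>exp\<close> itself, which inverts the logarithmic
  coordinate for \<open>f ^^ 0\<close>, on a square of half-side exactly
  \<open>\<tau> / \<nu>\<close>.\<close>

lemma exists_box:
  assumes X: "X0 \<le> X" "V0 \<le> \<nu> X" "2 * \<tau> \<le> h0 * \<nu> X"
  shows "\<exists>\<sigma>. good_box X \<sigma> \<and> fst \<sigma> = 0"
proof -
  define b where "b = Complex (X + 1) \<psi>"
  define h where "h = \<tau> / \<nu> (Re b)"
  have "\<nu> X \<le> \<nu> (Re b)" by (rule \<nu>_mono) (simp add: b_def)
  then have "h0 * \<nu> X \<le> h0 * \<nu> (Re b)" using h0 by (intro mult_left_mono) auto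
  then have "2 * \<tau> \<le> h0 * \<nu> (Re b)" using X by linarith
  moreover from this have "0 < \<nu> (Re b)"
    using tau_pos h0 by (smt (verit) mult_nonneg_nonpos)
  ultimately have h: "0 < h" "h \<le> h0 / 2" "h * \<nu> (Re b) = \<tau>"
    using tau_pos by (auto simp: h_def field_simps)
  have "norm (exp u - exp v) \<le> 2 * norm (u - v) * norm (exp v)" if "u \<in> square b h" "v \<in> square b h" for u v :: complex
  proof -
    have "norm (u - v) \<le> 1/2" using norm_diff_le_square[OF that] h h0 by linarith
    then have "norm (exp (u - v) - 1) \<le> 2 * norm (u - v)"
      using norm_exp_bounds(2)[of "u - v"] norm_ge_zero[of "u - v"] by linarith
    then have "norm (exp (u - v) - 1) * norm (exp v) \<le> 2 * norm (u - v) * norm (exp v)" by (rule mult_right_mono) simp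
    moreover have "exp u - exp v = (exp (u - v) - 1) * exp v" by (simp add: algebra_simps flip: exp_add)
    ultimately show ?thesis by (simp only: norm_mult)
  qed
  moreover have "square b h \<subseteq> log_strip \<psi> \<eta> X"
    using h h0 by (auto simp: square_def log_strip_def b_def abs_le_iff)
  ultimately have "good_box X (0, exp, exp, b, h)"
    using h tau_pos by (auto simp: good_box_def intro: has_field_derivative_at_within[OF DERIV_exp])
  then show ?thesis by (intro exI[of _ "(0, exp, exp, b, h)"]) simp
qed

text \<open>The cut-off \<open>X\<close> depends on \<open>s\<close>: the game needs
  \<open>98 < (c1 / 2) powr s * m powr (2 - s)\<close>, hence many children, and a large value of
  \<open>\<nu> X\<close> guarantees them.\<close>

lemma hausdorff_measure_itinerary_nonzero:
  assumes s: "0 < s" "s < 2"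
  shows "\<exists>X\<ge>Y. hausdorff_measure s {z. \<forall>n. (f ^^ n) z \<in> exp ` log_strip \<psi> \<eta> X} \<noteq> 0"
proof -
  have "filterlim (\<lambda>m. real m powr (2 - s)) at_top sequentially"
    using s by real_asymp
  then have "\<forall>\<^sub>F m in sequentially. 2 * 49 / (c1 / 2) powr s + 1 \<le> real m powr (2 - s)"
    by (simp add: filterlim_at_top)
  then obtain M :: nat where M: "\<And>m. m \<ge> M \<Longrightarrow> 2 * 49 / (c1 / 2) powr s + 1 \<le> real m powr (2 - s)"
    by (auto simp: eventually_sequentially)
  have large: "2 * 49 < (c1 / 2) powr s * real m powr (2 - s)" if "m \<ge> M" for m
  proof -
    have p: "0 < (c1 / 2) powr s" using c1_pos by simp
    have "2 * 49 / (c1 / 2) powr s < real m powr (2 - s)" using M[OF that] by linarith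
    then show ?thesis using p by (simp add: divide_less_eq mult.commute)
  qed
  obtain Z where Z: "\<And>x. x \<ge> Z \<Longrightarrow> max V0 (max (2 * \<tau> / h0) (\<tau> * (M + 1) / h0)) \<le> \<nu> x"
    using \<nu>_unbounded by blast
  define X where "X = max Y (max X0 Z)"
  have X: "Y \<le> X" "X0 \<le> X" "V0 \<le> \<nu> X" "2 * \<tau> / h0 \<le> \<nu> X" "\<tau> * (M + 1) / h0 \<le> \<nu> X"
    using Z[of X] by (auto simp: X_def)
  have X3: "2 * \<tau> \<le> h0 * \<nu> X" using X(4) h0 by (simp add: field_simps)
  have "real M + 1 \<le> h0 * \<nu> X / \<tau>" using X(5) h0 tau_pos by (simp add: field_simps)
  then have large': "2 * 49 < (c1 / 2) powr s * real m powr (2 - s)" if "h0 * \<nu> X / \<tau> - 1 \<le> real m" for m :: nat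
    using that by (intro large) linarith
  let ?E = "{z. \<forall>n. (f ^^ n) z \<in> exp ` log_strip \<psi> \<eta> X}"
  obtain \<sigma>0 where \<sigma>0: "good_box X \<sigma>0" "fst \<sigma>0 = 0" using exists_box[OF X(2,3) X3] by blast
  have "\<exists>e>0. \<forall>y r. (\<forall>i::nat. 0 < r i) \<and> summable (\<lambda>i. r i powr s) \<and> (\<Sum>i. r i powr s) < e \<longrightarrow>
      (\<exists>x \<sigma>. \<sigma> 0 = \<sigma>0 \<and> (\<forall>k. good_box X (\<sigma> k) \<and> fst (\<sigma> (Suc k)) = Suc (fst (\<sigma> k)) \<and> x \<in> box_set (\<sigma> k)) \<and>
         x \<notin> (\<Union>i. ball (y i) (r i)))"
    by (rule nested_sets_avoid_balls[where C = 49 and d = box_size, OF s _ c1_pos box_nonempty_compact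
          box_children[OF X(2,3) X3 large'] \<sigma>0(1)]) simp_all
  then obtain e where e: "0 < e" "\<forall>y r. (\<forall>i::nat. 0 < r i) \<and> summable (\<lambda>i. r i powr s) \<and> (\<Sum>i. r i powr s) < e \<longrightarrow>
      (\<exists>x \<sigma>. \<sigma> 0 = \<sigma>0 \<and> (\<forall>k. good_box X (\<sigma> k) \<and> fst (\<sigma> (Suc k)) = Suc (fst (\<sigma> k)) \<and> x \<in> box_set (\<sigma> k)) \<and>
         x \<notin> (\<Union>i. ball (y i) (r i)))"
    by (elim exE conjE) (rule that)
  have "hausdorff_measure s ?E \<noteq> 0"
  proof (rule hausdorff_measure_nonzeroI[OF s(1) e(1)])
    fix y :: "nat \<Rightarrow> complex" and r :: "nat \<Rightarrow> real"
    assume r: "\<And>i. 0 < r i" "summable (\<lambda>i. r i powr s)" "(\<Sum>i. r i powr s) < e"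
    then obtain x \<sigma> where x: "\<sigma> 0 = \<sigma>0" "\<And>k. good_box X (\<sigma> k)" "\<And>k. fst (\<sigma> (Suc k)) = Suc (fst (\<sigma> k))"
      "\<And>k. x \<in> box_set (\<sigma> k)" "x \<notin> (\<Union>i. ball (y i) (r i))"
      using e(2) by meson
    have "(f ^^ n) x \<in> exp ` log_strip \<psi> \<eta> X" for n
    proof -
      \<comment> \<open>The first component counts generations, so the box with index
        \<open>n\<close> records where the \<open>n\<close>-th iterate lies.\<close>
      have "fst (\<sigma> n) = n" by (induction n) (use x \<sigma>0 in auto)
      then obtain G g b h where \<sigma>n: "\<sigma> n = (n, G, g, b, h)" by (metis fst_conv surj_pair)
      obtain w where "w \<in> square b h" "x = G w" using x(4)[of n] by (auto simp: \<sigma>n box_set_def)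
      then show ?thesis using x(2)[of n] by (auto simp: \<sigma>n good_box_def)
    qed
    then show "\<not> ?E \<subseteq> (\<Union>i. ball (y i) (r i))" using x(5) by blast
  qed
  then show ?thesis using X(1) by blast
qed

end

section \<open>Canonical products of genus zero in a sector\<close>

text \<open>The hypothesis puts \<open>w\<close> into a closed sector within the right half plane,
  where \<open>1 + Re w\<close> is a lower bound for \<open>norm (1 + w)\<close>. The second
  estimate rests on Re(w/(1+w)) = (Re w + |w|^2)/|1+w|^2.\<close>

lemma sector_factor_bounds:
  fixes w :: complex
  assumes "0 < \<epsilon>" "\<epsilon> \<le> 1" "\<epsilon> * norm w \<le> Re w"
  shows "1 + \<epsilon> * norm w \<le> norm (1 + w)" "\<epsilon> * (norm w / (1 + norm w)) \<le> Re (w / (1 + w))"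
proof -
  have "1 + \<epsilon> * norm w \<le> Re (1 + w)" using assms by simp
  also have "\<dots> \<le> norm (1 + w)" by (rule complex_Re_le_cmod)
  finally show *: "1 + \<epsilon> * norm w \<le> norm (1 + w)" .
  have pos: "0 < norm (1 + w)" using * assms by (smt (verit) mult_nonneg_nonneg norm_ge_zero)
  have Re: "Re (w / (1 + w)) = (Re w + (norm w)\<^sup>2) / (norm (1 + w))\<^sup>2"
    unfolding cmod_power2 by (simp add: Re_divide power2_eq_square algebra_simps)
  have "\<epsilon> * (norm w / (1 + norm w)) = \<epsilon> * norm w * (1 + norm w) / (1 + norm w)\<^sup>2"
    by (simp add: power2_eq_square)
  also have "\<dots> \<le> (Re w + (norm w)\<^sup>2) / (1 + norm w)\<^sup>2"
  proof (rule divide_right_mono)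
    have "\<epsilon> * (norm w * norm w) \<le> 1 * (norm w * norm w)" using assms by (intro mult_right_mono) auto
    then show "\<epsilon> * norm w * (1 + norm w) \<le> Re w + (norm w)\<^sup>2"
      using assms by (simp add: power2_eq_square algebra_simps)
  qed simp
  also have "\<dots> \<le> (Re w + (norm w)\<^sup>2) / (norm (1 + w))\<^sup>2"
  proof (rule divide_left_mono)
    show "(norm (1 + w))\<^sup>2 \<le> (1 + norm w)\<^sup>2"
      using norm_triangle_ineq[of 1 w] by (intro power_mono) auto
    have "0 \<le> \<epsilon> * norm w" using assms by simp
    then show "0 \<le> Re w + (norm w)\<^sup>2" using assms(3) by (smt (verit) zero_le_power2)
    show "0 < (1 + norm w)\<^sup>2 * (norm (1 + w))\<^sup>2"
      using pos norm_ge_zero[of w] by (intro mult_pos_pos zero_less_power) linarith+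
  qed
  finally show "\<epsilon> * (norm w / (1 + norm w)) \<le> Re (w / (1 + w))" using Re by simp
qed

text \<open>For the finitely many zeros of uncontrolled argument: once
  \<open>norm w \<ge> 4\<close>, the modulus alone forces both bounds.\<close>

lemma large_factor_bounds:
  fixes w :: complex
  assumes "0 < \<epsilon>" "\<epsilon> \<le> 1/2" "4 \<le> norm w"
  shows "1 + \<epsilon> * norm w \<le> norm (1 + w)" "\<epsilon> * (norm w / (1 + norm w)) \<le> Re (w / (1 + w))"
proof -
  have "\<epsilon> * norm w \<le> 1/2 * norm w" using assms by (intro mult_right_mono) auto
  moreover have "norm w - 1 \<le> norm (1 + w)" using norm_triangle_ineq4[of "1 + w" 1] by simp
  ultimately show "1 + \<epsilon> * norm w \<le> norm (1 + w)" using assms(3) by linarith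
  have pos: "0 < norm (1 + w)" using \<open>norm w - 1 \<le> norm (1 + w)\<close> assms by linarith
  have Re: "Re (w / (1 + w)) = (Re w + (norm w)\<^sup>2) / (norm (1 + w))\<^sup>2"
    unfolding cmod_power2 by (simp add: Re_divide power2_eq_square algebra_simps)
  have num: "1/2 * norm w * (1 + norm w) \<le> Re w + (norm w)\<^sup>2"
  proof -
    have "0 \<le> norm w * (norm w - 3)" using assms by (intro mult_nonneg_nonneg) auto
    then show ?thesis using complex_Re_le_cmod[of "- w"] by (simp add: power2_eq_square algebra_simps)
  qed
  have "\<epsilon> * (norm w / (1 + norm w)) \<le> 1/2 * (norm w / (1 + norm w))"
    using assms by (intro mult_right_mono) auto
  also have "\<dots> = 1/2 * norm w * (1 + norm w) / (1 + norm w)\<^sup>2"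
    by (simp add: power2_eq_square)
  also have "\<dots> \<le> (Re w + (norm w)\<^sup>2) / (1 + norm w)\<^sup>2"
    by (rule divide_right_mono[OF num]) simp
  also have "\<dots> \<le> (Re w + (norm w)\<^sup>2) / (norm (1 + w))\<^sup>2"
  proof (rule divide_left_mono)
    show "(norm (1 + w))\<^sup>2 \<le> (1 + norm w)\<^sup>2"
      using norm_triangle_ineq[of 1 w] by (intro power_mono) auto
    have "0 \<le> 1/2 * norm w * (1 + norm w)" by simp
    then show "0 \<le> Re w + (norm w)\<^sup>2" using num by linarith
    show "0 < (1 + norm w)\<^sup>2 * (norm (1 + w))\<^sup>2"
      using pos norm_ge_zero[of w] by (intro mult_pos_pos zero_less_power) linarith+
  qed
  finally show "\<epsilon> * (norm w / (1 + norm w)) \<le> Re (w / (1 + w))" using Re by simp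
qed

lemma uniform_limit_canonical_product:
  fixes b :: "nat \<Rightarrow> complex"
  assumes "summable (\<lambda>n. 1 / norm (b n))"
  shows "uniform_limit (cball 0 R) (\<lambda>n z. \<Prod>k<n. 1 + z / b k) (\<lambda>z. \<Prod>k. 1 + z / b k) sequentially"
proof -
  have "uniformly_convergent_on (cball 0 R) (\<lambda>n z. \<Sum>k<n. norm (z / b k))"
  proof (rule Weierstrass_m_test'_ev)
    show "\<forall>\<^sub>F n in sequentially. \<forall>z\<in>cball 0 R. norm (norm (z / b n)) \<le> R * (1 / norm (b n))"
      by (intro always_eventually allI ballI) (auto simp: norm_divide divide_right_mono)
  qed (intro summable_mult assms)
  then have "uniformly_convergent_on (cball 0 R) (\<lambda>n z. \<Prod>k<n. 1 + z / b k)"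
    by (intro Complex_Transcendental.uniformly_convergent_on_prod compact_cball)
      (auto intro!: continuous_intros simp: divide_inverse)
  then obtain l where l: "uniform_limit (cball 0 R) (\<lambda>n z. \<Prod>k<n. 1 + z / b k) l sequentially"
    by (auto simp: uniformly_convergent_on_def)
  \<comment> \<open>The M-test gives an unnamed limit; pointwise convergence identifies it with the
    infinite product.\<close>
  have "l z = (\<Prod>k. 1 + z / b k)" if "z \<in> cball 0 R" for z
  proof -
    have "summable (\<lambda>k. norm ((1 + z / b k) - 1))"
      using summable_mult[OF assms, of "norm z"] by (simp add: norm_divide)
    then have "convergent_prod (\<lambda>k. 1 + z / b k)"
      by (intro abs_convergent_prod_imp_convergent_prod summable_imp_abs_convergent_prod)
    then have "(\<lambda>n. \<Prod>k<n. 1 + z / b k) \<longlonglongrightarrow> (\<Prod>k. 1 + z / b k)"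
      by (intro has_prod_imp_tendsto') (simp add: convergent_prod_has_prod_iff)
    moreover have "(\<lambda>n. \<Prod>k<n. 1 + z / b k) \<longlonglongrightarrow> l z"
      using l that by (rule tendsto_uniform_limitI)
    ultimately show ?thesis by (metis LIMSEQ_unique)
  qed
  then show ?thesis using uniform_limit_cong'[THEN iffD1, OF _ _ l] by fastforce
qed

text \<open>The bounds \<open>factor\<close> hold because \<open>z / b n\<close> stays away from the negative real axis in the sector.\<close>

locale sector_product =
  fixes f :: "complex \<Rightarrow> complex" and c :: complex and q :: nat and b :: "nat \<Rightarrow> complex"
    and \<psi> \<eta> \<epsilon> X0 :: real
  assumes c: "c \<noteq> 0" and b: "\<And>n. b n \<noteq> 0" and summ: "summable (\<lambda>n. 1 / norm (b n))"
    and f_eq: "\<And>z. f z = c * z ^ q * (\<Prod>n. 1 + z / b n)"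
    and eps: "0 < \<epsilon>" "\<epsilon> \<le> 1"
    and factor: "\<And>\<zeta> n. \<zeta> \<in> log_strip \<psi> \<eta> X0 \<Longrightarrow> 1 + \<epsilon> * norm (exp \<zeta> / b n) \<le> norm (1 + exp \<zeta> / b n)"
      "\<And>\<zeta> n. \<zeta> \<in> log_strip \<psi> \<eta> X0 \<Longrightarrow>
        \<epsilon> * (norm (exp \<zeta> / b n) / (1 + norm (exp \<zeta> / b n))) \<le> Re (exp \<zeta> / b n / (1 + exp \<zeta> / b n))"
begin

text \<open>A smoothed count of the zeros \<open>- b n\<close> of modulus at most
  \<open>exp x\<close>: each of these contributes at least 1/2, and a distant one about
  \<open>exp x / norm (b n)\<close>.\<close>

definition \<nu> :: "real \<Rightarrow> real" where
  "\<nu> x = (\<Sum>n. (exp x / norm (b n)) / (1 + exp x / norm (b n)))"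

definition K :: "complex \<Rightarrow> complex" where
  "K \<zeta> = exp \<zeta> * deriv f (exp \<zeta>) / f (exp \<zeta>)"

lemma ulim: "uniform_limit (cball 0 R) (\<lambda>n z. \<Prod>k<n. 1 + z / b k) (\<lambda>z. \<Prod>k. 1 + z / b k) sequentially"
  by (rule uniform_limit_canonical_product[OF summ])

lemma plim: "(\<lambda>n. \<Prod>k<n. 1 + z / b k) \<longlonglongrightarrow> (\<Prod>k. 1 + z / b k)"
  by (rule tendsto_uniform_limitI[OF ulim[of "norm z"]]) simp

lemma norm_flim: "(\<lambda>n. norm c * norm z ^ q * (\<Prod>k<n. norm (1 + z / b k))) \<longlonglongrightarrow> norm (f z)"
  unfolding f_eq norm_mult norm_power prod_norm
  by (intro tendsto_intros plim)

lemma prodinf_nonzero: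
  assumes "\<zeta> \<in> log_strip \<psi> \<eta> X0"
  shows "(\<Prod>k. 1 + exp \<zeta> / b k) \<noteq> 0"
proof -
  have "1 \<le> norm (\<Prod>k<n. 1 + exp \<zeta> / b k)" for n
    unfolding prod_norm[symmetric]
  proof (rule prod_ge_1)
    fix k
    have "0 \<le> \<epsilon> * norm (exp \<zeta> / b k)" using eps by simp
    then show "1 \<le> norm (1 + exp \<zeta> / b k)" using factor(1)[OF assms, of k] by linarith
  qed
  then have "1 \<le> norm (\<Prod>k. 1 + exp \<zeta> / b k)"
    by (intro tendsto_lowerbound[OF tendsto_norm[OF plim]]) auto
  then show ?thesis by auto
qed

lemma f_nonzero: "\<zeta> \<in> log_strip \<psi> \<eta> X0 \<Longrightarrow> f (exp \<zeta>) \<noteq> 0"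
  using prodinf_nonzero c by (simp add: f_eq)

lemma summable_\<nu>: "summable (\<lambda>n. (exp x / norm (b n)) / (1 + exp x / norm (b n)))"
proof (rule summable_comparison_test'[OF summable_mult[OF summ, of "exp x"], of 0])
  fix n
  have "exp x / norm (b n) / (1 + exp x / norm (b n)) \<le> exp x / norm (b n) / 1"
    by (intro divide_left_mono) (auto intro!: mult_pos_pos add_pos_nonneg)
  then show "norm (exp x / norm (b n) / (1 + exp x / norm (b n))) \<le> exp x * (1 / norm (b n))" by simp
qed

text \<open>Locally uniform convergence permits logarithmic differentiation factor by factor; the
  power \<open>z ^ q\<close> accounts for the \<open>q\<close> on the right.\<close>

lemma K_sums:
  assumes "\<zeta> \<in> log_strip \<psi> \<eta> X0"
  shows "(\<lambda>n. exp \<zeta> / b n / (1 + exp \<zeta> / b n)) sums (K \<zeta> - of_nat q)"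
proof -
  define P where "P = (\<lambda>z. \<Prod>k. 1 + z / b k)"
  define z where "z = exp \<zeta>"
  have z: "z \<noteq> 0" by (simp add: z_def)
  have Pz: "P z \<noteq> 0" using prodinf_nonzero[OF assms] by (simp add: P_def z_def)
  have ul: "uniform_limit (ball 0 (norm z + 1)) (\<lambda>n z. \<Prod>k<n. 1 + z / b k) P sequentially"
    unfolding P_def by (rule uniform_limit_on_subset[OF ulim ball_subset_cball])
  have hol: "(\<lambda>z. 1 + z / b k) holomorphic_on S" for k S using b by (intro holomorphic_intros) auto
  have s: "(\<lambda>k. deriv (\<lambda>z. 1 + z / b k) z / (1 + z / b k)) sums (deriv P z / P z)"
    by (rule logderiv_prodinf_complex_uniform_limit[where A = "ball 0 (norm z + 1)"])
      (use ul hol Pz in auto)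
  have "deriv (\<lambda>z. 1 + z / b k) z = 1 / b k" for k
    by (rule DERIV_imp_deriv) (auto intro!: derivative_eq_intros b)
  then have s1: "(\<lambda>k. z / b k / (1 + z / b k)) sums (z * (deriv P z / P z))"
    using sums_mult[OF s, of z] by simp
  have "P holomorphic_on ball 0 (norm z + 1)"
  proof (rule holomorphic_uniform_sequence)
    show "\<exists>d>0. cball x d \<subseteq> ball 0 (norm z + 1) \<and> uniform_limit (cball x d) (\<lambda>n z. \<Prod>k<n. 1 + z / b k) P sequentially"
      if "x \<in> ball 0 (norm z + 1)" for x
    proof -
      obtain d where "0 < d" "cball x d \<subseteq> ball 0 (norm z + 1)"
        using \<open>x \<in> _\<close> open_ball open_contains_cball by blast
      then show ?thesis using uniform_limit_on_subset[OF ul] by blast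
    qed
  qed (auto intro!: holomorphic_intros b)
  then have dP: "(P has_field_derivative deriv P z) (at z)"
    by (auto intro!: holomorphic_derivI)
  have "((\<lambda>z. c * z ^ q * P z) has_field_derivative (c * (of_nat q * z ^ (q - 1)) * P z + c * z ^ q * deriv P z)) (at z)"
    by (auto intro!: derivative_eq_intros dP)
  moreover have "(\<lambda>z. c * z ^ q * P z) = f" by (simp add: fun_eq_iff f_eq P_def)
  ultimately have "deriv f z = c * (of_nat q * z ^ (q - 1)) * P z + c * z ^ q * deriv P z"
    by (simp add: DERIV_imp_deriv)
  \<comment> \<open>The split on \<open>q\<close> takes care of the truncated exponent
    \<open>q - 1\<close> at \<open>q = 0\<close>.\<close>
  then have "z * deriv f z = of_nat q * f z + f z * (z * (deriv P z / P z))"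
    using Pz by (cases q) (simp_all add: f_eq P_def[symmetric] P_def[THEN fun_cong, symmetric] algebra_simps)
  moreover have "f z \<noteq> 0" using f_nonzero[OF assms] by (simp add: z_def)
  ultimately have "z * deriv f z / f z = of_nat q + z * (deriv P z / P z)"
    by (simp add: field_simps)
  then show ?thesis using s1 by (simp add: K_def z_def)
qed

lemma Re_K_ge:
  assumes "\<zeta> \<in> log_strip \<psi> \<eta> X0"
  shows "\<epsilon> * \<nu> (Re \<zeta>) \<le> Re (K \<zeta>)"
proof -
  have s: "(\<lambda>n. Re (exp \<zeta> / b n / (1 + exp \<zeta> / b n))) sums Re (K \<zeta> - of_nat q)"
    by (rule sums_Re[OF K_sums[OF assms]])
  have "\<epsilon> * \<nu> (Re \<zeta>) = (\<Sum>n. \<epsilon> * ((exp (Re \<zeta>) / norm (b n)) / (1 + exp (Re \<zeta>) / norm (b n))))"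
    unfolding \<nu>_def by (rule suminf_mult[OF summable_\<nu>, symmetric])
  also have "\<dots> \<le> (\<Sum>n. Re (exp \<zeta> / b n / (1 + exp \<zeta> / b n)))"
    using factor(2)[OF assms]
    by (intro suminf_le summable_mult summable_\<nu> sums_summable[OF s]) (simp add: norm_divide)
  also have "\<dots> = Re (K \<zeta>) - real q" using sums_unique[OF s] by simp
  finally show ?thesis by simp
qed

lemma factor_quotient_le:
  assumes "\<zeta> \<in> log_strip \<psi> \<eta> X0"
  shows "inverse (norm (1 + exp \<zeta> / b n)) \<le> 1 / \<epsilon> * inverse (1 + norm (exp \<zeta> / b n))"
proof -
  have "\<epsilon> * (1 + norm (exp \<zeta> / b n)) \<le> norm (1 + exp \<zeta> / b n)"
    using factor(1)[OF assms, of n] eps by (simp add: distrib_left)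
  moreover have "0 < \<epsilon> * (1 + norm (exp \<zeta> / b n))" using eps by (intro mult_pos_pos add_pos_nonneg) auto
  ultimately have "inverse (norm (1 + exp \<zeta> / b n)) \<le> inverse (\<epsilon> * (1 + norm (exp \<zeta> / b n)))"
    by (rule le_imp_inverse_le)
  then show ?thesis by (simp add: field_simps)
qed

lemma norm_K_le:
  assumes "\<zeta> \<in> log_strip \<psi> \<eta> X0"
  shows "norm (K \<zeta>) \<le> real q + \<nu> (Re \<zeta>) / \<epsilon>"
proof -
  have le: "norm (exp \<zeta> / b n / (1 + exp \<zeta> / b n))
      \<le> 1 / \<epsilon> * ((exp (Re \<zeta>) / norm (b n)) / (1 + exp (Re \<zeta>) / norm (b n)))" for n
  proof -
    define w where "w = exp \<zeta> / b n"
    have "norm (w / (1 + w)) = norm w * inverse (norm (1 + w))" by (simp add: norm_divide) (simp add: divide_inverse)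
    also have "\<dots> \<le> norm w * (1 / \<epsilon> * inverse (1 + norm w))"
      using factor_quotient_le[OF assms, of n] by (intro mult_left_mono) (auto simp: w_def)
    also have "\<dots> = 1 / \<epsilon> * (norm w / (1 + norm w))" by (simp add: divide_inverse)
    finally show ?thesis by (simp add: w_def norm_divide)
  qed
  have "norm (K \<zeta> - of_nat q) \<le> (\<Sum>n. 1 / \<epsilon> * ((exp (Re \<zeta>) / norm (b n)) / (1 + exp (Re \<zeta>) / norm (b n))))"
    unfolding sums_unique[OF K_sums[OF assms]]
    by (intro norm_suminf_le le summable_mult summable_\<nu>)
  also have "\<dots> = 1 / \<epsilon> * \<nu> (Re \<zeta>)" unfolding \<nu>_def by (rule suminf_mult[OF summable_\<nu>])
  finally show ?thesis using norm_triangle_ineq[of "K \<zeta> - of_nat q" "of_nat q"] by simp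
qed

text \<open>Termwise, w/(1+w) - v/(1+v) = (w-v)/((1+w)(1+v)). The numerator is at most
  \<open>2 * norm w * norm (\<zeta> - \<xi>)\<close>, one denominator produces the term of \<nu>
  with loss \<open>1 / \<epsilon>\<close>, and the other is at least 1 in modulus.\<close>

lemma K_increment:
  assumes "\<zeta> \<in> log_strip \<psi> \<eta> X0" "\<xi> \<in> log_strip \<psi> \<eta> X0" "norm (\<zeta> - \<xi>) \<le> 1/2"
  shows "norm (K \<zeta> - K \<xi>) \<le> 2 / \<epsilon> * norm (\<zeta> - \<xi>) * \<nu> (Re \<zeta>)"
proof -
  have le: "norm (exp \<zeta> / b n / (1 + exp \<zeta> / b n) - exp \<xi> / b n / (1 + exp \<xi> / b n))
      \<le> 2 / \<epsilon> * norm (\<zeta> - \<xi>) * ((exp (Re \<zeta>) / norm (b n)) / (1 + exp (Re \<zeta>) / norm (b n)))" for n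
  proof -
    define w where "w = exp \<zeta> / b n"
    define v where "v = exp \<xi> / b n"
    have nz: "1 \<le> norm (1 + v)" "1 \<le> norm (1 + w)"
      using factor(1)[OF assms(2), of n] factor(1)[OF assms(1), of n] eps
      by (auto simp: w_def v_def intro: order_trans[rotated])
    then have "1 + v \<noteq> 0" "1 + w \<noteq> 0" by auto
    then have "w / (1 + w) - v / (1 + v) = (w - v) / ((1 + w) * (1 + v))"
      by (simp add: field_simps)
    then have "norm (w / (1 + w) - v / (1 + v)) = norm (w - v) * inverse (norm (1 + w)) * inverse (norm (1 + v))"
      by (simp add: norm_divide norm_mult) (simp add: divide_inverse)
    also have "\<dots> \<le> norm (w - v) * (1 / \<epsilon> * inverse (1 + norm w)) * 1"
      using nz factor_quotient_le[OF assms(1), of n] inverse_le_1_iff eps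
      by (intro mult_mono mult_left_mono) (auto simp: w_def field_simps)
    also have "norm (w - v) * (1 / \<epsilon> * inverse (1 + norm w)) * 1
        = norm w * norm (exp (\<xi> - \<zeta>) - 1) * (1 / \<epsilon> * inverse (1 + norm w)) * 1"
    proof -
      have "w - v = - (w * (exp (\<xi> - \<zeta>) - 1))"
        by (simp add: w_def v_def exp_diff field_simps b)
      then have "norm (w - v) = norm w * norm (exp (\<xi> - \<zeta>) - 1)"
        by (simp only: norm_minus_cancel norm_mult)
      then show ?thesis by simp
    qed
    also have "norm w * norm (exp (\<xi> - \<zeta>) - 1) * (1 / \<epsilon> * inverse (1 + norm w)) * 1
        \<le> norm w * (2 * norm (\<zeta> - \<xi>)) * (1 / \<epsilon> * inverse (1 + norm w)) * 1"
    proof (intro mult_right_mono mult_left_mono)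
      show "norm (exp (\<xi> - \<zeta>) - 1) \<le> 2 * norm (\<zeta> - \<xi>)"
        using norm_exp_bounds(2)[of "\<xi> - \<zeta>"] assms(3) norm_ge_zero[of "\<xi> - \<zeta>"]
          norm_minus_commute[of \<zeta> \<xi>] by linarith
    qed (use eps in auto)
    also have "\<dots> = 2 / \<epsilon> * norm (\<zeta> - \<xi>) * (norm w / (1 + norm w))"
      by (simp add: divide_inverse mult_ac)
    finally have "norm (w / (1 + w) - v / (1 + v)) \<le> 2 / \<epsilon> * norm (\<zeta> - \<xi>) * (norm w / (1 + norm w))" .
    moreover have "norm w = exp (Re \<zeta>) / norm (b n)" by (simp add: w_def norm_divide)
    ultimately show ?thesis unfolding w_def v_def by simp
  qed
  have "norm (K \<zeta> - K \<xi>) = norm (\<Sum>n. exp \<zeta> / b n / (1 + exp \<zeta> / b n) - exp \<xi> / b n / (1 + exp \<xi> / b n))"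
    using sums_unique[OF sums_diff[OF K_sums[OF assms(1)] K_sums[OF assms(2)]]] by simp
  also have "\<dots> \<le> (\<Sum>n. 2 / \<epsilon> * norm (\<zeta> - \<xi>) * ((exp (Re \<zeta>) / norm (b n)) / (1 + exp (Re \<zeta>) / norm (b n))))"
    by (intro norm_suminf_le le summable_mult summable_\<nu>)
  also have "\<dots> = 2 / \<epsilon> * norm (\<zeta> - \<xi>) * \<nu> (Re \<zeta>)" unfolding \<nu>_def by (rule suminf_mult[OF summable_\<nu>])
  finally show ?thesis .
qed

lemma \<nu>_mono:
  assumes "x \<le> y"
  shows "\<nu> x \<le> \<nu> y"
  unfolding \<nu>_def
proof (intro suminf_le summable_\<nu>)
  fix n
  have *: "t / (1 + t) \<le> u / (1 + u)" if "0 < t" "t \<le> u" for t u :: real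
    using that by (simp add: field_simps)
  show "(exp x / norm (b n)) / (1 + exp x / norm (b n)) \<le> (exp y / norm (b n)) / (1 + exp y / norm (b n))"
    by (rule *) (use assms b in \<open>auto intro!: divide_right_mono\<close>)
qed

text \<open>In \<open>t / (1 + t)\<close>, scaling \<open>t\<close> by \<open>exp s\<close> scales
  the numerator by this factor and can only increase the denominator.\<close>

lemma \<nu>_add_le:
  assumes "0 \<le> s"
  shows "\<nu> (x + s) \<le> exp s * \<nu> x"
proof -
  have "\<nu> (x + s) \<le> (\<Sum>n. exp s * ((exp x / norm (b n)) / (1 + exp x / norm (b n))))"
    unfolding \<nu>_def[of "x + s"]
  proof (intro suminf_le summable_\<nu> summable_mult)
    fix n
    define t where "t = exp x / norm (b n)"
    have "0 \<le> t" by (simp add: t_def)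
    then have "t \<le> exp s * t" using assms mult_right_mono[of 1 "exp s" t] by simp
    then have "exp s * t / (1 + exp s * t) \<le> exp s * t / (1 + t)"
      using \<open>0 \<le> t\<close> by (intro divide_left_mono) (auto intro!: mult_pos_pos add_pos_nonneg)
    then show "(exp (x + s) / norm (b n)) / (1 + exp (x + s) / norm (b n))
        \<le> exp s * ((exp x / norm (b n)) / (1 + exp x / norm (b n)))"
      by (simp add: t_def exp_add mult.commute)
  qed
  also have "\<dots> = exp s * \<nu> x" unfolding \<nu>_def by (rule suminf_mult[OF summable_\<nu>])
  finally show ?thesis .
qed

lemma ex_norm_b_le_exp: "\<exists>X. \<forall>x\<ge>X. \<forall>n<m. A * norm (b n) \<le> exp x"
proof -
  have "\<forall>\<^sub>F x::real in at_top. \<forall>n\<in>{..<m}. A * norm (b n) \<le> exp x"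
    by (intro eventually_ball_finite ballI) (use exp_at_top in \<open>auto simp: filterlim_at_top\<close>)
  then show ?thesis by (auto simp: eventually_at_top_linorder)
qed

lemma \<nu>_unbounded: "\<exists>X. \<forall>x\<ge>X. V \<le> \<nu> x"
proof -
  obtain m :: nat where m: "2 * V \<le> real m" using real_arch_simple by blast
  obtain X where X: "\<And>x n. x \<ge> X \<Longrightarrow> n < m \<Longrightarrow> 1 * norm (b n) \<le> exp x" using ex_norm_b_le_exp by blast
  have "V \<le> \<nu> x" if "x \<ge> X" for x
  proof -
    have half: "1/2 \<le> exp x / norm (b n) / (1 + exp x / norm (b n))" if "n < m" for n
    proof -
      have "0 < norm (b n)" using b by simp
      then have "1 \<le> exp x / norm (b n)" using X[OF \<open>x \<ge> X\<close> that] by simp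
      moreover have "1/2 \<le> t / (1 + t)" if "1 \<le> t" for t :: real using that by (simp add: field_simps)
      ultimately show ?thesis by blast
    qed
    have "V \<le> (\<Sum>n<m. 1/2)" using m by simp
    also have "\<dots> \<le> (\<Sum>n<m. exp x / norm (b n) / (1 + exp x / norm (b n)))"
      using half by (intro sum_mono) auto
    also have "\<dots> \<le> \<nu> x"
      unfolding \<nu>_def by (intro sum_le_suminf summable_\<nu>) (auto intro!: divide_nonneg_nonneg)
    finally show ?thesis .
  qed
  then show ?thesis by blast
qed

text \<open>Factors are compared one by one. With
  \<open>y = \<epsilon> / 2 * exp (Re \<zeta>) / norm (b k)\<close>, the factor at \<open>w\<close>
  is at most \<open>1 + y\<close> and the factor at \<open>exp \<zeta>\<close> at least
  \<open>1 + 2 * y\<close>. Where \<open>y \<ge> 1\<close> their quotient is at least 3/2, and far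
  out this holds for as many factors as are needed to beat \<open>A\<close>.\<close>

lemma growth:
  "\<exists>X. \<forall>\<zeta>\<in>log_strip \<psi> \<eta> X0. X \<le> Re \<zeta> \<longrightarrow> (\<forall>w. norm w \<le> \<epsilon> / 2 * exp (Re \<zeta>) \<longrightarrow> A * norm (f w) \<le> norm (f (exp \<zeta>)))"
proof -
  obtain m where m: "A \<le> (3/2) ^ m" using real_arch_pow[of "3/2" A] by (auto intro: less_imp_le)
  obtain X where X: "\<And>x n. x \<ge> X \<Longrightarrow> n < m \<Longrightarrow> 2 / \<epsilon> * norm (b n) \<le> exp x" using ex_norm_b_le_exp by blast
  have "A * norm (f w) \<le> norm (f (exp \<zeta>))"
    if \<zeta>: "\<zeta> \<in> log_strip \<psi> \<eta> X0" "X \<le> Re \<zeta>" and w: "norm w \<le> \<epsilon> / 2 * exp (Re \<zeta>)" for \<zeta> w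
  proof -
    define t where "t n = (if n < m then 3/2 else 1::real)" for n
    have tm: "t k * norm (1 + w / b k) \<le> norm (1 + exp \<zeta> / b k)" for k
    proof -
      define y where "y = \<epsilon> / 2 * exp (Re \<zeta>) / norm (b k)"
      have y0: "0 \<le> y" using eps by (simp add: y_def)
      have "norm (1 + w / b k) \<le> 1 + norm (w / b k)" by (metis norm_one norm_triangle_ineq)
      also have "norm (w / b k) \<le> y" unfolding y_def norm_divide by (rule divide_right_mono[OF w]) simp
      finally have 1: "norm (1 + w / b k) \<le> 1 + y" by simp
      have 2: "1 + 2 * y \<le> norm (1 + exp \<zeta> / b k)"
        using factor(1)[OF \<zeta>(1), of k] by (simp add: y_def norm_divide mult.commute)
      have "t k * (1 + y) \<le> 1 + 2 * y"
      proof (cases "k < m")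
        case True
        have "2 / \<epsilon> * norm (b k) \<le> exp (Re \<zeta>)" by (rule X[OF \<zeta>(2) True])
        then have "1 \<le> y" using eps b[of k] by (simp add: y_def field_simps)
        then show ?thesis using True by (simp add: t_def)
      qed (use y0 in \<open>simp add: t_def\<close>)
      moreover have "t k * norm (1 + w / b k) \<le> t k * (1 + y)"
        using 1 by (intro mult_left_mono) (auto simp: t_def)
      ultimately show ?thesis using 2 by linarith
    qed
    have zq: "norm w ^ q \<le> norm (exp \<zeta>) ^ q"
    proof (rule power_mono)
      have "\<epsilon> / 2 * exp (Re \<zeta>) \<le> 1 * exp (Re \<zeta>)" using eps by (intro mult_right_mono) auto
      then show "norm w \<le> norm (exp \<zeta>)" unfolding norm_exp_eq_Re using w by linarith
    qed simp
    have prod: "(3/2) ^ m * (\<Prod>k<n. norm (1 + w / b k)) \<le> (\<Prod>k<n. norm (1 + exp \<zeta> / b k))" if "m \<le> n" for n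
    proof -
      have "(\<Prod>k<n. t k) = (\<Prod>k\<in>{..<m}. 3/2)"
        by (rule prod.mono_neutral_cong_right) (use that in \<open>auto simp: t_def\<close>)
      then have "(3/2) ^ m * (\<Prod>k<n. norm (1 + w / b k)) = (\<Prod>k<n. t k * norm (1 + w / b k))"
        by (simp add: prod.distrib)
      also have "\<dots> \<le> (\<Prod>k<n. norm (1 + exp \<zeta> / b k))"
        by (intro prod_mono conjI tm) (simp add: t_def)
      finally show ?thesis .
    qed
    have "(3/2) ^ m * norm (f w) \<le> norm (f (exp \<zeta>))"
    proof (rule tendsto_le)
      show "(\<lambda>n. (3/2) ^ m * (norm c * norm w ^ q * (\<Prod>k<n. norm (1 + w / b k)))) \<longlonglongrightarrow> (3/2) ^ m * norm (f w)"
        by (intro tendsto_intros norm_flim)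
      show "\<forall>\<^sub>F n in sequentially. (3/2) ^ m * (norm c * norm w ^ q * (\<Prod>k<n. norm (1 + w / b k)))
          \<le> norm c * norm (exp \<zeta>) ^ q * (\<Prod>k<n. norm (1 + exp \<zeta> / b k))"
        using eventually_ge_at_top[of m]
      proof eventually_elim
        case (elim n)
        have "norm c * norm w ^ q * ((3/2) ^ m * (\<Prod>k<n. norm (1 + w / b k)))
            \<le> norm c * norm (exp \<zeta>) ^ q * (\<Prod>k<n. norm (1 + exp \<zeta> / b k))"
          by (intro mult_mono mult_left_mono zq prod[OF elim]) (auto intro!: prod_nonneg mult_nonneg_nonneg)
        then show ?case by (simp add: mult_ac)
      qed
    qed (rule trivial_limit_sequentially norm_flim)+
    moreover have "A * norm (f w) \<le> (3/2) ^ m * norm (f w)" using m by (intro mult_right_mono) auto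
    ultimately show ?thesis by linarith
  qed
  then show ?thesis by blast
qed

end

section \<open>Verification of the dynamical assumptions and value of the dimension\<close>

context sector_product begin

lemma transcendental_log_dynamics:
  assumes tr: "transcendental_entire f" and eta: "0 < \<eta>"
  shows "\<exists>X1. log_dynamics f K \<nu> \<psi> \<eta> X1 \<epsilon> (1 / \<epsilon> + 2 / \<epsilon> + 1) \<and> 2 / \<epsilon> \<le> \<nu> X1 \<and>
    (\<forall>\<zeta>\<in>log_strip \<psi> \<eta> X1. \<forall>w. norm w \<le> \<epsilon> / 2 * exp (Re \<zeta>) \<longrightarrow> 2 / \<epsilon> * norm (f w) \<le> norm (f (exp \<zeta>)))"
proof -
  obtain R where R: "0 < R" "\<And>r. r \<ge> R \<Longrightarrow> r < max_modulus f r"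
    using ex_admissible_radius[OF tr] by (auto simp: admissible_radius_def)
  have hol: "f holomorphic_on UNIV" using tr by (simp add: transcendental_entire_def)
  \<comment> \<open>Combined with \<open>max_modulus f r > r\<close> at
    \<open>r = \<epsilon> / 2 * exp (Re \<zeta>)\<close>, the constant \<open>6 / \<epsilon>\<close>
    produces the factor 3 of \<open>f_grows\<close>.\<close>
  obtain X2 where X2: "\<And>\<zeta> w. \<zeta> \<in> log_strip \<psi> \<eta> X0 \<Longrightarrow> X2 \<le> Re \<zeta> \<Longrightarrow> norm w \<le> \<epsilon> / 2 * exp (Re \<zeta>) \<Longrightarrow>
      6 / \<epsilon> * norm (f w) \<le> norm (f (exp \<zeta>))"
    using growth[of "6 / \<epsilon>"] by blast
  \<comment> \<open>\<open>q \<le> \<nu>\<close> absorbs the zero at the origin into the bound for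
    \<open>K\<close>; \<open>2 / \<epsilon> \<le> \<nu>\<close> makes \<open>Re K\<close> at least
    2, the expansion needed for the Julia set.\<close>
  obtain X3 where X3: "\<And>x. x \<ge> X3 \<Longrightarrow> max (real q) (2 / \<epsilon>) \<le> \<nu> x" using \<nu>_unbounded by blast
  define X1 where "X1 = max (max X0 X2) (max X3 (ln (2 * R / \<epsilon>)))"
  have X1: "X0 \<le> X1" "X2 \<le> X1" "X3 \<le> X1" "ln (2 * R / \<epsilon>) \<le> X1" by (simp_all add: X1_def)
  have sub: "log_strip \<psi> \<eta> X1 \<subseteq> log_strip \<psi> \<eta> X0" by (rule log_strip_mono[OF X1(1)])
  have gr: "6 / \<epsilon> * norm (f w) \<le> norm (f (exp \<zeta>))"
    if "\<zeta> \<in> log_strip \<psi> \<eta> X1" "norm w \<le> \<epsilon> / 2 * exp (Re \<zeta>)" for \<zeta> w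
    using that sub X1 by (intro X2) (auto simp: log_strip_def)
  have \<nu>1: "real q \<le> \<nu> (Re \<zeta>)" "0 \<le> \<nu> (Re \<zeta>)" if "\<zeta> \<in> log_strip \<psi> \<eta> X1" for \<zeta>
    using X3[of "Re \<zeta>"] that X1 eps by (auto simp: log_strip_def intro: order_trans[rotated])
  have "log_dynamics f K \<nu> \<psi> \<eta> X1 \<epsilon> (1 / \<epsilon> + 2 / \<epsilon> + 1)"
  proof
    fix \<zeta> assume \<zeta>: "\<zeta> \<in> log_strip \<psi> \<eta> X1"
    then have \<zeta>0: "\<zeta> \<in> log_strip \<psi> \<eta> X0" using sub by blast
    show "f (exp \<zeta>) \<noteq> 0" by (rule f_nonzero[OF \<zeta>0])
    show "\<epsilon> * \<nu> (Re \<zeta>) \<le> Re (K \<zeta>)" by (rule Re_K_ge[OF \<zeta>0])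
    have "norm (K \<zeta>) \<le> real q + \<nu> (Re \<zeta>) / \<epsilon>" by (rule norm_K_le[OF \<zeta>0])
    also have "\<dots> \<le> \<nu> (Re \<zeta>) + \<nu> (Re \<zeta>) / \<epsilon> + 2 / \<epsilon> * \<nu> (Re \<zeta>)"
    proof -
      have "0 \<le> 2 / \<epsilon> * \<nu> (Re \<zeta>)" using \<nu>1[OF \<zeta>] eps by (intro mult_nonneg_nonneg) auto
      then show ?thesis using \<nu>1[OF \<zeta>] by linarith
    qed
    finally show "norm (K \<zeta>) \<le> (1 / \<epsilon> + 2 / \<epsilon> + 1) * \<nu> (Re \<zeta>)" by (simp add: algebra_simps)
    show "norm (K \<zeta> - K \<xi>) \<le> (1 / \<epsilon> + 2 / \<epsilon> + 1) * norm (\<zeta> - \<xi>) * \<nu> (Re \<zeta>)"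
      if "\<xi> \<in> log_strip \<psi> \<eta> X1" "norm (\<zeta> - \<xi>) \<le> 1/2" for \<xi>
    proof -
      have "norm (K \<zeta> - K \<xi>) \<le> 2 / \<epsilon> * norm (\<zeta> - \<xi>) * \<nu> (Re \<zeta>)"
        by (rule K_increment) (use \<zeta>0 sub that in auto)
      also have "\<dots> \<le> (1 / \<epsilon> + 2 / \<epsilon> + 1) * norm (\<zeta> - \<xi>) * \<nu> (Re \<zeta>)"
      proof -
        have "0 \<le> 1 / \<epsilon>" using eps by simp
        then have "2 / \<epsilon> \<le> 1 / \<epsilon> + 2 / \<epsilon> + 1" by linarith
        then show ?thesis using \<nu>1[OF \<zeta>] by (intro mult_right_mono) auto
      qed
      finally show ?thesis .
    qed
    show "3 * exp (Re \<zeta>) \<le> norm (f (exp \<zeta>))"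
    proof -
      define r where "r = \<epsilon> / 2 * exp (Re \<zeta>)"
      have "2 * R / \<epsilon> = exp (ln (2 * R / \<epsilon>))" using R(1) eps by simp
      also have "\<dots> \<le> exp X1" using X1(4) by simp
      also have "\<dots> \<le> exp (Re \<zeta>)" using \<zeta> by (simp add: log_strip_def)
      finally have "R \<le> r" using eps by (simp add: r_def field_simps)
      then have "r < max_modulus f r" by (rule R(2))
      moreover have "max_modulus f r \<le> norm (f (exp \<zeta>)) * (\<epsilon> / 6)"
        unfolding max_modulus_def
      proof (rule cSUP_least)
        show "sphere 0 r \<noteq> ({} :: complex set)" using \<open>R \<le> r\<close> R(1) by simp
        fix w :: complex assume "w \<in> sphere 0 r"
        then have "6 / \<epsilon> * norm (f w) \<le> norm (f (exp \<zeta>))" by (intro gr[OF \<zeta>]) (simp add: r_def)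
        then show "norm (f w) \<le> norm (f (exp \<zeta>)) * (\<epsilon> / 6)" using eps by (simp add: field_simps)
      qed
      ultimately have "\<epsilon> / 2 * exp (Re \<zeta>) < norm (f (exp \<zeta>)) * (\<epsilon> / 6)" by (simp only: r_def)
      then have "\<epsilon> * (3 * exp (Re \<zeta>)) < \<epsilon> * norm (f (exp \<zeta>))" by (simp add: mult_ac)
      then show ?thesis using eps by (simp only: mult_less_cancel_left_pos less_imp_le)
    qed
  qed (use hol eta eps \<nu>_mono \<nu>_add_le \<nu>_unbounded in \<open>auto simp: K_def\<close>)
  moreover have "2 / \<epsilon> * norm (f w) \<le> norm (f (exp \<zeta>))"
    if "\<zeta> \<in> log_strip \<psi> \<eta> X1" "norm w \<le> \<epsilon> / 2 * exp (Re \<zeta>)" for \<zeta> w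
  proof -
    have "2 / \<epsilon> * norm (f w) \<le> 6 / \<epsilon> * norm (f w)" using eps by (intro mult_right_mono divide_right_mono) auto
    then show ?thesis using gr[OF that] by linarith
  qed
  moreover have "2 / \<epsilon> \<le> \<nu> X1" using X3[OF X1(3)] by simp
  ultimately show ?thesis by blast
qed

lemma itinerary_subset_julia_fast_escaping:
  assumes tr: "transcendental_entire f"
    and sc: "\<not> (\<exists>U \<in> components (fatou_set f). multiply_connected U)"
    and R: "admissible_radius f R"
    and dyn: "log_dynamics f K \<nu> \<psi> \<eta> X1 \<epsilon> C" and X1: "2 / \<epsilon> \<le> \<nu> X1"
    and dom: "\<And>\<zeta> w. \<zeta> \<in> log_strip \<psi> \<eta> X1 \<Longrightarrow> norm w \<le> \<epsilon> / 2 * exp (Re \<zeta>) \<Longrightarrow> 2 / \<epsilon> * norm (f w) \<le> norm (f (exp \<zeta>))"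
    and X: "X1 \<le> X"
  shows "{z. \<forall>n. (f ^^ n) z \<in> exp ` log_strip \<psi> \<eta> X} \<subseteq> julia_set f \<inter> fast_escaping_set R f"
proof
  interpret log_dynamics f K \<nu> \<psi> \<eta> X1 \<epsilon> C by (rule dyn)
  fix z assume "z \<in> {z. \<forall>n. (f ^^ n) z \<in> exp ` log_strip \<psi> \<eta> X}"
  then have "\<exists>\<zeta>. \<zeta> \<in> log_strip \<psi> \<eta> X1 \<and> (f ^^ n) z = exp \<zeta>" for n
    using log_strip_mono[OF X] by blast
  then obtain \<zeta> where \<zeta>: "\<And>n. \<zeta> n \<in> log_strip \<psi> \<eta> X1" "\<And>n. (f ^^ n) z = exp (\<zeta> n)" by metis
  have "3 * norm ((f ^^ n) z) \<le> norm ((f ^^ Suc n) z)" for n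
    using f_grows[OF \<zeta>(1)[of n]] \<zeta>(2)[of n] by simp
  then have pow: "3 ^ n * norm z \<le> norm ((f ^^ n) z)" for n
  proof (induction n)
    case (Suc n)
    then have "3 * (3 ^ n * norm z) \<le> 3 * norm ((f ^^ n) z)" by simp
    also have "\<dots> \<le> norm ((f ^^ Suc n) z)" by (rule Suc.prems)
    finally show ?case by simp
  qed simp
  have "z \<noteq> 0" using \<zeta>(2)[of 0] by simp
  then have "filterlim (\<lambda>n. 3 ^ n * norm z) at_top sequentially" by real_asymp
  then have esc: "filterlim (\<lambda>n. norm ((f ^^ n) z)) at_top sequentially"
    by (rule filterlim_at_top_mono) (use pow in auto)
  have "z \<in> julia_set f"
  proof (rule expanding_escaping_point_in_julia_set[OF tr sc esc])
    fix n
    have "2 \<le> \<epsilon> * \<nu> X1" using X1 eps by (simp add: field_simps)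
    also have "\<dots> \<le> \<epsilon> * \<nu> (Re (\<zeta> n))"
      using \<zeta>(1)[of n] eps by (intro mult_left_mono \<nu>_mono) (auto simp: log_strip_def)
    also have "\<dots> \<le> norm (K (\<zeta> n))" using Re_K[OF \<zeta>(1)[of n]] complex_Re_le_cmod order_trans by blast
    finally have "2 * norm (f (exp (\<zeta> n))) \<le> norm (K (\<zeta> n)) * norm (f (exp (\<zeta> n)))" by (rule mult_right_mono) simp
    also have "\<dots> = norm (deriv f (exp (\<zeta> n))) * norm (exp (\<zeta> n))"
      using nz[OF \<zeta>(1)[of n]] by (simp add: K_def norm_mult norm_divide)
    finally show "2 * norm (f ((f ^^ n) z)) \<le> norm (deriv f ((f ^^ n) z)) * norm ((f ^^ n) z)"
      by (simp add: \<zeta>(2))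
  qed
  moreover have "z \<in> fast_escaping_set R f"
  proof -
    have "\<forall>\<^sub>F n in sequentially. 2 / \<epsilon> * R \<le> norm ((f ^^ n) z)" using esc by (simp add: filterlim_at_top)
    then obtain l where l: "2 / \<epsilon> * R \<le> norm ((f ^^ l) z)" by (auto dest: eventually_happens)
    have Rr: "0 < R" "\<And>r. r \<ge> R \<Longrightarrow> r < max_modulus f r" using R by (auto simp: admissible_radius_def)
    \<comment> \<open>The factor \<open>2 / \<epsilon>\<close> makes the induction work:
      \<open>dom\<close> controls \<open>f\<close> only on circles smaller by
      \<open>\<epsilon> / 2\<close> and returns the same factor for the next step.\<close>
    have "R \<le> (max_modulus f ^^ n) R \<and> 2 / \<epsilon> * (max_modulus f ^^ n) R \<le> norm ((f ^^ (n + l)) z)" for n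
    proof (induction n)
      case (Suc n)
      define r where "r = (max_modulus f ^^ n) R"
      have r: "R \<le> r" "2 / \<epsilon> * r \<le> norm ((f ^^ (n + l)) z)" using Suc by (simp_all add: r_def)
      have "max_modulus f r \<le> norm ((f ^^ (Suc n + l)) z) * (\<epsilon> / 2)"
        unfolding max_modulus_def
      proof (rule cSUP_least)
        show "sphere 0 r \<noteq> ({} :: complex set)" using r Rr(1) by simp
        fix w :: complex assume "w \<in> sphere 0 r"
        then have "norm w \<le> \<epsilon> / 2 * exp (Re (\<zeta> (n + l)))" using r(2) eps by (simp add: \<zeta>(2) field_simps)
        from dom[OF \<zeta>(1) this] show "norm (f w) \<le> norm ((f ^^ (Suc n + l)) z) * (\<epsilon> / 2)"
          using eps by (simp add: \<zeta>(2) field_simps)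
      qed
      then have "2 / \<epsilon> * max_modulus f r \<le> norm ((f ^^ (Suc n + l)) z)" using eps by (simp add: field_simps)
      moreover have "R \<le> max_modulus f r" using Rr(2)[OF r(1)] r(1) by simp
      ultimately show ?case by (simp add: r_def)
    qed (use l in simp)
    moreover have "(max_modulus f ^^ n) R \<le> 2 / \<epsilon> * (max_modulus f ^^ n) R" if "R \<le> (max_modulus f ^^ n) R" for n
    proof -
      have "1 \<le> 2 / \<epsilon>" using eps by simp
      then show ?thesis using that Rr(1) mult_right_mono[of 1 "2 / \<epsilon>" "(max_modulus f ^^ n) R"] by simp
    qed
    ultimately have "(max_modulus f ^^ n) R \<le> norm ((f ^^ (n + l)) z)" for n by (meson order_trans)
    then show ?thesis unfolding fast_escaping_set_def by blast
  qed
  ultimately show "z \<in> julia_set f \<inter> fast_escaping_set R f" by blast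
qed

text \<open>The orbit sets depend on \<open>s\<close> through \<open>X\<close>, but all lie in the
  same set, so \<open>s\<close> may tend to 2.\<close>

lemma hausdorff_dim_julia_fast_escaping:
  assumes tr: "transcendental_entire f" and eta: "0 < \<eta>"
    and sc: "\<not> (\<exists>U \<in> components (fatou_set f). multiply_connected U)"
    and R: "admissible_radius f R"
  shows "hausdorff_dim (julia_set f \<inter> fast_escaping_set R f) = 2"
proof (rule antisym)
  obtain X1 where X1: "log_dynamics f K \<nu> \<psi> \<eta> X1 \<epsilon> (1 / \<epsilon> + 2 / \<epsilon> + 1)" "2 / \<epsilon> \<le> \<nu> X1"
    "\<And>\<zeta> w. \<zeta> \<in> log_strip \<psi> \<eta> X1 \<Longrightarrow> norm w \<le> \<epsilon> / 2 * exp (Re \<zeta>) \<Longrightarrow> 2 / \<epsilon> * norm (f w) \<le> norm (f (exp \<zeta>))"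
    using transcendental_log_dynamics[OF tr eta] by blast
  have "hausdorff_measure s (julia_set f \<inter> fast_escaping_set R f) \<noteq> 0" if s: "1 \<le> s" "s < 2" for s
  proof -
    obtain X where X: "X1 \<le> X" "hausdorff_measure s {z. \<forall>n. (f ^^ n) z \<in> exp ` log_strip \<psi> \<eta> X} \<noteq> 0"
      using log_dynamics.hausdorff_measure_itinerary_nonzero[OF X1(1), of s X1] s by auto
    then show ?thesis
      using hausdorff_measure_mono[OF itinerary_subset_julia_fast_escaping[OF tr sc R X1 X(1)], of s] by auto
  qed
  then have "ennreal 2 \<le> hausdorff_dim (julia_set f \<inter> fast_escaping_set R f)"
    by (rule hausdorff_dim_geI) auto
  then show "2 \<le> hausdorff_dim (julia_set f \<inter> fast_escaping_set R f)" by simp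
qed (rule hausdorff_dim_complex_le)

end

lemma cos_ge_of_abs_le:
  assumes "\<bar>x\<bar> \<le> y" "y \<le> pi"
  shows "cos y \<le> cos x"
  using cos_monotone_0_pi_le[of "\<bar>x\<bar>" y] assms by simp

theorem theorem1p2:
  fixes f :: "complex \<Rightarrow> complex" and c :: complex and q :: nat
    and a :: "nat \<Rightarrow> complex" and \<theta>\<^sub>1 \<theta>\<^sub>2 R :: real and N\<^sub>0 :: nat
  assumes "transcendental_entire f"
    and "c \<noteq> 0"
    and "\<And>n. n \<ge> 1 \<Longrightarrow> 0 < norm (a n)"
    and "\<And>m n. 1 \<le> m \<Longrightarrow> m \<le> n \<Longrightarrow> norm (a m) \<le> norm (a n)"
    and "summable (\<lambda>n. 1 / norm (a (Suc n)))"
    and "\<And>z. f z = c * z ^ q * (\<Prod>n. 1 + z / a (Suc n))"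
    and "0 < \<theta>\<^sub>1" and "0 < \<theta>\<^sub>2" and "0 \<le> \<theta>\<^sub>2 - \<theta>\<^sub>1" and "\<theta>\<^sub>2 - \<theta>\<^sub>1 < pi"
    and "N\<^sub>0 \<ge> 1"
    and "\<And>n. n \<ge> N\<^sub>0 \<Longrightarrow> \<exists>k::int. Arg (a n) + 2 * pi * of_int k \<in> {\<theta>\<^sub>1..\<theta>\<^sub>2}"
    and "\<not> (\<exists>U \<in> components (fatou_set f). multiply_connected U)"
    and "admissible_radius f R"
  shows "hausdorff_dim (julia_set f \<inter> fast_escaping_set R f) = 2"
proof -
  \<comment> \<open>The nonzero zeros of \<open>f\<close> are \<open>- a n\<close>, so the bisector
    of the sector containing almost all \<open>a n\<close> points away from almost all of
    them.\<close>
  define \<psi> where "\<psi> = (\<theta>\<^sub>1 + \<theta>\<^sub>2) / 2"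
  \<comment> \<open>A quarter of the available gap: directions within \<eta> of \<psi> differ from
    the argument of \<open>a n\<close>, for \<open>n \<ge> N\<^sub>0\<close>, by at most
    \<open>pi / 2 - \<eta>\<close>, and the cosine is then at least
    \<open>sin \<eta>\<close>.\<close>
  define \<eta> where "\<eta> = (pi - (\<theta>\<^sub>2 - \<theta>\<^sub>1)) / 4"
  define \<epsilon> where "\<epsilon> = min (sin \<eta>) (1/2)"
  have eta: "0 < \<eta>" "\<eta> \<le> pi / 4" using assms(9,10) by (auto simp: \<eta>_def)
  have "0 < sin \<eta>" by (rule sin_gt_zero) (use eta pi_gt_zero in linarith)+
  then have eps: "0 < \<epsilon>" "\<epsilon> \<le> 1/2" "\<epsilon> \<le> sin \<eta>" by (auto simp: \<epsilon>_def)
  \<comment> \<open>The indices below \<open>N\<^sub>0\<close> carry no condition on the argument;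
    beyond radius \<open>4 * Y\<close> their quotients satisfy
    \<open>norm (z / a n) \<ge> 4\<close>. Including \<open>a 0\<close> can only enlarge
    \<open>Y\<close>.\<close>
  define Y where "Y = Max ((\<lambda>n. norm (a n)) ` {..N\<^sub>0})"
  have Y: "norm (a n) \<le> Y" if "n \<le> N\<^sub>0" for n unfolding Y_def by (rule Max_ge) (use that in auto)
  have Y1: "0 < Y" using Y[OF assms(11)] assms(3)[of 1] by linarith
  define X0 where "X0 = ln (4 * Y)"
  have anz: "a (Suc n) \<noteq> 0" for n using assms(3)[of "Suc n"] by auto
  have dich: "\<epsilon> * norm (exp \<zeta> / a (Suc n)) \<le> Re (exp \<zeta> / a (Suc n)) \<or> 4 \<le> norm (exp \<zeta> / a (Suc n))"
    if \<zeta>: "\<zeta> \<in> log_strip \<psi> \<eta> X0" for \<zeta> n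
  proof (cases "Suc n \<ge> N\<^sub>0")
    case True
    then obtain k :: int where k: "Arg (a (Suc n)) + 2 * pi * of_int k \<in> {\<theta>\<^sub>1..\<theta>\<^sub>2}" using assms(12) by blast
    define \<phi> where "\<phi> = Arg (a (Suc n)) + 2 * pi * of_int k"
    define r where "r = norm (a (Suc n))"
    define \<rho> where "\<rho> = exp (Re \<zeta>) / r"
    have "a (Suc n) = of_real (norm (a (Suc n))) * exp (\<i> * of_real (Arg (a (Suc n))))"
      using Arg_eq[OF anz] by simp
    also have "exp (\<i> * of_real (Arg (a (Suc n)))) = exp (\<i> * of_real \<phi>)"
    proof -
      have "\<i> * of_real \<phi> = \<i> * of_real (Arg (a (Suc n))) + 2 * of_int k * of_real pi * \<i>"
        by (simp add: \<phi>_def algebra_simps)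
      then show ?thesis using exp_integer_2pi[of "of_int k"] by (simp add: exp_add)
    qed
    finally have an: "a (Suc n) = of_real r * exp (\<i> * of_real \<phi>)" by (simp only: r_def)
    have "exp \<zeta> = of_real (exp (Re \<zeta>)) * exp (\<i> * of_real (Im \<zeta>))"
      using exp_eq_polar[of \<zeta>] by (simp only: cis_conv_exp)
    then have "exp \<zeta> / a (Suc n) = of_real \<rho> * exp (\<i> * of_real (Im \<zeta> - \<phi>))"
      unfolding an by (simp add: \<rho>_def exp_diff right_diff_distrib)
    then have Re: "Re (exp \<zeta> / a (Suc n)) = \<rho> * cos (Im \<zeta> - \<phi>)" and nm: "norm (exp \<zeta> / a (Suc n)) = \<rho>"
      by (simp_all add: \<rho>_def r_def Re_exp norm_mult norm_divide)
    have "\<bar>\<phi> - \<psi>\<bar> \<le> (\<theta>\<^sub>2 - \<theta>\<^sub>1) / 2" using k unfolding \<phi>_def[symmetric] \<psi>_def by (auto simp: abs_le_iff field_simps)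
    moreover have "\<bar>Im \<zeta> - \<psi>\<bar> < \<eta>" using \<zeta> by (simp add: log_strip_def)
    ultimately have "\<bar>Im \<zeta> - \<phi>\<bar> \<le> \<eta> + (\<theta>\<^sub>2 - \<theta>\<^sub>1) / 2" by linarith
    also have "\<dots> = pi / 2 - \<eta>" by (simp add: \<eta>_def field_simps)
    finally have "cos (pi / 2 - \<eta>) \<le> cos (Im \<zeta> - \<phi>)" by (rule cos_ge_of_abs_le) (use eta in simp)
    then have "\<epsilon> \<le> cos (Im \<zeta> - \<phi>)" using eps(3) by (simp add: cos_diff)
    then have "\<rho> * \<epsilon> \<le> \<rho> * cos (Im \<zeta> - \<phi>)" by (intro mult_left_mono) (auto simp: \<rho>_def r_def)
    then show ?thesis by (simp add: Re nm mult.commute)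
  next
    case False
    then have "4 * norm (a (Suc n)) \<le> 4 * Y" using Y by simp
    also have "\<dots> = exp X0" using Y1 by (simp add: X0_def)
    also have "\<dots> \<le> exp (Re \<zeta>)" using \<zeta> by (simp add: log_strip_def)
    finally show ?thesis using assms(3)[of "Suc n"] by (simp add: norm_divide le_divide_eq)
  qed
  interpret sector_product f c q "\<lambda>n. a (Suc n)" \<psi> \<eta> \<epsilon> X0
  proof
    fix \<zeta> n assume "\<zeta> \<in> log_strip \<psi> \<eta> X0"
    note d = dich[OF this, of n]
    show "1 + \<epsilon> * norm (exp \<zeta> / a (Suc n)) \<le> norm (1 + exp \<zeta> / a (Suc n))"
      using d sector_factor_bounds(1)[OF eps(1), of "exp \<zeta> / a (Suc n)"]
        large_factor_bounds(1)[OF eps(1,2), of "exp \<zeta> / a (Suc n)"] eps(2) by auto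
    show "\<epsilon> * (norm (exp \<zeta> / a (Suc n)) / (1 + norm (exp \<zeta> / a (Suc n)))) \<le> Re (exp \<zeta> / a (Suc n) / (1 + exp \<zeta> / a (Suc n)))"
      using d sector_factor_bounds(2)[OF eps(1), of "exp \<zeta> / a (Suc n)"]
        large_factor_bounds(2)[OF eps(1,2), of "exp \<zeta> / a (Suc n)"] eps(2) by auto
  qed (use assms anz eps in auto)
  show ?thesis by (rule hausdorff_dim_julia_fast_escaping[OF assms(1) eta(1) assms(13,14)])
qed

end
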